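(* Let $d\ge 2$ and let $L=(G,p)$ be a connected linkage in $\mathbb{R}^d$, with $G=(V,E)$, $n=|V|$ vertices and $m=|E|\leq nd-\binom{d+1}{2}$ edges, such that: (a) the $m$ edges impose infinitesimally independent constraints; (b) there are $d$ marked pairs of vertices $\{v_{i(k)},v_{j(k)}\}\subset V$, $k=1,\dots,d$, with the corresponding vectors $\lambda_k=p(v_{j(k)})-p(v_{i(k)})$, $k=1,\dots,d$, providing a basis of $\mathbb{R}^d$. Then there is a unique periodic framework $\tilde L=(\tilde G,\Gamma,\tilde p,\pi)$ in $\mathbb{R}^d$ with the following four properties: (i) the periodicity group $\Gamma$ is identified with the lattice $\Lambda=\{\sum_{k=1}^d n_k\lambda_k : n_k\in\mathbb{Z}\}$ generated by the given basis; (ii) the linkage $L$ is contained in the framework $\tilde L$; (iii) the edges of $L$ provide a complete set of representatives for the edge orbits of $\tilde L$ under periodicity (that is, under $\Gamma$); (iv) every vertex orbit of $\tilde L$ has at least one representative in $L$. This unique associated periodic framework $\tilde L$ has $\tilde n=n-d$ vertex orbits and $\tilde m=m$ edge orbits, and the local deformation spaces of $L$ and $\tilde L$ can be identified. Their common dimension is $$f=nd-m-\binom{d+1}{2}=\tilde n d-\tilde m+\binom{d}{2}.$$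
   Context: Linkages. A linkage in $\mathbb{R}^d$ is a pair $L=(G,p)$ where $G=(V,E)$ is a finite simple connected graph and $p:V\to\mathbb{R}^d$ is a placement of the vertices with $p(u)\ne p(v)$ for every edge $(u,v)\in E$. Edges are conceived as rigid straight bars and vertices as spherical joints; linkages differing by a Euclidean isometry of $\mathbb{R}^d$ are identified. The edge constraints are infinitesimally independent if the rows of the rigidity matrix (i.e. the $|E|$ linear functionals $(\dot p_v)_{v\in V}\mapsto\langle p(u)-p(v),\dot p_u-\dot p_v\rangle$, $(u,v)\in E$) are linearly independent. The local deformation space of $L$ is the space of placements near $p$ with the same edge lengths, modulo Euclidean isometries. In each marked pair the two vertices are distinct, but different marked pairs may share one vertex. Periodic frameworks. A $d$-periodic graph is a pair $(\tilde G,\Gamma)$, where $\tilde G=(\tilde V,\tilde E)$ is a simple infinite graph with finite degree at every vertex and $\Gamma\subset \mathrm{Aut}(\tilde G)$ is a free Abelian group of automorphisms of rank $d$ (the periodicity group), acting without fixed points on vertices and edges and with finitely many vertex and edge orbits. A $d$-periodic framework $(\tilde G,\Gamma,\tilde p,\pi)$ in $\mathbb{R}^d$ consists in addition of a function $\tilde p:\tilde V\to\mathbb{R}^d$ and an injective homomorphism $\pi$ from $\Gamma$ to the group of translations of $\mathbb{R}^d$, with $\pi(\Gamma)$ a lattice of rank $d$, such that $\tilde p(\gamma v)=\pi(\gamma)(\tilde p(v))$ for all $\gamma\in\Gamma$, $v\in\tilde V$, and such that the endpoints of every edge have distinct images. Two frameworks are considered equivalent when one is obtained from the other by a Euclidean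 isometry. The local deformation space of a periodic framework is the space of periodic placements $(\tilde p',\pi')$ of $(\tilde G,\Gamma)$ near $(\tilde p,\pi)$ with the same edge lengths ($\pi'$ is allowed to differ from $\pi$), modulo Euclidean isometries.
   Formalization: The framework must also satisfy: two vertices of L lie in one Γ-orbit exactly when linked by a chain of marked pairs. Without this, uniqueness and the count n−d fail: the disjoint Λ-translates of L also satisfy (i)–(iv), with n vertex orbits. *)

theory Defs
  imports
    "HOL-Analysis.Analysis"
    "HOL-Algebra.Group_Action"
    "HOL-Algebra.Free_Abelian_Groups"
begin

section \<open>Graphs and linkages\<close>

definition simple_graph :: "'v set \<Rightarrow> 'v set set \<Rightarrow> bool" where
  "simple_graph V E \<longleftrightarrow> (\<forall>e\<in>E. e \<subseteq> V \<and> card e = 2)"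

definition connected_graph :: "'v set \<Rightarrow> 'v set set \<Rightarrow> bool" where
  "connected_graph V E \<longleftrightarrow> V \<noteq> {} \<and> (\<forall>u\<in>V. \<forall>v\<in>V. (\<lambda>x y. {x, y} \<in> E)\<^sup>*\<^sup>* u v)"

text \<open>Placements are only relevant on the vertex set; they need not be injective.\<close>

definition linkage :: "'v set \<Rightarrow> 'v set set \<Rightarrow> ('v \<Rightarrow> real ^ 'd) \<Rightarrow> bool" where
  "linkage V E p \<longleftrightarrow> finite V \<and> simple_graph V E \<and> connected_graph V E \<and>
     (\<forall>u v. {u, v} \<in> E \<longrightarrow> p u \<noteq> p v)"

text \<open>
  The row of the rigidity matrix belonging to the edge \<open>e = {u, v}\<close>, as a functional of the
  velocities \<open>w\<close>.  The value is symmetric in \<open>u\<close> and \<open>v\<close>, hence well defined for unordered edges.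
\<close>

definition rigidity_row :: "('v \<Rightarrow> real ^ 'd) \<Rightarrow> 'v set \<Rightarrow> ('v \<Rightarrow> real ^ 'd) \<Rightarrow> real" where
  "rigidity_row p e w = (THE r. \<exists>u v. e = {u, v} \<and> r = (p u - p v) \<bullet> (w u - w v))"

lemma rigidity_row_edge: "rigidity_row p {u, v} w = (p u - p v) \<bullet> (w u - w v)"
  unfolding rigidity_row_def
proof (rule the_equality)
  fix r
  assume "\<exists>u' v'. {u, v} = {u', v'} \<and> r = (p u' - p v') \<bullet> (w u' - w v')"
  then show "r = (p u - p v) \<bullet> (w u - w v)"
    by (auto simp: doubleton_eq_iff algebra_simps)
qed blast

definition infinitesimally_independent :: "'v set set \<Rightarrow> ('v \<Rightarrow> real ^ 'd) \<Rightarrow> bool" where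
  "infinitesimally_independent E p \<longleftrightarrow>
     (\<forall>c :: 'v set \<Rightarrow> real.
        (\<forall>w. (\<Sum>e\<in>E. c e * rigidity_row p e w) = 0) \<longrightarrow> (\<forall>e\<in>E. c e = 0))"


section \<open>Lattices\<close>

definition is_basis :: "('d \<Rightarrow> real ^ 'd) \<Rightarrow> bool" where
  "is_basis b \<longleftrightarrow> inj b \<and> independent (range b) \<and> span (range b) = UNIV"

definition lattice_of :: "('d \<Rightarrow> real ^ 'd) \<Rightarrow> (real ^ 'd) set" where
  "lattice_of b = range (\<lambda>n :: 'd \<Rightarrow> int. \<Sum>k\<in>UNIV. of_int (n k) *\<^sub>R b k)"


section \<open>Periodic graphs and periodic frameworks\<close>

abbreviation perm_group :: "'w set \<Rightarrow> ('w \<Rightarrow> 'w) set \<Rightarrow> ('w \<Rightarrow> 'w) monoid" where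
  "perm_group W \<Gamma> \<equiv> (BijGroup W)\<lparr>carrier := \<Gamma>\<rparr>"

definition graph_auts :: "'w set \<Rightarrow> 'w set set \<Rightarrow> ('w \<Rightarrow> 'w) set" where
  "graph_auts W F = {\<gamma> \<in> Bij W. \<forall>u\<in>W. \<forall>v\<in>W. {\<gamma> u, \<gamma> v} \<in> F \<longleftrightarrow> {u, v} \<in> F}"

definition vertex_orbits :: "'w set \<Rightarrow> ('w \<Rightarrow> 'w) set \<Rightarrow> 'w set set" where
  "vertex_orbits W \<Gamma> = orbits (perm_group W \<Gamma>) W (\<lambda>\<gamma>. \<gamma>)"

definition edge_orbits :: "'w set \<Rightarrow> 'w set set \<Rightarrow> ('w \<Rightarrow> 'w) set \<Rightarrow> 'w set set set" where
  "edge_orbits W F \<Gamma> = orbits (perm_group W \<Gamma>) F (\<lambda>\<gamma> e. \<gamma> ` e)"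

definition periodic_graph :: "nat \<Rightarrow> 'w set \<Rightarrow> 'w set set \<Rightarrow> ('w \<Rightarrow> 'w) set \<Rightarrow> bool" where
  "periodic_graph d W F \<Gamma> \<longleftrightarrow>
     infinite W \<and> simple_graph W F \<and> (\<forall>w\<in>W. finite {e \<in> F. w \<in> e}) \<and>
     subgroup \<Gamma> (BijGroup W) \<and> \<Gamma> \<subseteq> graph_auts W F \<and>
     perm_group W \<Gamma> \<cong> free_Abelian_group {..<d} \<and>
     (\<forall>\<gamma>\<in>\<Gamma>. \<gamma> \<noteq> \<one>\<^bsub>BijGroup W\<^esub> \<longrightarrow> (\<forall>w\<in>W. \<gamma> w \<noteq> w) \<and> (\<forall>e\<in>F. \<gamma> ` e \<noteq> e)) \<and>
     finite (vertex_orbits W \<Gamma>) \<and> finite (edge_orbits W F \<Gamma>)"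

text \<open>
  A translation is represented by its translation vector, so \<open>\<pi>\<close> is a homomorphism into the
  additive group of vectors.
\<close>

definition periodic_placement ::
    "'w set \<Rightarrow> 'w set set \<Rightarrow> ('w \<Rightarrow> 'w) set \<Rightarrow> ('w \<Rightarrow> real ^ 'd) \<Rightarrow> (('w \<Rightarrow> 'w) \<Rightarrow> real ^ 'd) \<Rightarrow> bool" where
  "periodic_placement W F \<Gamma> q \<pi> \<longleftrightarrow>
     (\<forall>\<gamma>\<in>\<Gamma>. \<forall>\<delta>\<in>\<Gamma>. \<pi> (\<gamma> \<otimes>\<^bsub>BijGroup W\<^esub> \<delta>) = \<pi> \<gamma> + \<pi> \<delta>) \<and> inj_on \<pi> \<Gamma> \<and>
     (\<exists>b. is_basis b \<and> \<pi> ` \<Gamma> = lattice_of b) \<and>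
     (\<forall>\<gamma>\<in>\<Gamma>. \<forall>w\<in>W. q (\<gamma> w) = q w + \<pi> \<gamma>) \<and>
     (\<forall>u v. {u, v} \<in> F \<longrightarrow> q u \<noteq> q v)"

definition periodic_framework ::
    "'w set \<Rightarrow> 'w set set \<Rightarrow> ('w \<Rightarrow> 'w) set \<Rightarrow> ('w \<Rightarrow> real ^ 'd) \<Rightarrow> (('w \<Rightarrow> 'w) \<Rightarrow> real ^ 'd) \<Rightarrow> bool" where
  "periodic_framework W F \<Gamma> q \<pi> \<longleftrightarrow>
     periodic_graph CARD('d) W F \<Gamma> \<and> periodic_placement W F \<Gamma> q \<pi>"

definition framework_iso where
  "framework_iso \<phi> W\<^sub>1 F\<^sub>1 \<Gamma>\<^sub>1 q\<^sub>1 \<pi>\<^sub>1 W\<^sub>2 F\<^sub>2 \<Gamma>\<^sub>2 q\<^sub>2 \<pi>\<^sub>2 \<longleftrightarrow>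
     bij_betw \<phi> W\<^sub>1 W\<^sub>2 \<and> F\<^sub>2 = (\<lambda>e. \<phi> ` e) ` F\<^sub>1 \<and>
     (let conj = (\<lambda>\<gamma>. \<lambda>w\<in>W\<^sub>2. \<phi> (\<gamma> (inv_into W\<^sub>1 \<phi> w)))
      in \<Gamma>\<^sub>2 = conj ` \<Gamma>\<^sub>1 \<and> (\<forall>\<gamma>\<in>\<Gamma>\<^sub>1. \<pi>\<^sub>2 (conj \<gamma>) = \<pi>\<^sub>1 \<gamma>)) \<and>
     (\<forall>w\<in>W\<^sub>1. q\<^sub>2 (\<phi> w) = q\<^sub>1 w)"


section \<open>The periodic framework associated with a linkage and marked pairs\<close>

text \<open>The marked pairs are \<open>{a k, b k}\<close>, with \<open>k\<close> ranging over the coordinate indices.\<close>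

definition marked_vector :: "('v \<Rightarrow> real ^ 'd) \<Rightarrow> ('d \<Rightarrow> 'v) \<Rightarrow> ('d \<Rightarrow> 'v) \<Rightarrow> 'd \<Rightarrow> real ^ 'd" where
  "marked_vector p a b k = p (b k) - p (a k)"

definition marked_equiv :: "('d \<Rightarrow> 'v) \<Rightarrow> ('d \<Rightarrow> 'v) \<Rightarrow> 'v \<Rightarrow> 'v \<Rightarrow> bool" where
  "marked_equiv a b = equivclp (\<lambda>u v. \<exists>k. u = a k \<and> v = b k)"

definition contains_linkage where
  "contains_linkage V E p W F q \<iota> \<longleftrightarrow>
     inj_on \<iota> V \<and> \<iota> ` V \<subseteq> W \<and> (\<forall>e\<in>E. \<iota> ` e \<in> F) \<and> (\<forall>v\<in>V. q (\<iota> v) = p v)"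

definition same_orbit :: "('w \<Rightarrow> 'w) set \<Rightarrow> 'w \<Rightarrow> 'w \<Rightarrow> bool" where
  "same_orbit \<Gamma> x y \<longleftrightarrow> (\<exists>\<gamma>\<in>\<Gamma>. \<gamma> x = y)"

definition linkage_in_periodic_framework where
  "linkage_in_periodic_framework V E p a b W F \<Gamma> q \<pi> \<iota> \<longleftrightarrow>
     periodic_framework W F \<Gamma> q \<pi> \<and>
     \<pi> ` \<Gamma> = lattice_of (marked_vector p a b) \<and>
     contains_linkage V E p W F q \<iota> \<and>
     (\<forall>orb\<in>edge_orbits W F \<Gamma>. \<exists>!e. e \<in> E \<and> \<iota> ` e \<in> orb) \<and>
     (\<forall>orb\<in>vertex_orbits W \<Gamma>. \<exists>v\<in>V. \<iota> v \<in> orb)"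

text \<open>
  The periodicity generators carry one end of a marked pair to the other, so the two ends lie in
  one orbit, and no other vertices of the linkage are identified modulo periodicity.  When distinct
  vertices of the framework are placed at distinct points and no positions of unrelated vertices of
  the linkage happen to differ by a lattice vector, this is a consequence of the remaining
  conditions (lemma \<open>marked_gluing_generic\<close>).  Otherwise it has to be required: the disjoint union of
  the lattice translates of the linkage (where the ends of a marked pair lie in different orbits),
  and the framework obtained by a further gluing of vertices that accidentally differ by a lattice
  vector, satisfy \<open>linkage_in_periodic_framework\<close> too, with a different number of vertex orbits.
\<close>

definition marked_gluing where
  "marked_gluing V a b \<Gamma> \<iota> \<longleftrightarrow>
     (\<forall>u\<in>V. \<forall>v\<in>V. same_orbit \<Gamma> (\<iota> u) (\<iota> v) \<longleftrightarrow> marked_equiv a b u v)"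

definition associated_framework where
  "associated_framework V E p a b W F \<Gamma> q \<pi> \<iota> \<longleftrightarrow>
     linkage_in_periodic_framework V E p a b W F \<Gamma> q \<pi> \<iota> \<and> marked_gluing V a b \<Gamma> \<iota>"

lemma lattice_of_diff:
  fixes b :: "'d \<Rightarrow> real ^ 'd"
  assumes "x \<in> lattice_of b" and "y \<in> lattice_of b"
  shows "x - y \<in> lattice_of b"
proof -
  obtain n m :: "'d \<Rightarrow> int" where "x = (\<Sum>k\<in>UNIV. of_int (n k) *\<^sub>R b k)"
      and "y = (\<Sum>k\<in>UNIV. of_int (m k) *\<^sub>R b k)"
    using assms by (auto simp: lattice_of_def)
  then have "x - y = (\<Sum>k\<in>UNIV. of_int (n k - m k) *\<^sub>R b k)"
    by (simp add: sum_subtractf scaleR_left_diff_distrib)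
  then show ?thesis
    unfolding lattice_of_def by (intro range_eqI[where x = "\<lambda>k. n k - m k"])
qed

lemma lattice_of_zero: "0 \<in> lattice_of b"
  unfolding lattice_of_def by (rule range_eqI[where x = "\<lambda>_. 0"]) simp

lemma lattice_of_base: "b k \<in> lattice_of b"
proof -
  have "of_int (if i = k then 1 else 0) *\<^sub>R b i = (if i = k then b i else 0)" for i
    by simp
  then have "(\<Sum>i\<in>UNIV. of_int (if i = k then 1 else 0) *\<^sub>R b i) = b k"
    by (simp add: sum.delta)
  then show ?thesis
    unfolding lattice_of_def by (intro range_eqI[where x = "\<lambda>i. if i = k then 1 else 0"]) simp
qed

lemma marked_gluing_generic:
  assumes F: "linkage_in_periodic_framework V E p a b W F \<Gamma> q \<pi> \<iota>"
    and marked: "\<And>k. a k \<in> V \<and> b k \<in> V"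
    and inj: "inj_on q W"
    and generic: "\<And>u v. u \<in> V \<Longrightarrow> v \<in> V \<Longrightarrow> p v - p u \<in> lattice_of (marked_vector p a b)
                    \<Longrightarrow> marked_equiv a b u v"
  shows "marked_gluing V a b \<Gamma> \<iota>"
proof -
  let ?L = "lattice_of (marked_vector p a b)"
  have \<pi>: "\<pi> ` \<Gamma> = ?L" and \<iota>: "\<iota> ` V \<subseteq> W" and q: "\<And>v. v \<in> V \<Longrightarrow> q (\<iota> v) = p v"
    and equivariant: "\<And>\<gamma> w. \<gamma> \<in> \<Gamma> \<Longrightarrow> w \<in> W \<Longrightarrow> q (\<gamma> w) = q w + \<pi> \<gamma>"
    and \<Gamma>: "\<Gamma> \<subseteq> Bij W"
    using F by (auto simp: linkage_in_periodic_framework_def contains_linkage_def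
        periodic_framework_def periodic_placement_def periodic_graph_def graph_auts_def)
  have orbit: "same_orbit \<Gamma> (\<iota> u) (\<iota> v) \<longleftrightarrow> p v - p u \<in> ?L" if uv: "u \<in> V" "v \<in> V" for u v
  proof
    assume "same_orbit \<Gamma> (\<iota> u) (\<iota> v)"
    then obtain \<gamma> where "\<gamma> \<in> \<Gamma>" "\<gamma> (\<iota> u) = \<iota> v"
      by (auto simp: same_orbit_def)
    then have "p v = p u + \<pi> \<gamma>"
      using equivariant[of \<gamma> "\<iota> u"] q uv \<iota> by auto
    then show "p v - p u \<in> ?L"
      using \<pi> \<open>\<gamma> \<in> \<Gamma>\<close> by auto
  next
    assume "p v - p u \<in> ?L"
    then obtain \<gamma> where \<gamma>: "\<gamma> \<in> \<Gamma>" "\<pi> \<gamma> = p v - p u"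
      using \<pi> by (metis imageE)
    have "\<gamma> (\<iota> u) \<in> W"
      using \<gamma> \<Gamma> \<iota> uv Bij_imp_funcset by (metis funcset_mem image_subset_iff subsetD)
    moreover have "q (\<gamma> (\<iota> u)) = q (\<iota> v)"
      using equivariant[of \<gamma> "\<iota> u"] q uv \<iota> \<gamma> by auto
    ultimately have "\<gamma> (\<iota> u) = \<iota> v"
      using inj \<iota> uv by (auto dest: inj_onD)
    then show "same_orbit \<Gamma> (\<iota> u) (\<iota> v)"
      using \<gamma> by (auto simp: same_orbit_def)
  qed
  have "p v - p u \<in> ?L" if "marked_equiv a b u v" for u v
    using that unfolding marked_equiv_def
  proof (induction rule: equivclp_induct)
    case base
    then show ?case by (simp add: lattice_of_zero)
  next
    case (step y z)
    have "p z - p y \<in> ?L"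
    proof -
      have 1: "p (b k) - p (a k) \<in> ?L" for k
        using lattice_of_base[of "marked_vector p a b" k] by (simp add: marked_vector_def)
      have "p (a k) - p (b k) \<in> ?L" for k
        using lattice_of_diff[OF lattice_of_zero 1[of k]] by simp
      then show ?thesis
        using step.hyps 1 by auto
    qed
    moreover have "p u - p y \<in> ?L"
      using lattice_of_diff[OF lattice_of_zero step.IH] by simp
    ultimately show ?case
      using lattice_of_diff by fastforce
  qed
  then show ?thesis
    unfolding marked_gluing_def using orbit generic by blast
qed


section \<open>Deformation spaces\<close>

definition quotient_topology :: "'a topology \<Rightarrow> ('a \<times> 'a) set \<Rightarrow> 'a set topology" where
  "quotient_topology T r = topology (\<lambda>\<U>. \<U> \<subseteq> topspace T // r \<and> openin T (\<Union>\<U>))"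

lemma openin_quotient_topology:
  assumes "equiv (topspace T) r"
  shows "openin (quotient_topology T r) \<U> \<longleftrightarrow> \<U> \<subseteq> topspace T // r \<and> openin T (\<Union>\<U>)"
proof -
  have "istopology (\<lambda>\<U>. \<U> \<subseteq> topspace T // r \<and> openin T (\<Union>\<U>))"
    unfolding istopology_def
  proof (intro conjI allI impI)
    fix \<S> \<T>
    assume ST: "\<S> \<subseteq> topspace T // r \<and> openin T (\<Union>\<S>)" "\<T> \<subseteq> topspace T // r \<and> openin T (\<Union>\<T>)"
    then have "\<Union>(\<S> \<inter> \<T>) = \<Union>\<S> \<inter> \<Union>\<T>"
      using quotient_disj[OF assms] by blast
    with ST show "openin T (\<Union>(\<S> \<inter> \<T>))"
      by (simp add: openin_Int)
  next
    fix \<K>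
    assume "\<forall>\<S>\<in>\<K>. \<S> \<subseteq> topspace T // r \<and> openin T (\<Union>\<S>)"
    then have "openin T (\<Union>(Union ` \<K>))"
      by blast
    moreover have "\<Union>(\<Union>\<K>) = \<Union>(Union ` \<K>)"
      by blast
    ultimately show "openin T (\<Union>(\<Union>\<K>))"
      by simp
  qed blast+
  then show ?thesis
    by (simp add: quotient_topology_def)
qed

definition euclidean_isometry :: "(real ^ 'd \<Rightarrow> real ^ 'd) \<Rightarrow> bool" where
  "euclidean_isometry g \<longleftrightarrow> (\<forall>x y. dist (g x) (g y) = dist x y)"

definition same_edge_lengths :: "'v set set \<Rightarrow> ('v \<Rightarrow> real ^ 'd) \<Rightarrow> ('v \<Rightarrow> real ^ 'd) \<Rightarrow> bool" where
  "same_edge_lengths E p q \<longleftrightarrow> (\<forall>u v. {u, v} \<in> E \<longrightarrow> dist (q u) (q v) = dist (p u) (p v))"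

definition linkage_realizations ::
    "'v set \<Rightarrow> 'v set set \<Rightarrow> ('v \<Rightarrow> real ^ 'd) \<Rightarrow> ('v \<Rightarrow> real ^ 'd) set" where
  "linkage_realizations V E p = {q \<in> extensional V. same_edge_lengths E p q}"

definition linkage_congruence ::
    "'v set \<Rightarrow> 'v set set \<Rightarrow> ('v \<Rightarrow> real ^ 'd) \<Rightarrow> (('v \<Rightarrow> real ^ 'd) \<times> ('v \<Rightarrow> real ^ 'd)) set" where
  "linkage_congruence V E p =
     {(r, r'). r \<in> linkage_realizations V E p \<and> r' \<in> linkage_realizations V E p \<and>
        (\<exists>g. euclidean_isometry g \<and> r' = (\<lambda>v\<in>V. g (r v)))}"

definition linkage_realization_space ::
    "'v set \<Rightarrow> 'v set set \<Rightarrow> ('v \<Rightarrow> real ^ 'd) \<Rightarrow> ('v \<Rightarrow> real ^ 'd) topology" where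
  "linkage_realization_space V E p =
     subtopology (product_topology (\<lambda>_. euclidean) V) (linkage_realizations V E p)"

definition linkage_deformation_space ::
    "'v set \<Rightarrow> 'v set set \<Rightarrow> ('v \<Rightarrow> real ^ 'd) \<Rightarrow> ('v \<Rightarrow> real ^ 'd) set topology" where
  "linkage_deformation_space V E p =
     quotient_topology (linkage_realization_space V E p) (linkage_congruence V E p)"

definition linkage_class ::
    "'v set \<Rightarrow> 'v set set \<Rightarrow> ('v \<Rightarrow> real ^ 'd) \<Rightarrow> ('v \<Rightarrow> real ^ 'd) \<Rightarrow> ('v \<Rightarrow> real ^ 'd) set" where
  "linkage_class V E p r = linkage_congruence V E p `` {restrict r V}"

definition framework_realizations ::
    "'w set \<Rightarrow> 'w set set \<Rightarrow> ('w \<Rightarrow> 'w) set \<Rightarrow> ('w \<Rightarrow> real ^ 'd) \<Rightarrow>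
     (('w \<Rightarrow> real ^ 'd) \<times> (('w \<Rightarrow> 'w) \<Rightarrow> real ^ 'd)) set" where
  "framework_realizations W F \<Gamma> q =
     {(r, \<rho>). r \<in> extensional W \<and> \<rho> \<in> extensional \<Gamma> \<and>
        periodic_placement W F \<Gamma> r \<rho> \<and> same_edge_lengths F q r}"

text \<open>
  Conjugating the translation by \<open>t\<close> with an isometry \<open>g\<close> gives the translation by \<open>g t - g 0\<close>.
\<close>

definition framework_congruence ::
    "'w set \<Rightarrow> 'w set set \<Rightarrow> ('w \<Rightarrow> 'w) set \<Rightarrow> ('w \<Rightarrow> real ^ 'd) \<Rightarrow>
     ((('w \<Rightarrow> real ^ 'd) \<times> (('w \<Rightarrow> 'w) \<Rightarrow> real ^ 'd)) \<times>
      (('w \<Rightarrow> real ^ 'd) \<times> (('w \<Rightarrow> 'w) \<Rightarrow> real ^ 'd))) set" where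
  "framework_congruence W F \<Gamma> q =
     {((r, \<rho>), (r', \<rho>')).
        (r, \<rho>) \<in> framework_realizations W F \<Gamma> q \<and> (r', \<rho>') \<in> framework_realizations W F \<Gamma> q \<and>
        (\<exists>g. euclidean_isometry g \<and>
           r' = (\<lambda>w\<in>W. g (r w)) \<and> \<rho>' = (\<lambda>\<gamma>\<in>\<Gamma>. g (\<rho> \<gamma>) - g 0))}"

text \<open>Placements and period homomorphisms carry the topologies of pointwise convergence.\<close>

definition framework_realization_space ::
    "'w set \<Rightarrow> 'w set set \<Rightarrow> ('w \<Rightarrow> 'w) set \<Rightarrow> ('w \<Rightarrow> real ^ 'd) \<Rightarrow>
     (('w \<Rightarrow> real ^ 'd) \<times> (('w \<Rightarrow> 'w) \<Rightarrow> real ^ 'd)) topology" where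
  "framework_realization_space W F \<Gamma> q =
     subtopology
       (prod_topology (product_topology (\<lambda>_. euclidean) W) (product_topology (\<lambda>_. euclidean) \<Gamma>))
       (framework_realizations W F \<Gamma> q)"

definition framework_deformation_space ::
    "'w set \<Rightarrow> 'w set set \<Rightarrow> ('w \<Rightarrow> 'w) set \<Rightarrow> ('w \<Rightarrow> real ^ 'd) \<Rightarrow>
     (('w \<Rightarrow> real ^ 'd) \<times> (('w \<Rightarrow> 'w) \<Rightarrow> real ^ 'd)) set topology" where
  "framework_deformation_space W F \<Gamma> q =
     quotient_topology (framework_realization_space W F \<Gamma> q) (framework_congruence W F \<Gamma> q)"

definition framework_class ::
    "'w set \<Rightarrow> 'w set set \<Rightarrow> ('w \<Rightarrow> 'w) set \<Rightarrow> ('w \<Rightarrow> real ^ 'd) \<Rightarrow>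
     ('w \<Rightarrow> real ^ 'd) \<Rightarrow> (('w \<Rightarrow> 'w) \<Rightarrow> real ^ 'd) \<Rightarrow>
     (('w \<Rightarrow> real ^ 'd) \<times> (('w \<Rightarrow> 'w) \<Rightarrow> real ^ 'd)) set" where
  "framework_class W F \<Gamma> q r \<rho> =
     framework_congruence W F \<Gamma> q `` {(restrict r W, restrict \<rho> \<Gamma>)}"

text \<open>
  Local deformation spaces are the germs of the above spaces at the class of the given realization.
  They are identified by a homeomorphism of neighbourhoods of the base points, namely the one
  which restricts a periodic realization to the vertices of the linkage.
\<close>

definition local_deformation_spaces_identified where
  "local_deformation_spaces_identified V E p W F \<Gamma> q \<pi> \<iota> \<longleftrightarrow>
     (\<exists>U U' h.
        openin (framework_deformation_space W F \<Gamma> q) U \<and> framework_class W F \<Gamma> q q \<pi> \<in> U \<and>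
        openin (linkage_deformation_space V E p) U' \<and> linkage_class V E p p \<in> U' \<and>
        homeomorphic_map (subtopology (framework_deformation_space W F \<Gamma> q) U)
          (subtopology (linkage_deformation_space V E p) U') h \<and>
        (\<forall>(r, \<rho>)\<in>framework_realizations W F \<Gamma> q.
           framework_class W F \<Gamma> q r \<rho> \<in> U \<longrightarrow>
           h (framework_class W F \<Gamma> q r \<rho>) = linkage_class V E p (r \<circ> \<iota>)))"

definition has_local_dimension :: "'a topology \<Rightarrow> 'a \<Rightarrow> nat \<Rightarrow> bool" where
  "has_local_dimension T x f \<longleftrightarrow>
     (\<exists>U. openin T U \<and> x \<in> U \<and> subtopology T U homeomorphic_space Euclidean_space f)"


subsection \<open>Congruence is an equivalence relation\<close>

lemma topspace_linkage_realization_space [simp]: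
  "topspace (linkage_realization_space V E p) = linkage_realizations V E p"
  by (auto simp: linkage_realization_space_def linkage_realizations_def PiE_def)

lemma topspace_framework_realization_space [simp]:
  "topspace (framework_realization_space W F \<Gamma> q) = framework_realizations W F \<Gamma> q"
  by (auto simp: framework_realization_space_def framework_realizations_def PiE_def)

lemma euclidean_isometry_affine:
  assumes "euclidean_isometry g"
  obtains f where "orthogonal_transformation f" and "\<And>x. g x = f x + g 0"
proof
  show "orthogonal_transformation (\<lambda>x. g x - g 0)"
    using assms by (simp add: euclidean_isometry_def orthogonal_transformation_isometry dist_norm)
qed simp

lemma euclidean_isometry_inverse:
  assumes "euclidean_isometry g"
  obtains h where "euclidean_isometry h" and "\<And>x. h (g x) = x" and "\<And>x. g (h x) = x"
proof -
  obtain f where f: "orthogonal_transformation f" and g: "\<And>x. g x = f x + g 0"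
    using euclidean_isometry_affine[OF assms] by blast
  have inj: "inj g"
    using assms by (metis dist_eq_0_iff euclidean_isometry_def injI)
  have "surj g"
    using orthogonal_transformation_surj[OF f] g
    by (metis surj_def diff_add_cancel)
  with inj have "bij g" by (simp add: bij_def)
  then have "g (inv_into UNIV g x) = x" "inv_into UNIV g (g x) = x" for x
    by (simp_all add: bij_is_surj surj_f_inv_f bij_is_inj)
  then show ?thesis
    using that[of "inv_into UNIV g"] assms by (metis euclidean_isometry_def)
qed

lemma equiv_linkage_congruence:
  "equiv (linkage_realizations V E p) (linkage_congruence V E p)"
proof (rule equivI)
  show "linkage_congruence V E p \<subseteq> linkage_realizations V E p \<times> linkage_realizations V E p"
    by (auto simp: linkage_congruence_def)
  show "refl_on (linkage_realizations V E p) (linkage_congruence V E p)"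
  proof (rule refl_onI)
    fix r :: "'a \<Rightarrow> real ^ 'b"
    assume r: "r \<in> linkage_realizations V E p"
    have "r = (\<lambda>v\<in>V. id (r v))"
      using r by (simp add: linkage_realizations_def extensional_restrict)
    moreover have "euclidean_isometry (id :: real ^ 'b \<Rightarrow> _)"
      by (simp add: euclidean_isometry_def)
    ultimately have "\<exists>g. euclidean_isometry g \<and> r = (\<lambda>v\<in>V. g (r v))"
      by (intro exI[of _ id] conjI)
    with r show "(r, r) \<in> linkage_congruence V E p"
      unfolding linkage_congruence_def by simp
  qed
  show "sym (linkage_congruence V E p)"
  proof (rule symI)
    fix r r' :: "'a \<Rightarrow> real ^ 'b"
    assume A: "(r, r') \<in> linkage_congruence V E p"
    then obtain g where g: "euclidean_isometry g" "r' = (\<lambda>v\<in>V. g (r v))"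
      by (auto simp: linkage_congruence_def)
    obtain h where h: "euclidean_isometry h" "\<And>x. h (g x) = x"
      using euclidean_isometry_inverse[OF g(1)] by metis
    have "r \<in> extensional V"
      using A by (auto simp: linkage_congruence_def linkage_realizations_def)
    then have "r = (\<lambda>v\<in>V. h (r' v))"
      using g h by (auto simp: fun_eq_iff extensional_def)
    with A h show "(r', r) \<in> linkage_congruence V E p"
      unfolding linkage_congruence_def by blast
  qed
  show "trans (linkage_congruence V E p)"
  proof (rule transI)
    fix r r' r'' :: "'a \<Rightarrow> real ^ 'b"
    assume A: "(r, r') \<in> linkage_congruence V E p" "(r', r'') \<in> linkage_congruence V E p"
    then obtain g g' where g: "euclidean_isometry g" "r' = (\<lambda>v\<in>V. g (r v))"
        "euclidean_isometry g'" "r'' = (\<lambda>v\<in>V. g' (r' v))"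
      by (auto simp: linkage_congruence_def)
    have "euclidean_isometry (g' \<circ> g)"
      using g by (simp add: euclidean_isometry_def)
    moreover have "r'' = (\<lambda>v\<in>V. (g' \<circ> g) (r v))"
      using g by (auto simp: fun_eq_iff)
    ultimately have "\<exists>g. euclidean_isometry g \<and> r'' = (\<lambda>v\<in>V. g (r v))"
      by (intro exI[of _ "g' \<circ> g"] conjI)
    with A show "(r, r'') \<in> linkage_congruence V E p"
      unfolding linkage_congruence_def by simp
  qed
qed

lemma equiv_framework_congruence:
  "equiv (framework_realizations W F \<Gamma> q) (framework_congruence W F \<Gamma> q)"
proof (rule equivI)
  let ?R = "framework_realizations W F \<Gamma> q" and ?C = "framework_congruence W F \<Gamma> q"
  show "?C \<subseteq> ?R \<times> ?R"
    by (auto simp: framework_congruence_def)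
  have ext: "r \<in> extensional W" "\<rho> \<in> extensional \<Gamma>" if "(r, \<rho>) \<in> ?R" for r \<rho>
    using that by (auto simp: framework_realizations_def)
  show "refl_on ?R ?C"
  proof (rule refl_onI)
    fix x
    assume x: "x \<in> ?R"
    obtain r \<rho> where x_eq: "x = (r, \<rho>)" by (cases x)
    with x ext have "r = (\<lambda>w\<in>W. id (r w))" "\<rho> = (\<lambda>\<gamma>\<in>\<Gamma>. id (\<rho> \<gamma>) - id 0)"
      by (auto simp: extensional_restrict)
    moreover have "euclidean_isometry (id :: real ^ 'b \<Rightarrow> _)"
      by (simp add: euclidean_isometry_def)
    ultimately have "\<exists>g. euclidean_isometry g \<and> r = (\<lambda>w\<in>W. g (r w)) \<and>
        \<rho> = (\<lambda>\<gamma>\<in>\<Gamma>. g (\<rho> \<gamma>) - g 0)"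
      by (intro exI[of _ id] conjI)
    with x x_eq show "(x, x) \<in> ?C"
      unfolding framework_congruence_def by simp
  qed
  show "sym ?C"
  proof (rule symI)
    fix x y
    assume "(x, y) \<in> ?C"
    then obtain r \<rho> r' \<rho>' g where xy: "x = (r, \<rho>)" "y = (r', \<rho>')" "x \<in> ?R" "y \<in> ?R"
      and g: "euclidean_isometry g" "r' = (\<lambda>w\<in>W. g (r w))" "\<rho>' = (\<lambda>\<gamma>\<in>\<Gamma>. g (\<rho> \<gamma>) - g 0)"
      by (auto simp: framework_congruence_def)
    obtain h where h: "euclidean_isometry h" "\<And>x. h (g x) = x" "\<And>x. g (h x) = x"
      using euclidean_isometry_inverse[OF g(1)] by metis
    obtain f where f: "orthogonal_transformation f" "\<And>x. h x = f x + h 0"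
      using euclidean_isometry_affine[OF h(1)] by blast
    have "h (g t - g 0) - h 0 = t" for t
    proof -
      have "h (g t - g 0) - h 0 = f (g t) - f (g 0)"
        using f(2)[of "g t - g 0"] linear_diff[OF orthogonal_transformation_linear[OF f(1)]] by simp
      also have "\<dots> = h (g t) - h (g 0)"
        using f(2)[of "g t"] f(2)[of "g 0"] by (simp add: algebra_simps)
      finally show ?thesis by (simp add: h)
    qed
    then have "r = (\<lambda>w\<in>W. h (r' w))" "\<rho> = (\<lambda>\<gamma>\<in>\<Gamma>. h (\<rho>' \<gamma>) - h 0)"
      using g h ext xy by (auto simp: fun_eq_iff extensional_def)
    with h xy show "(y, x) \<in> ?C"
      unfolding framework_congruence_def by blast
  qed
  show "trans ?C"
  proof (rule transI)
    fix x y z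
    assume A: "(x, y) \<in> ?C" "(y, z) \<in> ?C"
    then obtain r \<rho> r' \<rho>' g where xy: "x = (r, \<rho>)" "y = (r', \<rho>')" "x \<in> ?R"
      and g: "euclidean_isometry g" "r' = (\<lambda>w\<in>W. g (r w))" "\<rho>' = (\<lambda>\<gamma>\<in>\<Gamma>. g (\<rho> \<gamma>) - g 0)"
      by (auto simp: framework_congruence_def)
    with A obtain r'' \<rho>'' g' where z: "z = (r'', \<rho>'')" "z \<in> ?R"
      and g': "euclidean_isometry g'" "r'' = (\<lambda>w\<in>W. g' (r' w))" "\<rho>'' = (\<lambda>\<gamma>\<in>\<Gamma>. g' (\<rho>' \<gamma>) - g' 0)"
      by (auto simp: framework_congruence_def)
    obtain f where f: "orthogonal_transformation f" "\<And>x. g' x = f x + g' 0"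
      using euclidean_isometry_affine[OF g'(1)] by blast
    have "g' (g t - g 0) - g' 0 = g' (g t) - g' (g 0)" for t
    proof -
      have "g' (g t - g 0) - g' 0 = f (g t) - f (g 0)"
        using f(2)[of "g t - g 0"] linear_diff[OF orthogonal_transformation_linear[OF f(1)]] by simp
      also have "\<dots> = g' (g t) - g' (g 0)"
        using f(2)[of "g t"] f(2)[of "g 0"] by (simp add: algebra_simps)
      finally show ?thesis .
    qed
    then have "r'' = (\<lambda>w\<in>W. (g' \<circ> g) (r w))" "\<rho>'' = (\<lambda>\<gamma>\<in>\<Gamma>. (g' \<circ> g) (\<rho> \<gamma>) - (g' \<circ> g) 0)"
      using g g' by (auto simp: fun_eq_iff)
    moreover have "euclidean_isometry (g' \<circ> g)"
      using g g' by (simp add: euclidean_isometry_def)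
    ultimately have "\<exists>g. euclidean_isometry g \<and> r'' = (\<lambda>w\<in>W. g (r w)) \<and>
        \<rho>'' = (\<lambda>\<gamma>\<in>\<Gamma>. g (\<rho> \<gamma>) - g 0)"
      by (intro exI[of _ "g' \<circ> g"] conjI)
    with xy z show "(x, z) \<in> ?C"
      unfolding framework_congruence_def by simp
  qed
qed

end

theory Submission
  imports Defs "HOL-Homology.Invariance_of_Domain"
begin

text \<open>
  The theorem has a combinatorial part, which compares the linkage with the frameworks that contain
  it, and an analytic part, which computes one local dimension.

  \<^emph>\<open>The combinatorial part.\<close>  The marked vectors \<open>p (b k) - p (a k)\<close> are linearly independent, so the
  marked pairs form a forest.  If \<open>u\<close> and \<open>v\<close> are joined in it, then the steps from \<open>u\<close> to \<open>v\<close> give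
  an integer vector \<open>n\<close> with \<open>s v - s u = (\<Sum>k. n k (s (b k) - s (a k)))\<close> for \<^emph>\<open>every\<close> placement \<open>s\<close>
  (\<open>marked_displacement\<close>); \<open>n\<close> is determined by \<open>p v - p u\<close>, and it determines \<open>u\<close> and \<open>v\<close> unless it
  is zero.  An associated framework consists of the translates \<open>tr n (\<iota> v)\<close> of the vertices of the
  linkage, and two of them, \<open>tr n (\<iota> u)\<close> and \<open>tr m (\<iota> v)\<close>, coincide exactly if \<open>n - m\<close> is the
  displacement from \<open>u\<close> to \<open>v\<close> (\<open>tr_eq_iff\<close>).  That condition mentions the linkage only.  Therefore
  all associated frameworks are isomorphic (\<open>associated_framework_unique\<close>), the condition can be used
  to construct one (\<open>associated_framework_exists\<close>), the vertex orbits are the trees of the forest, of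
  which there are \<open>card V - d\<close> (\<open>card_marked_classes\<close>), and a placement \<open>s\<close> of the linkage extends to the
  framework in precisely one way, by \<open>s v + (\<Sum>k. n k (s (b k) - s (a k)))\<close> at \<open>tr n (\<iota> v)\<close>.  The
  extension is periodic with a lattice of full rank exactly if the marked vectors of \<open>s\<close> form a
  basis.  This is an open condition that is invariant under isometries, so restriction to the linkage
  identifies the deformation space of the framework with an open part of the deformation space of the
  linkage (\<open>deformation_spaces\<close>).

  \<^emph>\<open>The analytic part.\<close>  Extend the edge set to a maximal set \<open>B\<close> of pairs of vertices whose length
  constraints are independent at \<open>p\<close>.  The positions span the space affinely, so a velocity that is
  orthogonal to the trivial motions and preserves all distances to first order vanishes
  (\<open>infinitesimally_rigid\<close>).  It follows that the rows of \<open>B\<close> and a basis of the trivial motions form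
  a basis of the space of velocities; hence \<open>B\<close> has \<open>card V * d - ((d + 1) choose 2)\<close> elements.  The squared
  lengths of the pairs in \<open>B\<close>, together with the linear functionals given by the trivial motions, are
  \<open>card V * d\<close> functions that separate the placements near \<open>p\<close>, because they are at most quadratic with
  injective derivative at \<open>p\<close> (\<open>local_length_coordinates_injective\<close>).  Invariance of domain turns them
  into a chart.  Every placement near \<open>p\<close> is congruent to one which is at least as close and for which
  the linear functionals have the same values as for \<open>p\<close>: among the congruent placements with the
  right centroid take one with the least square distance to \<open>p\<close> (\<open>aligned_congruent_placement\<close>).  On
  realizations of the linkage the lengths of the edges are fixed as well, and the remaining
  coordinates, the lengths of the pairs in \<open>B - E\<close>, are invariant under congruence.  They are a chart
  of the deformation space at the class of \<open>p\<close> (\<open>linkage_local_dimension\<close>).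
\<close>

section \<open>Independent and total families of vectors\<close>

definition family_independent :: "('i \<Rightarrow> 'j \<Rightarrow> real) \<Rightarrow> 'i set \<Rightarrow> 'j set \<Rightarrow> bool" where
  "family_independent a I J \<longleftrightarrow>
     (\<forall>c. (\<forall>j\<in>J. (\<Sum>i\<in>I. c i * a i j) = 0) \<longrightarrow> (\<forall>i\<in>I. c i = 0))"

lemma family_independentD:
  assumes "family_independent a I J" "\<And>j. j \<in> J \<Longrightarrow> (\<Sum>i\<in>I. c i * a i j) = 0" "i \<in> I"
  shows "c i = 0"
  using assms unfolding family_independent_def by metis

text \<open>
  Induction on the family, one step of Gaussian elimination each time: subtract from the new vector
  its components along the smaller family, pick a coordinate \<open>j0\<close> where the rest does not vanish, and
  normalize the part of the unit vector at \<open>j0\<close> that is annihilated by the smaller family.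
\<close>

lemma family_independent_dual:
  assumes "finite I" "finite J" "family_independent a I J"
  shows "\<exists>b. \<forall>i\<in>I. \<forall>k\<in>I. (\<Sum>j\<in>J. a i j * b k j) = (if i = k then 1 else 0)"
  using assms(1,3)
proof (induction I)
  case empty
  then show ?case by simp
next
  case (insert i0 I)
  have "family_independent a I J"
    unfolding family_independent_def
  proof (intro allI impI)
    fix c :: "'a \<Rightarrow> real"
    assume "\<forall>j\<in>J. (\<Sum>i\<in>I. c i * a i j) = 0"
    moreover have "(\<Sum>i\<in>insert i0 I. (if i = i0 then 0 else c i) * a i j) = (\<Sum>i\<in>I. c i * a i j)" for j
      using insert.hyps by (auto intro!: sum.cong)
    ultimately have "\<forall>j\<in>J. (\<Sum>i\<in>insert i0 I. (if i = i0 then 0 else c i) * a i j) = 0"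
      by simp
    then have "\<forall>i\<in>insert i0 I. (if i = i0 then 0 else c i) = 0"
      using family_independentD[OF insert.prems, of "\<lambda>i. if i = i0 then 0 else c i"] by simp
    then show "\<forall>i\<in>I. c i = 0"
      using insert.hyps by (metis insertCI)
  qed
  then obtain b where b: "\<And>i k. i \<in> I \<Longrightarrow> k \<in> I \<Longrightarrow> (\<Sum>j\<in>J. a i j * b k j) = (if i = k then 1 else 0)"
    using insert.IH by metis
  define t where "t i = (\<Sum>j\<in>J. a i0 j * b i j)" for i
  define d where "d j = a i0 j - (\<Sum>i\<in>I. t i * a i j)" for j
  have "\<exists>j\<in>J. d j \<noteq> 0"
  proof (rule ccontr)
    assume "\<not> (\<exists>j\<in>J. d j \<noteq> 0)"
    have "(\<Sum>i\<in>insert i0 I. (if i = i0 then 1 else - t i) * a i j) = d j" for j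
    proof -
      have "(\<Sum>i\<in>I. (if i = i0 then 1 else - t i) * a i j) = (\<Sum>i\<in>I. - (t i * a i j))"
        using insert.hyps by (intro sum.cong) auto
      then show ?thesis
        using insert.hyps by (simp add: d_def sum_negf)
    qed
    then have "\<forall>j\<in>J. (\<Sum>i\<in>insert i0 I. (if i = i0 then 1 else - t i) * a i j) = 0"
      using \<open>\<not> (\<exists>j\<in>J. d j \<noteq> 0)\<close> by simp
    then have "(if i0 = i0 then 1 else - t i0) = 0"
      using family_independentD[OF insert.prems, of "\<lambda>i. if i = i0 then 1 else - t i"] by blast
    then show False by simp
  qed
  then obtain j0 where j0: "j0 \<in> J" "d j0 \<noteq> 0" by blast
  \<comment> \<open>the part of the unit vector at \<open>j0\<close> that the vectors of the smaller family annihilate\<close>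
  define u where "u j = ((if j = j0 then 1 else 0) - (\<Sum>i\<in>I. a i j0 * b i j)) / d j0" for j
  have prod_u: "(\<Sum>j\<in>J. x j * u j) = (x j0 - (\<Sum>i\<in>I. a i j0 * (\<Sum>j\<in>J. x j * b i j))) / d j0"
    for x :: "'b \<Rightarrow> real"
  proof -
    have "(\<Sum>j\<in>J. x j * u j)
        = ((\<Sum>j\<in>J. x j * (if j = j0 then 1 else 0)) - (\<Sum>j\<in>J. \<Sum>i\<in>I. a i j0 * (x j * b i j))) / d j0"
      unfolding u_def
      by (simp add: sum_divide_distrib[symmetric] right_diff_distrib diff_divide_distrib
          sum_subtractf sum_distrib_left algebra_simps)
    also have "(\<Sum>j\<in>J. x j * (if j = j0 then 1 else 0)) = x j0"
      using j0(1) assms(2) by (simp add: if_distrib cong: if_cong)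
    also have "(\<Sum>j\<in>J. \<Sum>i\<in>I. a i j0 * (x j * b i j)) = (\<Sum>i\<in>I. a i j0 * (\<Sum>j\<in>J. x j * b i j))"
      by (subst sum.swap) (simp add: sum_distrib_left)
    finally show ?thesis .
  qed
  have u_old: "(\<Sum>j\<in>J. a k j * u j) = 0" if "k \<in> I" for k
  proof -
    have "(\<Sum>i\<in>I. a i j0 * (\<Sum>j\<in>J. a k j * b i j)) = (\<Sum>i\<in>I. if i = k then a i j0 else 0)"
      using b[OF that] by (intro sum.cong) auto
    then show ?thesis
      using that insert.hyps prod_u[of "a k"] by simp
  qed
  have u_new: "(\<Sum>j\<in>J. a i0 j * u j) = 1"
    using prod_u[of "a i0"] j0(2) by (simp add: d_def t_def mult.commute)
  define b' where "b' k j = (if k = i0 then u j else b k j - t k * u j)" for k j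
  have expand: "(\<Sum>j\<in>J. x j * (b k j - t k * u j)) = (\<Sum>j\<in>J. x j * b k j) - t k * (\<Sum>j\<in>J. x j * u j)"
    for x :: "'b \<Rightarrow> real" and k
    by (simp add: right_diff_distrib sum_subtractf sum_distrib_left algebra_simps)
  have "(\<Sum>j\<in>J. a i j * b' k j) = (if i = k then 1 else 0)"
    if "i \<in> insert i0 I" "k \<in> insert i0 I" for i k
  proof (cases "k = i0")
    case True
    then show ?thesis
      using that insert.hyps u_old u_new by (auto simp: b'_def)
  next
    case False
    then have "(\<Sum>j\<in>J. a i j * b' k j) = (\<Sum>j\<in>J. a i j * b k j) - t k * (\<Sum>j\<in>J. a i j * u j)"
      by (simp add: b'_def expand)
    then show ?thesis
      using that insert.hyps u_old u_new b False by (auto simp: t_def)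
  qed
  then show ?case by blast
qed

text \<open>
  Two independent, mutually orthogonal families that are jointly total form a basis.  The conclusion
  gives the resulting coordinate formula and the dimension count.  It is used for the rows of the
  rigidity matrix with the trivial motions, and for the marked pairs with the indicator functions of
  their connected components.
\<close>

lemma orthogonal_families_basis:
  fixes a :: "'i \<Rightarrow> 'j \<Rightarrow> real" and c :: "'k \<Rightarrow> 'j \<Rightarrow> real"
  assumes fin: "finite I" "finite K" "finite J"
    and a: "family_independent a I J" and c: "family_independent c K J"
    and orth: "\<And>i k. i \<in> I \<Longrightarrow> k \<in> K \<Longrightarrow> (\<Sum>j\<in>J. a i j * c k j) = 0"
    and total: "\<And>y. (\<And>i. i \<in> I \<Longrightarrow> (\<Sum>j\<in>J. a i j * y j) = 0) \<Longrightarrow>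
                     (\<And>k. k \<in> K \<Longrightarrow> (\<Sum>j\<in>J. c k j * y j) = 0) \<Longrightarrow> \<forall>j\<in>J. y j = 0"
  obtains b e where
    "\<And>y j. j \<in> J \<Longrightarrow> y j = (\<Sum>i\<in>I. (\<Sum>l\<in>J. a i l * y l) * b i j) + (\<Sum>k\<in>K. (\<Sum>l\<in>J. c k l * y l) * e k j)"
    and "card I + card K = card J"
proof -
  define h where "h = case_sum a c"
  have sum_Plus: "(\<Sum>x\<in>Sum_Type.Plus I K. F x) = (\<Sum>i\<in>I. F (Inl i)) + (\<Sum>k\<in>K. F (Inr k))"
    for F :: "'i + 'k \<Rightarrow> real"
    using fin by (simp add: sum.Plus)
  have "family_independent h (Sum_Type.Plus I K) J"
    unfolding family_independent_def
  proof (intro allI impI)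
    fix s :: "'i + 'k \<Rightarrow> real"
    define A where "A j = (\<Sum>i\<in>I. s (Inl i) * a i j)" for j
    define C where "C j = (\<Sum>k\<in>K. s (Inr k) * c k j)" for j
    assume "\<forall>j\<in>J. (\<Sum>i\<in>Sum_Type.Plus I K. s i * h i j) = 0"
    then have AC: "A j + C j = 0" if "j \<in> J" for j
      using that by (simp add: sum_Plus h_def A_def C_def)
    \<comment> \<open>the two parts of a vanishing combination are orthogonal and opposite, so both vanish\<close>
    have "(\<Sum>j\<in>J. A j * C j) = (\<Sum>j\<in>J. \<Sum>i\<in>I. \<Sum>k\<in>K. s (Inl i) * s (Inr k) * (a i j * c k j))"
      by (simp add: A_def C_def sum_product mult.assoc mult.left_commute)
    also have "\<dots> = (\<Sum>i\<in>I. \<Sum>k\<in>K. s (Inl i) * s (Inr k) * (\<Sum>j\<in>J. a i j * c k j))"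
      by (subst sum.swap, rule sum.cong[OF refl], subst sum.swap) (simp add: sum_distrib_left)
    also have "\<dots> = 0"
      using orth by simp
    finally have AC0: "(\<Sum>j\<in>J. A j * C j) = 0" .
    have "(\<Sum>j\<in>J. (C j)\<^sup>2) = (\<Sum>j\<in>J. - (A j * C j))"
      using AC by (intro sum.cong) (auto simp: power2_eq_square add_eq_0_iff)
    then have "(\<Sum>j\<in>J. (C j)\<^sup>2) = 0"
      using AC0 by (simp add: sum_negf)
    then have C0: "\<forall>j\<in>J. C j = 0"
      using fin by (simp add: sum_nonneg_eq_0_iff)
    then have A0: "\<forall>j\<in>J. A j = 0"
      using AC by auto
    have "\<forall>i\<in>I. s (Inl i) = 0"
      using family_independentD[OF a, of "\<lambda>i. s (Inl i)"] A0 by (simp add: A_def)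
    moreover have "\<forall>k\<in>K. s (Inr k) = 0"
      using family_independentD[OF c, of "\<lambda>k. s (Inr k)"] C0 by (simp add: C_def)
    ultimately show "\<forall>x\<in>Sum_Type.Plus I K. s x = 0"
      by auto
  qed
  then obtain g where g: "\<And>x z. x \<in> Sum_Type.Plus I K \<Longrightarrow> z \<in> Sum_Type.Plus I K \<Longrightarrow>
      (\<Sum>j\<in>J. h x j * g z j) = (if x = z then 1 else 0)"
    using family_independent_dual[of "Sum_Type.Plus I K" J h] fin by (metis finite_Plus)
  have recover: "y j = (\<Sum>x\<in>Sum_Type.Plus I K. (\<Sum>l\<in>J. h x l * y l) * g x j)" if "j \<in> J" for y j
  proof -
    define z where "z j = y j - (\<Sum>x\<in>Sum_Type.Plus I K. (\<Sum>l\<in>J. h x l * y l) * g x j)" for j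
    have "(\<Sum>j\<in>J. h w j * z j) = 0" if w: "w \<in> Sum_Type.Plus I K" for w
    proof -
      have "(\<Sum>j\<in>J. h w j * z j) = (\<Sum>j\<in>J. h w j * y j)
          - (\<Sum>j\<in>J. \<Sum>x\<in>Sum_Type.Plus I K. (\<Sum>l\<in>J. h x l * y l) * (h w j * g x j))"
        by (simp add: z_def right_diff_distrib sum_subtractf sum_distrib_left mult.left_commute
            del: sum.Plus)
      also have "(\<Sum>j\<in>J. \<Sum>x\<in>Sum_Type.Plus I K. (\<Sum>l\<in>J. h x l * y l) * (h w j * g x j))
          = (\<Sum>x\<in>Sum_Type.Plus I K. (\<Sum>l\<in>J. h x l * y l) * (\<Sum>j\<in>J. h w j * g x j))"
        by (subst sum.swap) (simp add: sum_distrib_left)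
      also have "\<dots> = (\<Sum>x\<in>Sum_Type.Plus I K. if w = x then (\<Sum>l\<in>J. h x l * y l) else 0)"
        using g[OF w] by (intro sum.cong) auto
      also have "\<dots> = (\<Sum>l\<in>J. h w l * y l)"
        using w fin by (simp add: finite_Plus sum.delta)
      finally show ?thesis by simp
    qed
    then have hz: "w \<in> Sum_Type.Plus I K \<Longrightarrow> (\<Sum>j\<in>J. h w j * z j) = 0" for w .
    have "\<forall>j\<in>J. z j = 0"
    proof (rule total)
      show "(\<Sum>j\<in>J. a i j * z j) = 0" if "i \<in> I" for i
        using hz[OF InlI[OF that]] by (simp add: h_def)
      show "(\<Sum>j\<in>J. c k j * z j) = 0" if "k \<in> K" for k
        using hz[OF InrI[OF that]] by (simp add: h_def)
    qed
    with that show ?thesis by (simp add: z_def)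
  qed
  \<comment> \<open>The recovery formula says that the matrices of the family and of its dual are inverse to
    each other; their two products have the same trace.\<close>
  define \<delta> :: "'j \<Rightarrow> 'j \<Rightarrow> real" where "\<delta> j l = (if l = j then 1 else 0)" for j l
  have "real (card I + card K) = real (card (Sum_Type.Plus I K))"
    using fin by (simp add: card_Plus)
  also have "\<dots> = (\<Sum>x\<in>Sum_Type.Plus I K. \<Sum>j\<in>J. h x j * g x j)"
    using g by simp
  also have "\<dots> = (\<Sum>j\<in>J. \<Sum>x\<in>Sum_Type.Plus I K. (\<Sum>l\<in>J. h x l * \<delta> j l) * g x j)"
    using fin(3) by (subst sum.swap) (simp add: \<delta>_def if_distrib cong: if_cong)
  also have "\<dots> = (\<Sum>j\<in>J. \<delta> j j)"
    by (intro sum.cong refl recover[symmetric])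
  also have "\<dots> = real (card J)"
    by (simp add: \<delta>_def)
  finally have "card I + card K = card J" by linarith
  moreover have "y j = (\<Sum>i\<in>I. (\<Sum>l\<in>J. a i l * y l) * g (Inl i) j) + (\<Sum>k\<in>K. (\<Sum>l\<in>J. c k l * y l) * g (Inr k) j)"
    if "j \<in> J" for y j
    using recover[OF that, of y] by (simp add: sum_Plus h_def)
  ultimately show ?thesis
    using that[of "\<lambda>i. g (Inl i)" "\<lambda>k. g (Inr k)"] by blast
qed


section \<open>Integral combinations of a basis\<close>

definition lattice_point :: "('d \<Rightarrow> real ^ 'd) \<Rightarrow> ('d \<Rightarrow> int) \<Rightarrow> real ^ 'd" where
  "lattice_point b n = (\<Sum>k\<in>UNIV. of_int (n k) *\<^sub>R b k)"

lemma lattice_of_eq_range: "lattice_of b = range (lattice_point b)"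
  by (simp add: lattice_of_def lattice_point_def[abs_def])

lemma lattice_point_zero [simp]: "lattice_point b (\<lambda>_. 0) = 0"
  and lattice_point_add: "lattice_point b (\<lambda>k. n k + m k) = lattice_point b n + lattice_point b m"
  and lattice_point_diff: "lattice_point b (\<lambda>k. n k - m k) = lattice_point b n - lattice_point b m"
  and lattice_point_minus: "lattice_point b (\<lambda>k. - n k) = - lattice_point b n"
  by (simp_all add: lattice_point_def scaleR_left_distrib scaleR_left_diff_distrib sum.distrib
      sum_subtractf sum_negf)

lemma lattice_point_unit: "lattice_point b (\<lambda>i. if i = k then 1 else 0) = b k"
proof -
  have "of_int (if i = k then 1 else 0) *\<^sub>R b i = (if i = k then b i else 0)" for i
    by simp
  then show ?thesis
    by (simp add: lattice_point_def)
qed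

text \<open>
  The form in which linear independence is used throughout: \<open>is_basis\<close> speaks about the set of the
  basis vectors, while the coefficients here are indexed by \<open>'d\<close>.
\<close>

lemma is_basis_coefficients_zero:
  fixes b :: "'d \<Rightarrow> real ^ 'd"
  assumes "is_basis b" "(\<Sum>k\<in>UNIV. c k *\<^sub>R b k) = 0"
  shows "c k = 0"
proof -
  have inj: "inj b" and indep: "independent (range b)"
    using assms(1) by (auto simp: is_basis_def)
  have sum0: "(\<Sum>v\<in>range b. c (inv_into UNIV b v) *\<^sub>R v) = 0"
    using inj assms(2) by (simp add: sum.reindex)
  have "c (inv_into UNIV b (b k)) = 0"
    by (rule independentD[where u = "\<lambda>v. c (inv_into UNIV b v)", OF indep _ order_refl sum0]) simp_all
  then show ?thesis using inj by simp
qed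

lemma lattice_point_inj:
  assumes "is_basis b" "lattice_point b n = lattice_point b m"
  shows "n = m"
proof
  fix k
  have "(\<Sum>k\<in>UNIV. of_int (n k - m k) *\<^sub>R b k) = 0"
    using assms(2) lattice_point_diff[of b n m] by (simp add: lattice_point_def)
  then have "real_of_int (n k - m k) = 0"
    by (rule is_basis_coefficients_zero[where c = "\<lambda>k. of_int (n k - m k)", OF assms(1)])
  then show "n k = m k"
    by simp
qed

section \<open>Displacements along marked pairs\<close>

text \<open>
  The net number of times that each marked pair is traversed on the way from \<open>u\<close> to \<open>v\<close>, expressed by
  its effect on all placements instead of by paths.  In this form it applies directly to the given
  placement, to deformed ones, and to indicator functions.
\<close>

definition marked_displacement ::
    "('d::finite \<Rightarrow> 'v) \<Rightarrow> ('d \<Rightarrow> 'v) \<Rightarrow> 'v \<Rightarrow> 'v \<Rightarrow> ('d \<Rightarrow> int) \<Rightarrow> bool" where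
  "marked_displacement a b u v n \<longleftrightarrow>
     (\<forall>s :: 'v \<Rightarrow> real ^ 'd. s v - s u = lattice_point (marked_vector s a b) n)"

lemma marked_displacementD:
  "marked_displacement a b u v n \<Longrightarrow> s v - s u = lattice_point (marked_vector s a b) n"
  by (simp add: marked_displacement_def)

lemma marked_displacement_refl: "marked_displacement a b u u (\<lambda>_. 0)"
  by (simp add: marked_displacement_def)

lemma marked_displacement_trans:
  assumes "marked_displacement a b u v n" "marked_displacement a b v w m"
  shows "marked_displacement a b u w (\<lambda>k. n k + m k)"
  unfolding marked_displacement_def lattice_point_add
proof
  fix s :: "'b \<Rightarrow> real ^ 'a"
  show "s w - s u = lattice_point (marked_vector s a b) n + lattice_point (marked_vector s a b) m"
    using marked_displacementD[OF assms(1), of s] marked_displacementD[OF assms(2), of s]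
    by (simp add: algebra_simps)
qed

lemma marked_displacement_sym:
  "marked_displacement a b u v n \<Longrightarrow> marked_displacement a b v u (\<lambda>k. - n k)"
  unfolding marked_displacement_def lattice_point_minus by (auto simp: algebra_simps)

lemma marked_displacement_pair: "marked_displacement a b (a k) (b k) (\<lambda>i. if i = k then 1 else 0)"
  by (simp add: marked_displacement_def lattice_point_unit marked_vector_def)

lemma marked_equiv_refl [simp]: "marked_equiv a b u u"
  and marked_equiv_sym: "marked_equiv a b u v \<Longrightarrow> marked_equiv a b v u"
  and marked_equiv_trans: "marked_equiv a b u v \<Longrightarrow> marked_equiv a b v w \<Longrightarrow> marked_equiv a b u w"
  and marked_equiv_pair: "marked_equiv a b (a k) (b k)"
  unfolding marked_equiv_def
  by (auto intro: equivclp_sym equivclp_trans r_into_equivclp)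

lemma marked_equiv_invariant:
  assumes "\<And>k. s (a k) = s (b k)" "marked_equiv a b u v"
  shows "s u = s v"
  using assms(2) unfolding marked_equiv_def
  by (induction rule: equivclp_induct) (auto simp: assms(1))

text \<open>
  Conversely to the obvious direction, a displacement forces equivalence, as one sees by testing it on
  the indicator function of the class of \<open>u\<close>: its marked vectors are all zero.
\<close>

lemma marked_equiv_iff_displacement:
  "marked_equiv a b u v \<longleftrightarrow> (\<exists>n. marked_displacement a b u v n)"
proof
  assume "marked_equiv a b u v"
  then show "\<exists>n. marked_displacement a b u v n"
    unfolding marked_equiv_def
  proof (induction rule: equivclp_induct)
    case base
    show ?case by (rule exI, rule marked_displacement_refl)
  next
    case (step y z)
    then obtain k where "y = a k \<and> z = b k \<or> y = b k \<and> z = a k"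
      by auto
    then obtain m where m: "marked_displacement a b y z m"
      using marked_displacement_pair[of a b k] marked_displacement_sym[OF marked_displacement_pair[of a b k]]
      by auto
    obtain n where n: "marked_displacement a b u y n"
      using step.IH by blast
    show ?case by (rule exI, rule marked_displacement_trans[OF n m])
  qed
next
  assume "\<exists>n. marked_displacement a b u v n"
  then obtain n where n: "marked_displacement a b u v n" ..
  define s :: "'b \<Rightarrow> real ^ 'a" where "s x = (if marked_equiv a b u x then 1 else 0)" for x
  have "s (a k) = s (b k)" for k
    using marked_equiv_trans[of a b u "a k" "b k"] marked_equiv_trans[of a b u "b k" "a k"]
      marked_equiv_pair[of a b k] marked_equiv_sym[of a b "a k" "b k"] by (auto simp: s_def)
  then have "marked_vector s a b = (\<lambda>_. 0)"
    by (auto simp: marked_vector_def)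
  then have "s v = s u"
    using marked_displacementD[OF n, of s] by (simp add: lattice_point_def)
  then show "marked_equiv a b u v"
    by (simp add: s_def split: if_splits)
qed

lemma marked_displacement_unique:
  assumes "is_basis (marked_vector p a b)" "marked_displacement a b u v n"
    "p v - p u = lattice_point (marked_vector p a b) m"
  shows "n = m"
  using lattice_point_inj[OF assms(1)] assms(3) marked_displacementD[OF assms(2), of p] by simp

lemma marked_displacement_zero: "marked_displacement a b u v (\<lambda>_. 0) \<Longrightarrow> u = v"
proof (rule ccontr)
  assume *: "marked_displacement a b u v (\<lambda>_. 0)" "u \<noteq> v"
  define s :: "'b \<Rightarrow> real ^ 'a" where "s x = (if x = v then 1 else 0)" for x
  have "s v - s u = 0"
    using marked_displacementD[OF *(1), of s] by simp
  with *(2) show False by (simp add: s_def)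
qed

text \<open>
  A path in a forest is determined by the edges that it traverses.  Here this follows by testing both
  displacements on the indicator functions of the endpoints.  It is the reason why no two edges of the
  linkage become equivalent under the periodicity group.
\<close>

lemma marked_displacement_endpoints:
  assumes "marked_displacement a b u u' n" "marked_displacement a b v v' n"
  shows "u = v \<and> u' = v' \<or> u = u' \<and> v = v'"
proof -
  have eq: "s u' - s u = s v' - s v" for s :: "'b \<Rightarrow> real ^ 'a"
    using assms by (simp add: marked_displacementD)
  define \<delta> :: "'b \<Rightarrow> 'b \<Rightarrow> real ^ 'a" where "\<delta> x y = (if y = x then 1 else 0)" for x y
  have "(- 1 :: real ^ 'a) \<noteq> 1"
    by (simp add: vec_eq_iff)
  then show ?thesis
    using eq[of "\<delta> u'"] eq[of "\<delta> u"] eq[of "\<delta> v"]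
    by (auto simp: \<delta>_def split: if_splits)
qed

text \<open>
  The rows of the incidence matrix of the marked pairs are independent, because \<open>p\<close> maps them to the
  independent marked vectors.  Their orthogonal complement consists of the functions that are constant on
  the classes, which has the indicator functions of the classes as a basis.
\<close>

lemma card_marked_classes:
  fixes p :: "'v \<Rightarrow> real ^ 'd"
  assumes V: "finite V" and ab: "\<And>k. a k \<in> V \<and> b k \<in> V"
    and basis: "is_basis (marked_vector p a b)"
  shows "card (V // {(u, v). u \<in> V \<and> v \<in> V \<and> marked_equiv a b u v}) + CARD('d) = card V"
proof -
  let ?R = "{(u, v). u \<in> V \<and> v \<in> V \<and> marked_equiv a b u v}"
  have R: "equiv V ?R"
    by (rule equivI) (auto simp: refl_on_def sym_def trans_def intro: marked_equiv_sym marked_equiv_trans)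
  define bd where "bd k v = (if v = b k then 1 else 0) - (if v = a k then 1 else (0::real))" for k v
  define ind where "ind C v = (if v \<in> C then 1 else (0::real))" for C :: "'v set" and v
  have sum_bd: "(\<Sum>v\<in>V. bd k v *\<^sub>R y v) = y (b k) - y (a k)" for k and y :: "'v \<Rightarrow> 'z::real_vector"
  proof -
    have "bd k v *\<^sub>R y v = (if v = b k then y v else 0) - (if v = a k then y v else 0)" for v
      by (simp add: bd_def)
    then show ?thesis using V ab by (simp add: sum_subtractf)
  qed
  have sum_ind: "(\<Sum>v\<in>V. ind C v * y v) = (\<Sum>v\<in>C. y v)" if "C \<in> V // ?R" for C y
  proof -
    have "C \<subseteq> V" using that by (rule in_quotient_imp_subset[OF R])
    then show ?thesis using V by (simp add: ind_def sum.If_cases if_distrib[of "\<lambda>c. c * _"] Int_absorb1 cong: if_cong)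
  qed
  have fin: "finite (V // ?R)" using V R by (simp add: finite_quotient equiv_type)
  show ?thesis
  proof (rule orthogonal_families_basis)
    show "finite (UNIV :: 'd set)" "finite (V // ?R)" "finite V"
      using fin V by auto
    show "family_independent bd UNIV V"
      unfolding family_independent_def
    proof (intro allI impI ballI)
      fix c :: "'d \<Rightarrow> real" and k
      assume "\<forall>v\<in>V. (\<Sum>k\<in>UNIV. c k * bd k v) = 0"
      then have "(\<Sum>v\<in>V. (\<Sum>k\<in>UNIV. c k * bd k v) *\<^sub>R p v) = 0"
        by simp
      also have "(\<Sum>v\<in>V. (\<Sum>k\<in>UNIV. c k * bd k v) *\<^sub>R p v) = (\<Sum>k\<in>UNIV. c k *\<^sub>R (\<Sum>v\<in>V. bd k v *\<^sub>R p v))"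
        by (simp add: scaleR_sum_left scaleR_sum_right) (subst sum.swap, simp)
      finally have "(\<Sum>k\<in>UNIV. c k *\<^sub>R marked_vector p a b k) = 0"
        by (simp add: sum_bd marked_vector_def)
      then show "c k = 0"
        using is_basis_coefficients_zero[OF basis] by blast
    qed
    show "family_independent ind (V // ?R) V"
      unfolding family_independent_def
    proof (intro allI impI ballI)
      fix c and C
      assume *: "\<forall>v\<in>V. (\<Sum>C\<in>V // ?R. c C * ind C v) = 0" and C: "C \<in> V // ?R"
      then obtain v where v: "v \<in> C" "v \<in> V"
        using in_quotient_imp_non_empty[OF R C] in_quotient_imp_subset[OF R C] by blast
      have "c D * ind D v = (if D = C then c C else 0)" if "D \<in> V // ?R" for D
        using quotient_disj[OF R that C] v by (auto simp: ind_def)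
      then have "(\<Sum>D\<in>V // ?R. c D * ind D v) = c C"
        using fin C by simp
      then show "c C = 0" using * v by simp
    qed
    show "(\<Sum>v\<in>V. bd k v * ind C v) = 0" if C: "C \<in> V // ?R" for k C
    proof -
      obtain x where x: "x \<in> V" "C = ?R `` {x}"
        using C by (auto elim!: quotientE)
      have "marked_equiv a b x (a k) \<longleftrightarrow> marked_equiv a b x (b k)"
        using marked_equiv_pair[of a b k] marked_equiv_sym[OF marked_equiv_pair[of a b k]]
        by (meson marked_equiv_trans)
      then have "a k \<in> C \<longleftrightarrow> b k \<in> C"
        using x ab[of k] by simp
      then show ?thesis
        using sum_bd[of k "ind C"] by (simp add: ind_def)
    qed
    show "\<forall>v\<in>V. y v = 0" if "\<And>k. k \<in> UNIV \<Longrightarrow> (\<Sum>v\<in>V. bd k v * y v) = 0"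
      and "\<And>C. C \<in> V // ?R \<Longrightarrow> (\<Sum>v\<in>V. ind C v * y v) = 0" for y
    proof
      fix v assume v: "v \<in> V"
      have "y (a k) = y (b k)" for k
        using that(1)[of k] sum_bd[of k y] by simp
      then have const: "y w = y v" if "w \<in> ?R `` {v}" for w
        using marked_equiv_invariant[of y a b v w] that by auto
      have C: "?R `` {v} \<in> V // ?R"
        using v by (rule quotientI)
      then have "(\<Sum>w\<in>?R `` {v}. y w) = 0"
        using that(2)[OF C] sum_ind[OF C, of y] by linarith
      moreover have "(\<Sum>w\<in>?R `` {v}. y w) = (\<Sum>w\<in>?R `` {v}. y v)"
        by (intro sum.cong refl const)
      ultimately have "real (card (?R `` {v})) * y v = 0"
        by simp
      moreover have "card (?R `` {v}) \<noteq> 0"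
        using v V by (auto simp: card_eq_0_iff intro: finite_subset[of _ V])
      ultimately show "y v = 0" by simp
    qed
  qed simp
qed


section \<open>Infinitesimal rigidity of the complete graph on the vertices\<close>

definition vertex_pairs :: "'v set \<Rightarrow> 'v set set" where
  "vertex_pairs V = {e. e \<subseteq> V \<and> card e = 2}"

lemma finite_vertex_pairs: "finite V \<Longrightarrow> finite (vertex_pairs V)"
  unfolding vertex_pairs_def by (rule finite_subset[of _ "Pow V"]) auto

lemma vertex_pairsE:
  assumes "e \<in> vertex_pairs V"
  obtains u v where "e = {u, v}" "u \<in> V" "v \<in> V" "u \<noteq> v"
  using assms by (auto simp: vertex_pairs_def card_2_iff)

lemma doubleton_vertex_pairs: "u \<in> V \<Longrightarrow> v \<in> V \<Longrightarrow> u \<noteq> v \<Longrightarrow> {u, v} \<in> vertex_pairs V"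
  by (simp add: vertex_pairs_def)

text \<open>
  The row of the rigidity matrix for the pair \<open>e\<close>, with one block for each vertex; the sum over \<open>e\<close>
  picks the other endpoint, as the term for \<open>v\<close> itself is zero.
\<close>

definition row_vector :: "('v \<Rightarrow> real ^ 'd) \<Rightarrow> 'v set \<Rightarrow> 'v \<Rightarrow> real ^ 'd" where
  "row_vector p e v = (if v \<in> e then (\<Sum>u\<in>e. p v - p u) else 0)"

lemma rigidity_row_eq_inner:
  assumes V: "finite V" and e: "e \<in> vertex_pairs V"
  shows "rigidity_row p e w = (\<Sum>v\<in>V. row_vector p e v \<bullet> w v)"
proof -
  obtain x y where xy: "e = {x, y}" "x \<in> V" "y \<in> V" "x \<noteq> y"
    using e by (rule vertex_pairsE)
  have "(\<Sum>v\<in>V. row_vector p e v \<bullet> w v) = (\<Sum>v\<in>{x, y}. row_vector p e v \<bullet> w v)"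
    using V xy by (intro sum.mono_neutral_right) (auto simp: row_vector_def)
  also have "\<dots> = (p x - p y) \<bullet> w x + (p y - p x) \<bullet> w y"
    using xy by (simp add: row_vector_def)
  also have "\<dots> = rigidity_row p e w"
    unfolding xy(1) rigidity_row_edge by (simp add: inner_diff_left inner_diff_right)
  finally show ?thesis by simp
qed

text \<open>
  The velocity field of the rotations in the plane of the coordinates \<open>fst \<kappa>\<close> and \<open>snd \<kappa>\<close>.  It is
  zero if the two coordinates agree; \<open>trivial_motion\<close> uses these indices for the translations.
\<close>

definition infinitesimal_rotation :: "'d \<times> 'd \<Rightarrow> real ^ 'd \<Rightarrow> real ^ 'd" where
  "infinitesimal_rotation \<kappa> x = (x $ fst \<kappa>) *\<^sub>R axis (snd \<kappa>) 1 - (x $ snd \<kappa>) *\<^sub>R axis (fst \<kappa>) 1"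

definition trivial_motion :: "('v \<Rightarrow> real ^ 'd) \<Rightarrow> 'd \<times> 'd \<Rightarrow> 'v \<Rightarrow> real ^ 'd" where
  "trivial_motion p \<kappa> v =
     (if fst \<kappa> = snd \<kappa> then axis (fst \<kappa>) 1 else 0) + infinitesimal_rotation \<kappa> (p v)"

lemma inner_infinitesimal_rotation:
  "infinitesimal_rotation (i, j) x \<bullet> z = x $ i * z $ j - x $ j * z $ i"
  by (simp add: infinitesimal_rotation_def inner_diff_left inner_axis')

lemma linear_infinitesimal_rotation: "linear (infinitesimal_rotation \<kappa>)"
  by (rule linearI) (simp_all add: infinitesimal_rotation_def algebra_simps)

lemma infinitesimal_rotation_orthogonal: "x \<bullet> infinitesimal_rotation \<kappa> x = 0"
  by (cases \<kappa>) (simp add: inner_infinitesimal_rotation inner_commute[of x])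

text \<open>
  An index set for the trivial motions: the diagonal for the translations, and one of \<open>(i, j)\<close> and
  \<open>(j, i)\<close> for the rotation in each coordinate plane.  The type of coordinates carries no order by
  which a canonical choice could be made.
\<close>

definition half_pairs :: "('d \<times> 'd) set \<Rightarrow> bool" where
  "half_pairs K \<longleftrightarrow> (\<forall>i. (i, i) \<in> K) \<and> (\<forall>i j. i \<noteq> j \<longrightarrow> ((i, j) \<in> K \<longleftrightarrow> (j, i) \<notin> K))"

lemma half_pairsD:
  assumes "half_pairs K"
  shows "(i, i) \<in> K" "i \<noteq> j \<Longrightarrow> (i, j) \<in> K \<longleftrightarrow> (j, i) \<notin> K"
  using assms unfolding half_pairs_def by blast+

lemma half_pairs_exists:
  obtains K :: "('d::finite \<times> 'd) set" where "half_pairs K" "card K = (CARD('d) + 1) choose 2"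
proof -
  obtain f :: "'d \<Rightarrow> nat" where f: "inj f"
    using finite_imp_inj_to_nat_seg[OF finite_class.finite_UNIV] by blast
  define K where "K = {(i, j). f i \<le> f j}"
  have half: "half_pairs K"
    using f by (auto simp: half_pairs_def K_def dest: injD)
  have "K \<union> K\<inverse> = UNIV" "K \<inter> K\<inverse> = Id"
    using f by (auto simp: K_def dest: injD)
  then have "card K + card (K\<inverse>) = card (UNIV :: ('d \<times> 'd) set) + card (Id :: ('d \<times> 'd) set)"
    using card_Un_Int[of K "K\<inverse>"] by simp
  moreover have "card (Id :: ('d \<times> 'd) set) = CARD('d)"
  proof -
    have "(Id :: ('d \<times> 'd) set) = range (\<lambda>x. (x, x))" by auto
    then show ?thesis by (subst \<open>Id = _\<close>, subst card_image) (simp_all add: inj_on_def)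
  qed
  moreover have "card (K\<inverse>) = card K"
    by (rule card_inverse)
  ultimately have "2 * card K = CARD('d) * (CARD('d) + 1)"
    by simp
  then have "card K = (CARD('d) + 1) choose 2"
    by (simp add: choose_two)
  with half show ?thesis using that by blast
qed

lemma is_basis_linear_zero:
  fixes b :: "'d \<Rightarrow> real ^ 'd"
  assumes "is_basis b" "linear A" "\<And>k. A (b k) = 0"
  shows "A x = 0"
proof -
  have "x \<in> span (range b)" using assms(1) by (simp add: is_basis_def)
  then show ?thesis using linear_eq_0_on_span[OF assms(2)] assms(3) by blast
qed

lemma sum_coordinates:
  fixes x y :: "'v \<Rightarrow> real ^ 'd"
  shows "(\<Sum>j\<in>V \<times> UNIV. x (fst j) $ snd j * y (fst j) $ snd j) = (\<Sum>v\<in>V. x v \<bullet> y v)"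
  by (simp add: inner_vec_def sum.cartesian_product case_prod_unfold)

text \<open>
  A vanishing combination of trivial motions is an affine map that vanishes on the vertices.  Its linear
  part vanishes on the marked vectors, which span the space, and its matrix entries are the
  coefficients of the rotations.
\<close>

lemma trivial_motions_independent:
  fixes p :: "'v \<Rightarrow> real ^ 'd"
  assumes ab: "\<And>k. a k \<in> V \<and> b k \<in> V" and basis: "is_basis (marked_vector p a b)" and K: "half_pairs K"
  shows "family_independent (\<lambda>\<kappa> j. trivial_motion p \<kappa> (fst j) $ snd j) K (V \<times> UNIV)"
  unfolding family_independent_def
proof (intro allI impI)
  fix c :: "'d \<times> 'd \<Rightarrow> real"
  assume c: "\<forall>j\<in>V \<times> UNIV. (\<Sum>\<kappa>\<in>K. c \<kappa> * trivial_motion p \<kappa> (fst j) $ snd j) = 0"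
  define A where "A x = (\<Sum>\<kappa>\<in>K. c \<kappa> *\<^sub>R infinitesimal_rotation \<kappa> x)" for x :: "real ^ 'd"
  define t where "t = (\<Sum>\<kappa>\<in>K. c \<kappa> *\<^sub>R (if fst \<kappa> = snd \<kappa> then axis (fst \<kappa>) 1 else (0 :: real ^ 'd)))"
  have tA: "t + A (p v) = 0" if "v \<in> V" for v
  proof -
    have "(t + A (p v)) $ l = (\<Sum>\<kappa>\<in>K. c \<kappa> * trivial_motion p \<kappa> v $ l)" for l
      by (simp add: t_def A_def trivial_motion_def sum.distrib[symmetric] distrib_left)
    then show ?thesis using c that by (simp add: vec_eq_iff)
  qed
  have lin: "linear A"
    unfolding A_def by (intro linear_compose_sum ballI linear_compose_scale_right linear_infinitesimal_rotation)
  have "A (marked_vector p a b k) = 0" for k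
    using tA[of "a k"] tA[of "b k"] ab[of k] linear_diff[OF lin]
    by (simp add: marked_vector_def) (metis add_left_cancel)
  then have A0: "A x = 0" for x
    using is_basis_linear_zero[OF basis lin] by blast
  have off: "c (i, j) = 0" if ij: "(i, j) \<in> K" "i \<noteq> j" for i j
  proof -
    have "0 = A (axis i 1) $ j" by (simp add: A0)
    also have "\<dots> = (\<Sum>\<kappa>\<in>K. if \<kappa> = (i, j) then c \<kappa> else 0)"
      unfolding A_def sum_component
    proof (intro sum.cong refl)
      fix \<kappa> assume \<kappa>: "\<kappa> \<in> K"
      obtain i' j' where [simp]: "\<kappa> = (i', j')" by (cases \<kappa>)
      have "\<not> (i' = j \<and> j' = i)"
        using half_pairsD(2)[OF K ij(2)] ij(1) \<kappa> by auto
      then show "(c \<kappa> *\<^sub>R infinitesimal_rotation \<kappa> (axis i 1)) $ j = (if \<kappa> = (i, j) then c \<kappa> else 0)"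
        by (auto simp: infinitesimal_rotation_def axis_def)
    qed
    also have "\<dots> = c (i, j)" using ij by simp
    finally show ?thesis by simp
  qed
  have t0: "t = 0" using tA[of "a undefined"] ab A0 by simp
  have diag: "c (i, i) = 0" for i
  proof -
    have "0 = t $ i" by (simp add: t0)
    also have "\<dots> = (\<Sum>\<kappa>\<in>K. if \<kappa> = (i, i) then c \<kappa> else 0)"
      unfolding t_def sum_component by (intro sum.cong refl) (auto simp: axis_def)
    also have "\<dots> = c (i, i)" using half_pairsD(1)[OF K] by simp
    finally show ?thesis by simp
  qed
  show "\<forall>\<kappa>\<in>K. c \<kappa> = 0"
    using off diag by (metis surj_pair)
qed

lemma trivial_motion_preserves_lengths:
  assumes "e \<in> vertex_pairs V"
  shows "rigidity_row p e (trivial_motion p \<kappa>) = 0"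
proof -
  obtain x y where xy: "e = {x, y}"
    using assms by (rule vertex_pairsE)
  have "trivial_motion p \<kappa> x - trivial_motion p \<kappa> y = infinitesimal_rotation \<kappa> (p x - p y)"
    by (simp add: trivial_motion_def linear_diff[OF linear_infinitesimal_rotation])
  then show ?thesis
    by (simp add: xy rigidity_row_edge infinitesimal_rotation_orthogonal)
qed

text \<open>
  Let \<open>P v\<close> be the positions relative to their centroid.  Summing the first order length conditions over
  all pairs, with \<open>(\<Sum>v. y v) = 0\<close> by orthogonality to the translations, yields \<open>P u \<bullet> y u = 0\<close> for all \<open>u\<close>, so the matrix \<open>(P v \<bullet> y u)\<close> is antisymmetric.
  Orthogonality of \<open>y\<close> to the rotations says that \<open>N = (\<Sum>v. y v \<otimes> P v)\<close> is symmetric.  The traces of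
  the squares of these two matrices agree; one is at most zero and the other at least zero, hence all
  \<open>P v \<bullet> y u\<close> vanish, and the \<open>P v\<close> span the space.
\<close>

lemma infinitesimally_rigid:
  fixes p y :: "'v \<Rightarrow> real ^ 'd"
  assumes V: "finite V" and ab: "\<And>k. a k \<in> V \<and> b k \<in> V" and basis: "is_basis (marked_vector p a b)"
    and K: "half_pairs K"
    and rows: "\<And>e. e \<in> vertex_pairs V \<Longrightarrow> rigidity_row p e y = 0"
    and motions: "\<And>\<kappa>. \<kappa> \<in> K \<Longrightarrow> (\<Sum>v\<in>V. trivial_motion p \<kappa> v \<bullet> y v) = 0"
    and x: "x \<in> V"
  shows "y x = 0"
proof -
  define n where "n = real (card V)"
  have n: "n > 0" using V x by (auto simp: n_def card_gt_0_iff)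
  define c where "c = (1 / n) *\<^sub>R (\<Sum>v\<in>V. p v)"
  define P where "P v = p v - c" for v
  have sumP: "(\<Sum>v\<in>V. P v) = 0"
  proof -
    have "n *\<^sub>R c = (\<Sum>v\<in>V. p v)" using n by (simp add: c_def)
    then show ?thesis
      by (simp add: P_def sum_subtractf sum_constant_scaleR n_def del: sum_constant)
  qed
  have rot0: "infinitesimal_rotation (i, i) z = 0" for i and z :: "real ^ 'd"
    by (simp add: infinitesimal_rotation_def)
  have "(\<Sum>v\<in>V. y v $ i) = 0" for i
    using motions[OF half_pairsD(1)[OF K]] by (simp add: trivial_motion_def rot0 inner_axis')
  then have sumy: "(\<Sum>v\<in>V. y v) = 0" by (simp add: vec_eq_iff)
  define N where "N i j = (\<Sum>v\<in>V. y v $ i * P v $ j)" for i j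
  have N_p: "N i j = (\<Sum>v\<in>V. y v $ i * p v $ j)" for i j
  proof -
    have "N i j = (\<Sum>v\<in>V. y v $ i * p v $ j) - (\<Sum>v\<in>V. y v) $ i * c $ j"
      by (simp add: N_def P_def right_diff_distrib sum_subtractf sum_distrib_right)
    then show ?thesis by (simp add: sumy)
  qed
  have sym_K: "N i j = N j i" if "(i, j) \<in> K" "i \<noteq> j" for i j
  proof -
    have "0 = (\<Sum>v\<in>V. p v $ i * y v $ j - p v $ j * y v $ i)"
      using motions[OF that(1)] that(2) by (simp add: trivial_motion_def inner_infinitesimal_rotation)
    then show ?thesis by (simp add: N_p sum_subtractf mult.commute)
  qed
  have sym: "N i j = N j i" for i j
  proof (cases "i = j")
    case False
    then have "(i, j) \<in> K \<or> (j, i) \<in> K" using half_pairsD(2)[OF K] by blast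
    then show ?thesis using sym_K[of i j] sym_K[of j i] False by auto
  qed simp
  have pair: "P u \<bullet> y u + P v \<bullet> y v = P u \<bullet> y v + P v \<bullet> y u" if "u \<in> V" "v \<in> V" for u v
  proof (cases "u = v")
    case False
    then have "(p u - p v) \<bullet> (y u - y v) = 0"
      using rows[OF doubleton_vertex_pairs[OF that False]] by (simp add: rigidity_row_edge)
    moreover have "p u - p v = P u - P v" by (simp add: P_def)
    ultimately show ?thesis by (simp add: inner_diff_left inner_diff_right)
  qed simp
  define s where "s = (\<Sum>v\<in>V. P v \<bullet> y v)"
  have n_pair: "n * (P u \<bullet> y u) + s = 0" if "u \<in> V" for u
  proof -
    have "(\<Sum>v\<in>V. P u \<bullet> y u + P v \<bullet> y v) = (\<Sum>v\<in>V. P u \<bullet> y v + P v \<bullet> y u)"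
      using pair that by (intro sum.cong) auto
    then show ?thesis
      by (simp add: sum.distrib s_def n_def sumy sumP flip: inner_sum_left inner_sum_right)
  qed
  have "(\<Sum>u\<in>V. n * (P u \<bullet> y u) + s) = 0"
    using n_pair by simp
  then have "n * s + n * s = 0"
    by (simp add: sum.distrib s_def n_def flip: sum_distrib_left)
  then have "s = 0" using n by simp
  then have "P u \<bullet> y u = 0" if "u \<in> V" for u
    using n_pair[OF that] n by simp
  then have anti: "P v \<bullet> y u = - (P u \<bullet> y v)" if "u \<in> V" "v \<in> V" for u v
    using pair[OF that] that by simp
  \<comment> \<open>The matrix \<open>(P v \<bullet> y u)\<close> is antisymmetric while \<open>N\<close> is symmetric, and the trace of the
    square of either matrix is the same number.\<close>
  have "(\<Sum>u\<in>V. \<Sum>v\<in>V. (P v \<bullet> y u)\<^sup>2) = (\<Sum>u\<in>V. \<Sum>v\<in>V. - ((P v \<bullet> y u) * (P u \<bullet> y v)))"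
    by (intro sum.cong refl) (metis anti power2_eq_square mult_minus_right)
  also have "\<dots> = - (\<Sum>u\<in>V. \<Sum>v\<in>V. \<Sum>i\<in>UNIV. \<Sum>j\<in>UNIV. (y u $ i * P u $ j) * (y v $ j * P v $ i))"
    by (simp only: sum_negf inner_vec_def inner_real_def sum_product) (simp only: mult_ac)
  also have "(\<Sum>u\<in>V. \<Sum>v\<in>V. \<Sum>i\<in>UNIV. \<Sum>j\<in>UNIV. (y u $ i * P u $ j) * (y v $ j * P v $ i))
      = (\<Sum>i\<in>UNIV. \<Sum>j\<in>UNIV. \<Sum>u\<in>V. \<Sum>v\<in>V. (y u $ i * P u $ j) * (y v $ j * P v $ i))"
  proof -
    define g where "g u v i j = (y u $ i * P u $ j) * (y v $ j * P v $ i)" for u v i j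
    have "(\<Sum>u\<in>V. \<Sum>v\<in>V. \<Sum>i\<in>UNIV. \<Sum>j\<in>UNIV. g u v i j) = (\<Sum>u\<in>V. \<Sum>i\<in>UNIV. \<Sum>v\<in>V. \<Sum>j\<in>UNIV. g u v i j)"
      by (intro sum.cong refl) (rule sum.swap)
    also have "\<dots> = (\<Sum>i\<in>UNIV. \<Sum>u\<in>V. \<Sum>v\<in>V. \<Sum>j\<in>UNIV. g u v i j)"
      by (rule sum.swap)
    also have "\<dots> = (\<Sum>i\<in>UNIV. \<Sum>u\<in>V. \<Sum>j\<in>UNIV. \<Sum>v\<in>V. g u v i j)"
      by (intro sum.cong refl) (rule sum.swap)
    also have "\<dots> = (\<Sum>i\<in>UNIV. \<Sum>j\<in>UNIV. \<Sum>u\<in>V. \<Sum>v\<in>V. g u v i j)"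
      by (intro sum.cong refl) (rule sum.swap)
    finally show ?thesis by (simp add: g_def)
  qed
  also have "\<dots> = (\<Sum>i\<in>UNIV. \<Sum>j\<in>UNIV. (N i j)\<^sup>2)"
  proof (intro sum.cong refl)
    fix i j
    have "(\<Sum>u\<in>V. \<Sum>v\<in>V. (y u $ i * P u $ j) * (y v $ j * P v $ i)) = N i j * N j i"
      by (simp only: N_def sum_product)
    then show "(\<Sum>u\<in>V. \<Sum>v\<in>V. (y u $ i * P u $ j) * (y v $ j * P v $ i)) = (N i j)\<^sup>2"
      by (simp only: sym[of j i] power2_eq_square)
  qed
  finally have "(\<Sum>u\<in>V. \<Sum>v\<in>V. (P v \<bullet> y u)\<^sup>2) \<le> 0"
    by (simp add: sum_nonneg)
  then have "(\<Sum>u\<in>V. \<Sum>v\<in>V. (P v \<bullet> y u)\<^sup>2) = 0"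
    by (intro antisym sum_nonneg) auto
  then have "\<forall>v\<in>V. P v \<bullet> y x = 0"
    using V x by (simp add: sum_nonneg_eq_0_iff sum_nonneg)
  then have "marked_vector p a b k \<bullet> y x = 0" for k
    using ab[of k] by (simp add: marked_vector_def P_def inner_diff_left)
  then have "y x \<bullet> y x = 0"
    by (rule is_basis_linear_zero[OF basis bounded_linear.linear[OF bounded_linear_inner_left]])
  then show ?thesis by simp
qed

lemma maximal_independent_pairs:
  assumes V: "finite V" and E: "E \<subseteq> vertex_pairs V" "infinitesimally_independent E p"
  obtains B where "E \<subseteq> B" "B \<subseteq> vertex_pairs V" "infinitesimally_independent B p"
    and "\<And>y e. (\<And>e. e \<in> B \<Longrightarrow> rigidity_row p e y = 0) \<Longrightarrow> e \<in> vertex_pairs V \<Longrightarrow> rigidity_row p e y = 0"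
proof -
  define \<B> where "\<B> = {B. E \<subseteq> B \<and> B \<subseteq> vertex_pairs V \<and> infinitesimally_independent B p}"
  have "finite \<B>"
    unfolding \<B>_def using finite_vertex_pairs[OF V] by (auto intro: finite_subset[of _ "Pow (vertex_pairs V)"])
  moreover have "E \<in> \<B>" using E by (simp add: \<B>_def)
  ultimately obtain B where B: "B \<in> \<B>" and max: "\<And>C. C \<in> \<B> \<Longrightarrow> B \<subseteq> C \<Longrightarrow> B = C"
    using finite_has_maximal2[of \<B> E] by (metis (no_types, lifting))
  have finB: "finite B"
    using B finite_vertex_pairs[OF V] by (auto simp: \<B>_def intro: finite_subset)
  have "rigidity_row p e y = 0"
    if rows: "\<And>e. e \<in> B \<Longrightarrow> rigidity_row p e y = 0" and e: "e \<in> vertex_pairs V" for y e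
  proof (cases "e \<in> B")
    case False
    then have "insert e B \<notin> \<B>" using max by blast
    then have "\<not> infinitesimally_independent (insert e B) p"
      using B e by (auto simp: \<B>_def)
    then obtain c where c: "\<And>w. (\<Sum>e\<in>insert e B. c e * rigidity_row p e w) = 0"
      and nz: "\<not> (\<forall>e\<in>insert e B. c e = 0)"
      unfolding infinitesimally_independent_def by blast
    have split: "c e * rigidity_row p e w + (\<Sum>e\<in>B. c e * rigidity_row p e w) = 0" for w
      using c[of w] False finB by simp
    have "c e \<noteq> 0"
    proof
      assume "c e = 0"
      then have "\<forall>w. (\<Sum>e\<in>B. c e * rigidity_row p e w) = 0" using split by simp
      then have "\<forall>e\<in>B. c e = 0"
        using B by (simp add: \<B>_def infinitesimally_independent_def)
      with \<open>c e = 0\<close> nz show False by simp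
    qed
    with split[of y] rows show ?thesis by simp
  qed (rule rows)
  then show ?thesis using that B by (auto simp: \<B>_def)
qed

text \<open>
  The rows of a maximal independent set of pairs and the trivial motions satisfy the hypotheses of
  \<open>orthogonal_families_basis\<close> in the space of velocities.  The coordinate formula bounds a velocity in
  terms of its first order length changes and its products with the trivial motions.
\<close>

lemma infinitesimal_coordinates:
  fixes p :: "'v \<Rightarrow> real ^ 'd"
  assumes V: "finite V" and ab: "\<And>k. a k \<in> V \<and> b k \<in> V" and basis: "is_basis (marked_vector p a b)"
    and E: "E \<subseteq> vertex_pairs V" "infinitesimally_independent E p" and K: "half_pairs K"
  obtains B \<beta> \<eta> where "E \<subseteq> B" "B \<subseteq> vertex_pairs V" "card B + card K = card V * CARD('d)"
    and "\<And>y v i. v \<in> V \<Longrightarrow> y v $ i = (\<Sum>e\<in>B. rigidity_row p e y * \<beta> e (v, i))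
           + (\<Sum>\<kappa>\<in>K. (\<Sum>u\<in>V. trivial_motion p \<kappa> u \<bullet> y u) * \<eta> \<kappa> (v, i))"
proof -
  obtain B where B: "E \<subseteq> B" "B \<subseteq> vertex_pairs V" "infinitesimally_independent B p"
    and Bmax: "\<And>y e. (\<And>e. e \<in> B \<Longrightarrow> rigidity_row p e y = 0) \<Longrightarrow> e \<in> vertex_pairs V \<Longrightarrow> rigidity_row p e y = 0"
    using maximal_independent_pairs[OF V E] by blast
  have finB: "finite B"
    using B(2) finite_vertex_pairs[OF V] by (rule finite_subset)
  let ?J = "V \<times> (UNIV :: 'd set)"
  let ?a = "\<lambda>e j. row_vector p e (fst j) $ snd j" and ?c = "\<lambda>\<kappa> j. trivial_motion p \<kappa> (fst j) $ snd j"
  have row: "(\<Sum>j\<in>?J. ?a e j * y (fst j) $ snd j) = rigidity_row p e y" if "e \<in> B" for e y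
    using that B(2) by (simp add: sum_coordinates rigidity_row_eq_inner[OF V, symmetric] subset_iff)
  have mot: "(\<Sum>j\<in>?J. ?c \<kappa> j * y (fst j) $ snd j) = (\<Sum>u\<in>V. trivial_motion p \<kappa> u \<bullet> y u)" for \<kappa> y
    by (simp add: sum_coordinates)
  show ?thesis
  proof (rule orthogonal_families_basis[of B K ?J ?a ?c])
    show "finite B" "finite K" "finite ?J"
      using finB V by simp_all
    show "family_independent ?a B ?J"
      unfolding family_independent_def
    proof (intro allI impI)
      fix c assume c: "\<forall>j\<in>?J. (\<Sum>e\<in>B. c e * ?a e j) = 0"
      have "(\<Sum>e\<in>B. c e * rigidity_row p e w) = 0" for w
      proof -
        have "(\<Sum>e\<in>B. c e * rigidity_row p e w) = (\<Sum>e\<in>B. \<Sum>j\<in>?J. c e * ?a e j * w (fst j) $ snd j)"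
          by (intro sum.cong refl) (simp add: row[symmetric] sum_distrib_left mult.assoc)
        also have "\<dots> = (\<Sum>j\<in>?J. (\<Sum>e\<in>B. c e * ?a e j) * w (fst j) $ snd j)"
          by (subst sum.swap) (simp add: sum_distrib_right)
        also have "\<dots> = 0" using c by (intro sum.neutral) auto
        finally show ?thesis .
      qed
      then show "\<forall>e\<in>B. c e = 0"
        using B(3) by (simp add: infinitesimally_independent_def)
    qed
    show "family_independent ?c K ?J"
      by (rule trivial_motions_independent[OF ab basis K])
    show "(\<Sum>j\<in>?J. ?a e j * ?c \<kappa> j) = 0" if "e \<in> B" for e \<kappa>
      using row[OF that, of "trivial_motion p \<kappa>"] trivial_motion_preserves_lengths[of e V p \<kappa>] that B(2) by auto
    show "\<forall>j\<in>?J. y j = 0" if 1: "\<And>e. e \<in> B \<Longrightarrow> (\<Sum>j\<in>?J. ?a e j * y j) = 0"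
      and 2: "\<And>\<kappa>. \<kappa> \<in> K \<Longrightarrow> (\<Sum>j\<in>?J. ?c \<kappa> j * y j) = 0" for y
    proof -
      define z :: "'v \<Rightarrow> real ^ 'd" where "z v = (\<chi> i. y (v, i))" for v
      have y: "y = (\<lambda>j. z (fst j) $ snd j)" by (simp add: z_def)
      have "z v = 0" if "v \<in> V" for v
      proof (rule infinitesimally_rigid[OF V ab basis K _ _ that])
        show "rigidity_row p e z = 0" if "e \<in> vertex_pairs V" for e
          using Bmax[OF _ that, of z] 1 row by (simp add: y)
        show "(\<Sum>u\<in>V. trivial_motion p \<kappa> u \<bullet> z u) = 0" if "\<kappa> \<in> K" for \<kappa>
          using 2[OF that] mot[of \<kappa> z] by (simp add: y)
      qed
      then show ?thesis by (auto simp: y)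
    qed
    fix \<beta> \<eta>
    assume expand: "\<And>y j. j \<in> ?J \<Longrightarrow> y j = (\<Sum>e\<in>B. (\<Sum>l\<in>?J. ?a e l * y l) * \<beta> e j)
        + (\<Sum>\<kappa>\<in>K. (\<Sum>l\<in>?J. ?c \<kappa> l * y l) * \<eta> \<kappa> j)" and card: "card B + card K = card ?J"
    show thesis
    proof (rule that[OF B(1,2)])
      show "card B + card K = card V * CARD('d)"
        using card by (simp add: card_cartesian_product)
      fix y :: "'v \<Rightarrow> real ^ 'd" and v i
      assume "v \<in> V"
      then show "y v $ i = (\<Sum>e\<in>B. rigidity_row p e y * \<beta> e (v, i))
           + (\<Sum>\<kappa>\<in>K. (\<Sum>u\<in>V. trivial_motion p \<kappa> u \<bullet> y u) * \<eta> \<kappa> (v, i))"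
        using expand[of "(v, i)" "\<lambda>j. y (fst j) $ snd j"] row by (simp add: mot)
    qed
  qed
qed


section \<open>Aligning a placement with the given one\<close>

lemma compact_orthogonal_matrices: "compact {A :: real ^ 'd ^ 'd. orthogonal_matrix A}"
proof -
  have eq: "{A :: real ^ 'd ^ 'd. orthogonal_matrix A}
      = {A. \<forall>i j. (\<Sum>k\<in>UNIV. A $ k $ i * A $ k $ j) = (if i = j then 1 else 0)}"
    by (auto simp: orthogonal_matrix vec_eq_iff matrix_matrix_mult_def transpose_def mat_def)
  have "closed {A :: real ^ 'd ^ 'd. orthogonal_matrix A}"
    unfolding eq by (intro closed_Collect_all closed_Collect_eq continuous_intros)
  moreover have "norm A \<le> real (CARD('d) * CARD('d))" if "orthogonal_matrix A" for A :: "real ^ 'd ^ 'd"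
  proof -
    have entry: "\<bar>A $ k $ i\<bar> \<le> 1" for k i
    proof -
      have "A \<in> {A. \<forall>i j. (\<Sum>k\<in>UNIV. A $ k $ i * A $ k $ j) = (if i = j then 1 else 0)}"
        using that unfolding eq[symmetric] by simp
      then have "(\<Sum>k\<in>UNIV. (A $ k $ i)\<^sup>2) = 1"
        by (simp add: power2_eq_square)
      then have "(A $ k $ i)\<^sup>2 \<le> 1"
        using member_le_sum[of k UNIV "\<lambda>k. (A $ k $ i)\<^sup>2"] by simp
      then show ?thesis by (simp add: abs_square_le_1)
    qed
    have "norm A \<le> (\<Sum>k\<in>UNIV. norm (A $ k))"
      unfolding norm_vec_def by (rule L2_set_le_sum) simp
    also have "\<dots> \<le> (\<Sum>k\<in>(UNIV :: 'd set). \<Sum>i\<in>(UNIV :: 'd set). 1)"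
      by (intro sum_mono order_trans[OF norm_le_l1_cart] entry)
    finally show ?thesis by simp
  qed
  then have "bounded {A :: real ^ 'd ^ 'd. orthogonal_matrix A}"
    unfolding bounded_iff by blast
  ultimately show ?thesis by (simp add: compact_eq_bounded_closed)
qed

definition plane_rotation :: "'d \<Rightarrow> 'd \<Rightarrow> real \<Rightarrow> real ^ 'd \<Rightarrow> real ^ 'd" where
  "plane_rotation i j \<theta> z = z + (cos \<theta> - 1) *\<^sub>R ((z $ i) *\<^sub>R axis i 1 + (z $ j) *\<^sub>R axis j 1)
     + sin \<theta> *\<^sub>R infinitesimal_rotation (i, j) z"

lemma orthogonal_plane_rotation:
  assumes "i \<noteq> j"
  shows "orthogonal_transformation (plane_rotation i j \<theta>)"
  unfolding orthogonal_transformation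
proof (intro conjI allI)
  show "linear (plane_rotation i j \<theta>)"
    by (rule linearI) (simp_all add: plane_rotation_def infinitesimal_rotation_def algebra_simps)
  fix z :: "real ^ 'a"
  define e where "e = (z $ i) *\<^sub>R axis i 1 + (z $ j) *\<^sub>R (axis j 1 :: real ^ 'a)"
  define r where "r = infinitesimal_rotation (i, j) z"
  have in_e: "y \<bullet> e = y $ i * z $ i + y $ j * z $ j" and in_r: "y \<bullet> r = z $ i * y $ j - z $ j * y $ i" for y
    by (simp_all add: e_def r_def inner_add_right inner_axis inner_infinitesimal_rotation inner_commute[of y])
  have comps: "e $ i = z $ i" "e $ j = z $ j" "r $ i = - z $ j" "r $ j = z $ i"
    using assms by (simp_all add: e_def r_def infinitesimal_rotation_def axis_def)
  have "(z + (c - 1) *\<^sub>R e + s *\<^sub>R r) \<bullet> (z + (c - 1) *\<^sub>R e + s *\<^sub>R r)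
      = z \<bullet> z + (c\<^sup>2 + s\<^sup>2 - 1) * ((z $ i)\<^sup>2 + (z $ j)\<^sup>2)" for c s
    by (simp add: inner_add_left inner_add_right in_e in_r comps inner_commute[of e] inner_commute[of r])
      (simp add: power2_eq_square algebra_simps)
  from this[of "cos \<theta>" "sin \<theta>"]
  have "plane_rotation i j \<theta> z \<bullet> plane_rotation i j \<theta> z = z \<bullet> z"
    by (simp add: plane_rotation_def e_def r_def)
  then show "norm (plane_rotation i j \<theta> z) = norm z"
    by (simp add: norm_eq_sqrt_inner)
qed

text \<open>
  Translating the centroid of \<open>x\<close> to that of \<open>p\<close> does not increase the square distance to \<open>p\<close>.
  Among the rotations about the centroid choose one that minimizes the square distance, or
  equivalently maximizes \<open>(\<Sum>v. P v \<bullet> A (X v))\<close>.  The first order condition at the maximum, taken in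
  each coordinate plane, is orthogonality to the infinitesimal rotations.
\<close>

lemma aligned_congruent_placement:
  fixes p x :: "'v \<Rightarrow> real ^ 'd"
  assumes V: "finite V" "V \<noteq> {}"
  obtains g where "euclidean_isometry g"
    and "\<And>\<kappa>. (\<Sum>v\<in>V. trivial_motion p \<kappa> v \<bullet> g (x v)) = (\<Sum>v\<in>V. trivial_motion p \<kappa> v \<bullet> p v)"
    and "(\<Sum>v\<in>V. (dist (g (x v)) (p v))\<^sup>2) \<le> (\<Sum>v\<in>V. (dist (x v) (p v))\<^sup>2)"
proof -
  define n where "n = real (card V)"
  have n: "n > 0" using V by (simp add: n_def card_gt_0_iff)
  define c where "c = (1 / n) *\<^sub>R (\<Sum>v\<in>V. p v)"
  define t where "t = c - (1 / n) *\<^sub>R (\<Sum>v\<in>V. x v)"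
  have sum_p: "(\<Sum>v\<in>V. p v) = n *\<^sub>R c" and sum_x: "(\<Sum>v\<in>V. x v) = n *\<^sub>R (c - t)"
    using n by (simp_all add: c_def t_def)
  have sum_const: "(\<Sum>v\<in>V. z) = n *\<^sub>R z" for z :: "real ^ 'd"
    by (simp add: sum_constant_scaleR n_def del: sum_constant)
  define P where "P v = p v - c" for v
  define X where "X v = x v + t - c" for v
  have sumP: "(\<Sum>v\<in>V. P v) = 0" and sumX: "(\<Sum>v\<in>V. X v) = 0"
    by (simp_all add: P_def X_def sum.distrib sum_subtractf sum_p sum_x sum_const scaleR_diff_right
        del: sum_constant)
  let ?h = "\<lambda>A. \<Sum>v\<in>V. P v \<bullet> (A *v X v)"
  have "continuous_on {A. orthogonal_matrix A} ?h"
    unfolding inner_vec_def matrix_vector_mult_def by (simp, intro continuous_intros)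
  moreover have "{A :: real ^ 'd ^ 'd. orthogonal_matrix A} \<noteq> {}"
    using orthogonal_matrix_id by blast
  ultimately obtain A where A: "orthogonal_matrix A"
    and max: "\<And>B. orthogonal_matrix B \<Longrightarrow> ?h B \<le> ?h A"
    using continuous_attains_sup[OF compact_orthogonal_matrices, of ?h] by auto
  define z where "z v = A *v X v" for v
  have A_orth: "orthogonal_transformation ((*v) A)"
    using A by (simp add: orthogonal_transformation_matrix)
  have sumz: "(\<Sum>v\<in>V. z v) = 0"
    using sumX by (simp add: z_def linear_sum[OF matrix_vector_mul_linear, symmetric])
  have norm_z: "norm (z v) = norm (X v)" for v
    using A_orth by (simp add: z_def orthogonal_transformation)
  define g where "g y = c + A *v (y + t - c)" for y
  have gx: "g (x v) = c + z v" for v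
    by (simp add: g_def z_def X_def)
  have iso: "euclidean_isometry g"
    unfolding euclidean_isometry_def
  proof (intro allI)
    fix y y'
    have "dist (g y) (g y') = norm (A *v (y - y'))"
      by (simp add: g_def dist_norm flip: matrix_vector_mult_diff_distrib)
    then show "dist (g y) (g y') = dist y y'"
      using A_orth by (simp add: orthogonal_transformation dist_norm)
  qed
  have rot: "(\<Sum>v\<in>V. infinitesimal_rotation \<kappa> (P v) \<bullet> z v) = 0" for \<kappa>
  proof -
    obtain i j where \<kappa>: "\<kappa> = (i, j)" by (cases \<kappa>)
    show ?thesis
    proof (cases "i = j")
      case False
      define \<alpha> where "\<alpha> = (\<Sum>v\<in>V. P v $ i * z v $ i + P v $ j * z v $ j)"
      define \<gamma> where "\<gamma> = (\<Sum>v\<in>V. P v $ j * z v $ i - P v $ i * z v $ j)"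
      \<comment> \<open>\<open>F\<close> is the change of the maximized function under a further rotation by \<open>\<theta>\<close>.\<close>
      define F where "F \<theta> = (cos \<theta> - 1) * \<alpha> + sin \<theta> * \<gamma>" for \<theta>
      have F_le: "F \<theta> \<le> 0" for \<theta>
      proof -
        have lin: "linear (plane_rotation i j \<theta>)"
          and orth: "orthogonal_matrix (matrix (plane_rotation i j \<theta>))"
          using orthogonal_plane_rotation[OF False, of \<theta>] by (auto simp: orthogonal_transformation_matrix)
        have "?h (matrix (plane_rotation i j \<theta>) ** A) = (\<Sum>v\<in>V. P v \<bullet> plane_rotation i j \<theta> (z v))"
          by (simp add: z_def fun_cong[OF matrix_vector_mul(2)[OF lin]] flip: matrix_vector_mul_assoc)
        also have "\<dots> = (\<Sum>v\<in>V. P v \<bullet> z v + (cos \<theta> - 1) * (P v $ i * z v $ i + P v $ j * z v $ j)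
            + sin \<theta> * (P v $ j * z v $ i - P v $ i * z v $ j))"
          by (intro sum.cong refl) (simp add: plane_rotation_def inner_add_right inner_axis
              inner_commute[of _ "infinitesimal_rotation _ _"] inner_infinitesimal_rotation algebra_simps)
        also have "\<dots> = ?h A + F \<theta>"
          by (simp add: sum.distrib F_def \<alpha>_def \<gamma>_def z_def flip: sum_distrib_left)
        finally show ?thesis
          using max[OF orthogonal_matrix_mul[OF orth A]] by simp
      qed
      have "(F has_real_derivative \<gamma>) (at 0)"
        unfolding F_def[abs_def] by (auto intro!: derivative_eq_intros)
      moreover have "\<forall>\<theta>. \<bar>0 - \<theta>\<bar> < 1 \<longrightarrow> F \<theta> \<le> F 0"
        using F_le by (simp add: F_def)
      ultimately have "\<gamma> = 0"
        using DERIV_local_max[of F \<gamma> 0 1] by simp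
      then show ?thesis
        by (simp add: \<kappa> inner_infinitesimal_rotation \<gamma>_def sum_subtractf)
    qed (simp add: \<kappa> inner_infinitesimal_rotation)
  qed
  have aligned: "(\<Sum>v\<in>V. trivial_motion p \<kappa> v \<bullet> g (x v)) = (\<Sum>v\<in>V. trivial_motion p \<kappa> v \<bullet> p v)" for \<kappa>
  proof -
    define w where "w = (if fst \<kappa> = snd \<kappa> then axis (fst \<kappa>) 1 else (0 :: real ^ 'd))"
    define R where "R = infinitesimal_rotation \<kappa>"
    have linR: "linear R" by (simp add: R_def linear_infinitesimal_rotation)
    have tm: "trivial_motion p \<kappa> v = (w + R c) + R (P v)" for v
      by (simp add: trivial_motion_def w_def R_def P_def linear_diff[OF linear_infinitesimal_rotation])
    have sumR: "(\<Sum>v\<in>V. R (P v)) = 0"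
      using sumP by (simp add: linear_0[OF linR] flip: linear_sum[OF linR])
    have *: "(\<Sum>v\<in>V. trivial_motion p \<kappa> v \<bullet> (c + y v)) = n * ((w + R c) \<bullet> c)"
      if "(\<Sum>v\<in>V. y v) = 0" "(\<Sum>v\<in>V. R (P v) \<bullet> y v) = 0" for y
    proof -
      have "(\<Sum>v\<in>V. trivial_motion p \<kappa> v \<bullet> (c + y v))
          = (\<Sum>v\<in>V. (w + R c) \<bullet> c) + (w + R c) \<bullet> (\<Sum>v\<in>V. y v) + (\<Sum>v\<in>V. R (P v)) \<bullet> c + (\<Sum>v\<in>V. R (P v) \<bullet> y v)"
        by (simp add: tm inner_add_left inner_add_right sum.distrib inner_sum_left inner_sum_right)
      then show ?thesis by (simp add: that sumR n_def)
    qed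
    have "(\<Sum>v\<in>V. R (P v) \<bullet> P v) = 0"
      by (simp add: R_def infinitesimal_rotation_orthogonal inner_commute)
    then have "(\<Sum>v\<in>V. trivial_motion p \<kappa> v \<bullet> (c + P v)) = n * ((w + R c) \<bullet> c)"
      by (intro * sumP)
    moreover have "(\<Sum>v\<in>V. trivial_motion p \<kappa> v \<bullet> (c + z v)) = n * ((w + R c) \<bullet> c)"
      using rot[of \<kappa>] by (intro * sumz) (simp add: R_def)
    ultimately show ?thesis by (simp add: gx P_def)
  qed
  have "(\<Sum>v\<in>V. (dist (g (x v)) (p v))\<^sup>2) \<le> (\<Sum>v\<in>V. (dist (x v) (p v))\<^sup>2)"
  proof -
    have "(\<Sum>v\<in>V. (dist (g (x v)) (p v))\<^sup>2) = (\<Sum>v\<in>V. X v \<bullet> X v + P v \<bullet> P v - 2 * (P v \<bullet> z v))"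
    proof (intro sum.cong refl)
      fix v
      have "g (x v) - p v = z v - P v" by (simp add: gx P_def)
      moreover have "z v \<bullet> z v = X v \<bullet> X v" using norm_z by (simp add: dot_square_norm)
      ultimately show "(dist (g (x v)) (p v))\<^sup>2 = X v \<bullet> X v + P v \<bullet> P v - 2 * (P v \<bullet> z v)"
        by (simp add: dist_norm power2_norm_eq_inner inner_diff_left inner_diff_right inner_commute)
    qed
    also have "\<dots> \<le> (\<Sum>v\<in>V. X v \<bullet> X v + P v \<bullet> P v - 2 * (P v \<bullet> X v))"
      using max[OF orthogonal_matrix_id] by (simp add: sum_subtractf z_def flip: sum_distrib_left)
    also have "\<dots> \<le> (\<Sum>v\<in>V. X v \<bullet> X v + P v \<bullet> P v - 2 * (P v \<bullet> X v)) + n * (t \<bullet> t)"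
      using n by simp
    also have "\<dots> = (\<Sum>v\<in>V. (dist (x v) (p v))\<^sup>2)"
    proof -
      have "(dist (x v) (p v))\<^sup>2 = (X v \<bullet> X v + P v \<bullet> P v - 2 * (P v \<bullet> X v)) + t \<bullet> t - 2 * (t \<bullet> (X v - P v))" for v
      proof -
        have "x v - p v = (X v - P v) - t" by (simp add: X_def P_def)
        then show ?thesis
          by (simp add: dist_norm power2_norm_eq_inner inner_diff_left inner_diff_right inner_commute)
      qed
      moreover have "(\<Sum>v\<in>V. t \<bullet> (X v - P v)) = 0"
        by (simp add: sum_subtractf sumX sumP flip: inner_sum_right)
      ultimately show ?thesis
        by (simp add: sum.distrib sum_subtractf n_def flip: sum_distrib_left)
    qed
    finally show ?thesis .
  qed
  with iso aligned show ?thesis using that by blast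
qed

section \<open>Edge lengths as local coordinates\<close>

text \<open>
  The derivative at \<open>p\<close> of these functions is injective, with an explicit inverse given by the
  coordinate formula.  Let \<open>z = x - x'\<close>.  Squared lengths are quadratic, so equal lengths of a pair at
  \<open>x\<close> and \<open>x'\<close> make its row at \<open>(x + x') / 2\<close> vanish on \<open>z\<close>; the row at \<open>p\<close> is then at most \<open>O(\<epsilon>)\<close>
  times the size of \<open>z\<close>.  For small \<open>\<epsilon>\<close> the inverse allows this only if \<open>z\<close> is zero.
\<close>

lemma local_length_coordinates_injective:
  fixes p :: "'v \<Rightarrow> real ^ 'd"
  assumes V: "finite V" and B: "B \<subseteq> vertex_pairs V"
    and coords: "\<And>y v i. v \<in> V \<Longrightarrow> y v $ i = (\<Sum>e\<in>B. rigidity_row p e y * \<beta> e (v, i))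
           + (\<Sum>\<kappa>\<in>K. (\<Sum>u\<in>V. trivial_motion p \<kappa> u \<bullet> y u) * \<eta> \<kappa> (v, i))"
  obtains \<epsilon> where "\<epsilon> > 0"
    and "\<And>x x'. (\<Sum>v\<in>V. (dist (x v) (p v))\<^sup>2) < \<epsilon>\<^sup>2 \<Longrightarrow> (\<Sum>v\<in>V. (dist (x' v) (p v))\<^sup>2) < \<epsilon>\<^sup>2 \<Longrightarrow>
      (\<And>e. e \<in> B \<Longrightarrow> rigidity_row x e x = rigidity_row x' e x') \<Longrightarrow>
      (\<And>\<kappa>. \<kappa> \<in> K \<Longrightarrow> (\<Sum>v\<in>V. trivial_motion p \<kappa> v \<bullet> x v) = (\<Sum>v\<in>V. trivial_motion p \<kappa> v \<bullet> x' v)) \<Longrightarrow>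
      \<forall>v\<in>V. x v = x' v"
proof -
  define C where "C = (\<Sum>v\<in>V. \<Sum>i\<in>UNIV. \<Sum>e\<in>B. \<bar>\<beta> e (v, i)\<bar>)"
  have C: "C \<ge> 0" by (simp add: C_def sum_nonneg)
  \<comment> \<open>The estimate below is \<open>m \<le> 2 * \<epsilon> * C * m\<close>, and this choice makes the factor less than one.\<close>
  define \<epsilon> where "\<epsilon> = 1 / (2 * (C + 1))"
  have \<epsilon>: "\<epsilon> > 0" using C by (simp add: \<epsilon>_def)
  have "\<forall>v\<in>V. x v = x' v"
    if x: "(\<Sum>v\<in>V. (dist (x v) (p v))\<^sup>2) < \<epsilon>\<^sup>2" and x': "(\<Sum>v\<in>V. (dist (x' v) (p v))\<^sup>2) < \<epsilon>\<^sup>2"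
      and len: "\<And>e. e \<in> B \<Longrightarrow> rigidity_row x e x = rigidity_row x' e x'"
      and mot: "\<And>\<kappa>. \<kappa> \<in> K \<Longrightarrow> (\<Sum>v\<in>V. trivial_motion p \<kappa> v \<bullet> x v) = (\<Sum>v\<in>V. trivial_motion p \<kappa> v \<bullet> x' v)"
    for x x'
  proof -
    have close: "norm (y v - p v) \<le> \<epsilon>" if "(\<Sum>v\<in>V. (dist (y v) (p v))\<^sup>2) < \<epsilon>\<^sup>2" "v \<in> V" for y v
    proof -
      have "(dist (y v) (p v))\<^sup>2 \<le> (\<Sum>v\<in>V. (dist (y v) (p v))\<^sup>2)"
        using V that(2) by (intro member_le_sum) auto
      then have "(dist (y v) (p v))\<^sup>2 \<le> \<epsilon>\<^sup>2" using that(1) by linarith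
      then show ?thesis using \<epsilon> by (simp add: dist_norm abs_le_square_iff[symmetric])
    qed
    define z where "z v = x v - x' v" for v
    define m where "m = (\<Sum>v\<in>V. norm (z v))"
    have m: "m \<ge> 0" by (simp add: m_def sum_nonneg)
    have row_small: "\<bar>rigidity_row p e z\<bar> \<le> 2 * \<epsilon> * m" if e: "e \<in> B" for e
    proof -
      obtain u v where uv: "e = {u, v}" "u \<in> V" "v \<in> V" "u \<noteq> v"
        using e B by (blast elim: vertex_pairsE)
      define D where "D w = (x w - p w) + (x' w - p w)" for w
      have D: "norm (D w) \<le> 2 * \<epsilon>" if "w \<in> V" for w
        using norm_triangle_ineq[of "x w - p w" "x' w - p w"] close[OF x that] close[OF x' that]
        by (simp add: D_def)
      define f f' q where "f = x u - x v" and "f' = x' u - x' v" and "q = p u - p v"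
      have "f \<bullet> f = f' \<bullet> f'"
        using len[OF e] by (simp add: uv rigidity_row_edge f_def f'_def)
      then have "0 = 2 * (q \<bullet> (f - f')) + ((f + f') - 2 *\<^sub>R q) \<bullet> (f - f')"
        by (simp add: inner_diff_left inner_diff_right inner_add_left inner_add_right inner_commute)
      moreover have "D u - D v = (f + f') - 2 *\<^sub>R q" "z u - z v = f - f'"
        by (simp_all add: D_def z_def f_def f'_def q_def scaleR_2)
      ultimately have "0 = 2 * ((p u - p v) \<bullet> (z u - z v)) + (D u - D v) \<bullet> (z u - z v)"
        by (simp only: q_def)
      then have "2 * \<bar>rigidity_row p e z\<bar> = \<bar>(D u - D v) \<bullet> (z u - z v)\<bar>"
        by (simp add: uv rigidity_row_edge)
      also have "\<dots> \<le> norm (D u - D v) * norm (z u - z v)"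
        by (rule Cauchy_Schwarz_ineq2)
      also have "\<dots> \<le> (4 * \<epsilon>) * m"
      proof (rule mult_mono)
        show "norm (D u - D v) \<le> 4 * \<epsilon>"
          using norm_triangle_ineq4[of "D u" "D v"] D[OF uv(2)] D[OF uv(3)] by linarith
        have "(\<Sum>w\<in>{u, v}. norm (z w)) \<le> m"
          unfolding m_def using V uv by (intro sum_mono2) auto
        then show "norm (z u - z v) \<le> m"
          using norm_triangle_ineq4[of "z u" "z v"] uv(4) by simp
      qed (use \<epsilon> in simp_all)
      finally show ?thesis by simp
    qed
    have motz: "(\<Sum>u\<in>V. trivial_motion p \<kappa> u \<bullet> z u) = 0" if "\<kappa> \<in> K" for \<kappa>
      using mot[OF that] by (simp add: z_def inner_diff_right sum_subtractf)
    have "m \<le> (\<Sum>v\<in>V. \<Sum>i\<in>UNIV. \<bar>z v $ i\<bar>)"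
      unfolding m_def by (intro sum_mono norm_le_l1_cart)
    also have "\<dots> \<le> (\<Sum>v\<in>V. \<Sum>i\<in>UNIV. \<Sum>e\<in>B. (2 * \<epsilon> * m) * \<bar>\<beta> e (v, i)\<bar>)"
    proof (intro sum_mono)
      fix v i assume "v \<in> V"
      then have "\<bar>z v $ i\<bar> = \<bar>\<Sum>e\<in>B. rigidity_row p e z * \<beta> e (v, i)\<bar>"
        using coords[of v z i] motz by simp
      also have "\<dots> \<le> (\<Sum>e\<in>B. \<bar>rigidity_row p e z\<bar> * \<bar>\<beta> e (v, i)\<bar>)"
        by (simp add: sum_abs flip: abs_mult)
      also have "\<dots> \<le> (\<Sum>e\<in>B. (2 * \<epsilon> * m) * \<bar>\<beta> e (v, i)\<bar>)"
        by (intro sum_mono mult_right_mono row_small) auto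
      finally show "\<bar>z v $ i\<bar> \<le> (\<Sum>e\<in>B. (2 * \<epsilon> * m) * \<bar>\<beta> e (v, i)\<bar>)" .
    qed
    also have "\<dots> = 2 * \<epsilon> * m * C"
      by (simp add: C_def sum_distrib_left)
    finally have "m \<le> m * (C / (C + 1))"
      using C by (simp add: \<epsilon>_def field_simps)
    then have "m * (1 - C / (C + 1)) \<le> 0" by (simp add: right_diff_distrib)
    moreover have "1 - C / (C + 1) > 0" using C by (simp add: field_simps)
    ultimately have "m = 0" using m by (simp add: mult_le_0_iff)
    then show ?thesis
      using V by (simp add: m_def sum_nonneg_eq_0_iff z_def)
  qed
  with \<epsilon> show ?thesis using that by blast
qed


section \<open>Quotient topologies and local charts\<close>

lemma topspace_quotient_topology:
  assumes "equiv (topspace T) r"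
  shows "topspace (quotient_topology T r) = topspace T // r"
proof -
  have "openin (quotient_topology T r) (topspace T // r)"
    by (simp add: openin_quotient_topology[OF assms] Union_quotient[OF assms])
  moreover have "openin (quotient_topology T r) S \<Longrightarrow> S \<subseteq> topspace T // r" for S
    by (simp add: openin_quotient_topology[OF assms])
  ultimately show ?thesis
    by (meson openin_subset openin_topspace subset_antisym)
qed

lemma class_member_iff:
  assumes "equiv X r" "\<U> \<subseteq> X // r" "x \<in> X"
  shows "r `` {x} \<in> \<U> \<longleftrightarrow> x \<in> \<Union>\<U>"
proof
  assume "r `` {x} \<in> \<U>"
  then show "x \<in> \<Union>\<U>" using equiv_class_self[OF assms(1,3)] by blast
next
  assume "x \<in> \<Union>\<U>"
  then obtain C where C: "C \<in> \<U>" "x \<in> C" by blast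
  then have "C = r `` {x}"
    using assms(2) quotientI[OF assms(3), of r] equiv_class_self[OF assms(1,3)]
      quotient_disj[OF assms(1), of C "r `` {x}"] by blast
  with C show "r `` {x} \<in> \<U>" by simp
qed

lemma quotient_map_class:
  assumes "equiv (topspace T) r"
  shows "quotient_map T (quotient_topology T r) (\<lambda>x. r `` {x})"
  unfolding quotient_map_def
proof (intro conjI allI impI)
  show "(\<lambda>x. r `` {x}) ` topspace T = topspace (quotient_topology T r)"
    by (auto simp: topspace_quotient_topology[OF assms] quotient_def)
  fix \<U>
  assume "\<U> \<subseteq> topspace (quotient_topology T r)"
  then have \<U>: "\<U> \<subseteq> topspace T // r" by (simp add: topspace_quotient_topology[OF assms])
  have "{x \<in> topspace T. r `` {x} \<in> \<U>} = \<Union>\<U>"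
    using class_member_iff[OF assms \<U>] \<U> Union_quotient[OF assms] by blast
  then show "openin T {x \<in> topspace T. r `` {x} \<in> \<U>} \<longleftrightarrow> openin (quotient_topology T r) \<U>"
    by (simp add: openin_quotient_topology[OF assms] \<U>)
qed

lemma open_saturated_classes:
  assumes eq: "equiv (topspace T) r" and A: "openin T A" and sat: "\<And>x y. (x, y) \<in> r \<Longrightarrow> x \<in> A \<Longrightarrow> y \<in> A"
  shows "openin (quotient_topology T r) ((\<lambda>x. r `` {x}) ` A)"
    and "quotient_map (subtopology T A) (subtopology (quotient_topology T r) ((\<lambda>x. r `` {x}) ` A)) (\<lambda>x. r `` {x})"
proof -
  let ?A = "(\<lambda>x. r `` {x}) ` A"
  have AT: "A \<subseteq> topspace T" using A by (rule openin_subset)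
  have pre: "{x \<in> topspace T. r `` {x} \<in> ?A} = A"
  proof (intro equalityI subsetI)
    fix x assume "x \<in> {x \<in> topspace T. r `` {x} \<in> ?A}"
    then obtain y where "y \<in> A" "r `` {x} = r `` {y}" "x \<in> topspace T" by blast
    then have "(y, x) \<in> r" using equiv_class_self[OF eq] by blast
    then show "x \<in> A" using sat \<open>y \<in> A\<close> by blast
  qed (use AT in auto)
  have "?A \<subseteq> topspace (quotient_topology T r)"
    using AT by (auto simp: topspace_quotient_topology[OF eq] intro: quotientI)
  then show op: "openin (quotient_topology T r) ?A"
    using quotient_map_class[OF eq] A pre unfolding quotient_map_def by metis
  show "quotient_map (subtopology T A) (subtopology (quotient_topology T r) ?A) (\<lambda>x. r `` {x})"
    by (rule quotient_map_restriction[OF quotient_map_class[OF eq] pre]) (use op in simp)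
qed

text \<open>
  An open embedding with saturated image that respects and reflects the equivalence relations induces
  an open embedding of the quotients, because a continuous map through which a quotient map factors is
  a quotient map.
\<close>

lemma quotient_open_embedding:
  assumes eq1: "equiv (topspace T\<^sub>1) r\<^sub>1" and eq2: "equiv (topspace T\<^sub>2) r\<^sub>2"
    and A: "openin T\<^sub>2 A" and sat: "\<And>x y. (x, y) \<in> r\<^sub>2 \<Longrightarrow> x \<in> A \<Longrightarrow> y \<in> A"
    and \<Phi>: "homeomorphic_map T\<^sub>1 (subtopology T\<^sub>2 A) \<Phi>"
    and iff: "\<And>x y. x \<in> topspace T\<^sub>1 \<Longrightarrow> y \<in> topspace T\<^sub>1 \<Longrightarrow> (x, y) \<in> r\<^sub>1 \<longleftrightarrow> (\<Phi> x, \<Phi> y) \<in> r\<^sub>2"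
  shows "\<And>x. x \<in> topspace T\<^sub>1 \<Longrightarrow> \<Phi> ` (r\<^sub>1 `` {x}) = r\<^sub>2 `` {\<Phi> x}"
    and "homeomorphic_map (quotient_topology T\<^sub>1 r\<^sub>1)
           (subtopology (quotient_topology T\<^sub>2 r\<^sub>2) ((\<lambda>x. r\<^sub>2 `` {x}) ` A)) (\<lambda>C. \<Phi> ` C)"
proof -
  let ?c1 = "\<lambda>x. r\<^sub>1 `` {x}" and ?c2 = "\<lambda>x. r\<^sub>2 `` {x}"
  let ?Q1 = "quotient_topology T\<^sub>1 r\<^sub>1" and ?Q2 = "subtopology (quotient_topology T\<^sub>2 r\<^sub>2) (?c2 ` A)"
  have AT: "A \<subseteq> topspace T\<^sub>2" using A by (rule openin_subset)
  have surj: "\<Phi> ` topspace T\<^sub>1 = A"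
    using homeomorphic_imp_surjective_map[OF \<Phi>] AT by (simp add: Int_absorb1)
  show cls: "\<Phi> ` (?c1 x) = ?c2 (\<Phi> x)" if x: "x \<in> topspace T\<^sub>1" for x
  proof (intro equalityI subsetI)
    fix y assume "y \<in> \<Phi> ` (?c1 x)"
    then obtain x' where "(x, x') \<in> r\<^sub>1" "y = \<Phi> x'" by blast
    then show "y \<in> ?c2 (\<Phi> x)" using iff x eq1 equiv_type by blast
  next
    fix y assume y: "y \<in> ?c2 (\<Phi> x)"
    then have "y \<in> A" using sat surj x by blast
    then obtain x' where "x' \<in> topspace T\<^sub>1" "y = \<Phi> x'" using surj by blast
    then show "y \<in> \<Phi> ` (?c1 x)" using iff x y by blast
  qed
  have q1: "quotient_map T\<^sub>1 ?Q1 ?c1"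
    by (rule quotient_map_class[OF eq1])
  have "quotient_map T\<^sub>1 ?Q2 (?c2 \<circ> \<Phi>)"
    using quotient_map_compose[OF conjunct1[OF \<Phi>[unfolded homeomorphic_map_def]] open_saturated_classes(2)[OF eq2 A sat]] .
  then have q2: "quotient_map T\<^sub>1 ?Q2 ((\<lambda>C. \<Phi> ` C) \<circ> ?c1)"
    by (rule quotient_map_eq) (simp add: cls)
  have cont: "continuous_map ?Q1 ?Q2 (\<lambda>C. \<Phi> ` C)"
    using continuous_compose_quotient_map_eq[OF q1] quotient_imp_continuous_map[OF q2] by blast
  have "quotient_map ?Q1 ?Q2 (\<lambda>C. \<Phi> ` C)"
    by (rule quotient_map_from_composition[OF quotient_imp_continuous_map[OF q1] cont q2])
  moreover have "inj_on (\<lambda>C. \<Phi> ` C) (topspace ?Q1)"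
  proof (rule inj_onI)
    fix C D assume C: "C \<in> topspace ?Q1" and D: "D \<in> topspace ?Q1" and e: "\<Phi> ` C = \<Phi> ` D"
    have "inj_on \<Phi> (topspace T\<^sub>1)" using homeomorphic_imp_injective_map[OF \<Phi>] .
    moreover have "C \<subseteq> topspace T\<^sub>1" "D \<subseteq> topspace T\<^sub>1"
      using C D by (simp_all add: topspace_quotient_topology[OF eq1] in_quotient_imp_subset[OF eq1])
    ultimately show "C = D" using e by (simp add: inj_on_image_eq_iff)
  qed
  ultimately show "homeomorphic_map ?Q1 ?Q2 (\<lambda>C. \<Phi> ` C)"
    by (simp add: homeomorphic_map_def)
qed

lemma continuous_map_Euclidean_space_coordinate:
  "continuous_map (Euclidean_space f) euclideanreal (\<lambda>x. x i)"
  unfolding Euclidean_space_def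
  by (rule continuous_map_from_subtopology, rule continuous_map_product_projection) simp

lemma Euclidean_space_box_subset:
  assumes Y: "openin (Euclidean_space f) Y" and c: "c \<in> Y"
  obtains r where "r > 0" "\<And>x. x \<in> topspace (Euclidean_space f) \<Longrightarrow> (\<And>i. i < f \<Longrightarrow> \<bar>x i - c i\<bar> < r) \<Longrightarrow> x \<in> Y"
proof -
  obtain S where S: "openin (powertop_real UNIV) S" "Y = S \<inter> {x. \<forall>i\<ge>f. x i = 0}"
    using Y by (auto simp: Euclidean_space_def openin_subtopology)
  have "\<forall>x\<in>S. \<exists>U. finite {i. U i \<noteq> UNIV} \<and> (\<forall>i. open (U i)) \<and> x \<in> PiE UNIV U \<and> PiE UNIV U \<subseteq> S"
    using S(1) by (simp add: openin_product_topology_alt)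
  then obtain U where U: "\<And>i. open (U i)" "c \<in> PiE UNIV U" "PiE UNIV U \<subseteq> S"
    using c S(2) by blast
  have "\<exists>r>0. \<forall>y. \<bar>y - c i\<bar> < r \<longrightarrow> y \<in> U i" for i
    using U(1)[of i] U(2) by (auto simp: open_dist dist_real_def PiE_iff)
  then obtain \<rho> where \<rho>: "\<And>i. \<rho> i > 0" "\<And>i y. \<bar>y - c i\<bar> < \<rho> i \<Longrightarrow> y \<in> U i"
    by metis
  define r where "r = Min (insert 1 (\<rho> ` {..<f}))"
  have "r > 0" using \<rho>(1) by (simp add: r_def)
  moreover have "x \<in> Y" if x: "x \<in> topspace (Euclidean_space f)" "\<And>i. i < f \<Longrightarrow> \<bar>x i - c i\<bar> < r" for x
  proof -
    have "x i \<in> U i" for i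
    proof (cases "i < f")
      case True
      then have "r \<le> \<rho> i" by (simp add: r_def)
      then show ?thesis using x(2)[OF True] \<rho>(2) by auto
    next
      case False
      then have "x i = c i" using x(1) c S(2) by (simp add: topspace_Euclidean_space)
      then show ?thesis using U(2) by (simp add: PiE_iff)
    qed
    then have "x \<in> S" using U(3) by auto
    then show ?thesis using x(1) S(2) by (simp add: topspace_Euclidean_space)
  qed
  ultimately show ?thesis using that by blast
qed

text \<open>
  In each coordinate, \<open>t \<mapsto> t / (r - \<bar>t\<bar>)\<close> maps the interval of radius \<open>r\<close> onto the line.
\<close>

lemma Euclidean_space_box_homeomorphic:
  assumes "r > 0"
  shows "subtopology (Euclidean_space f) {x. \<forall>i<f. \<bar>x i - c i\<bar> < r} homeomorphic_space Euclidean_space f"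
proof -
  let ?S = "subtopology (Euclidean_space f) {x. \<forall>i<f. \<bar>x i - c i\<bar> < r}"
  define F where "F x = (\<lambda>i. if i < f then (x i - c i) / (r - \<bar>x i - c i\<bar>) else 0)" for x
  define G where "G x = (\<lambda>i. if i < f then c i + r * x i / (1 + \<bar>x i\<bar>) else 0)" for x
  note proj = continuous_map_Euclidean_space_coordinate
  have projS: "continuous_map ?S euclideanreal (\<lambda>x. x i)" for i
    using proj by (rule continuous_map_from_subtopology)
  have GF: "c i + r * (t / (r - \<bar>t\<bar>)) / (1 + \<bar>t / (r - \<bar>t\<bar>)\<bar>) = c i + t" if "\<bar>t\<bar> < r" for t i
  proof -
    have "1 + \<bar>t / (r - \<bar>t\<bar>)\<bar> = r / (r - \<bar>t\<bar>)"
      using that by (simp add: field_simps)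
    then show ?thesis using that assms by simp
  qed
  have abs_lt: "\<bar>r * t / (1 + \<bar>t\<bar>)\<bar> < r" for t :: real
    using assms by (simp add: abs_mult field_simps)
  have FG: "(r * t / (1 + \<bar>t\<bar>)) / (r - \<bar>r * t / (1 + \<bar>t\<bar>)\<bar>) = t" for t :: real
  proof -
    have pos: "1 + \<bar>t\<bar> > 0" by simp
    have "\<bar>r * t / (1 + \<bar>t\<bar>)\<bar> = r * \<bar>t\<bar> / (1 + \<bar>t\<bar>)"
      using assms by (simp add: abs_mult)
    moreover have "r - r * \<bar>t\<bar> / (1 + \<bar>t\<bar>) = r / (1 + \<bar>t\<bar>)"
      using pos by (simp add: field_simps)
    moreover have "(r * t / (1 + \<bar>t\<bar>)) / (r / (1 + \<bar>t\<bar>)) = t"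
      using pos assms by simp
    ultimately show ?thesis by (simp only:)
  qed
  have "homeomorphic_maps ?S (Euclidean_space f) F G"
    unfolding homeomorphic_maps_def
  proof (intro conjI ballI)
    show "continuous_map ?S (Euclidean_space f) F"
      unfolding F_def continuous_map_componentwise_Euclidean_space
    proof (intro allI impI)
      fix i assume i: "i < f"
      show "continuous_map ?S euclideanreal (\<lambda>x. (x i - c i) / (r - \<bar>x i - c i\<bar>))"
        by (intro continuous_map_real_divide continuous_map_diff continuous_map_real_abs projS
            continuous_map_const[THEN iffD2]) (use i in auto)
    qed
    have "continuous_map (Euclidean_space f) (Euclidean_space f) G"
      unfolding G_def continuous_map_componentwise_Euclidean_space
    proof (intro allI impI)
      fix i
      show "continuous_map (Euclidean_space f) euclideanreal (\<lambda>x. c i + r * x i / (1 + \<bar>x i\<bar>))"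
        by (intro continuous_map_add continuous_map_real_divide continuous_map_real_mult continuous_map_real_abs proj
            continuous_map_const[THEN iffD2]) auto
    qed
    then show "continuous_map (Euclidean_space f) ?S G"
      using abs_lt by (auto simp: continuous_map_in_subtopology G_def)
    show "G (F x) = x" if "x \<in> topspace ?S" for x
      using that GF[of "x _ - c _"] by (auto simp: F_def G_def fun_eq_iff topspace_Euclidean_space)
    show "F (G x) = x" if "x \<in> topspace (Euclidean_space f)" for x
      using that FG by (auto simp: F_def G_def fun_eq_iff topspace_Euclidean_space)
  qed
  then show ?thesis by (rule homeomorphic_maps_imp_homeomorphic_space)
qed

text \<open>
  It is enough to find a chart onto some open set: inside it there is a box around the image of \<open>x\<close>,
  and a box is homeomorphic to the whole Euclidean space.
\<close>

lemma has_local_dimensionI: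
  assumes U: "openin T U" "x \<in> U" and Y: "openin (Euclidean_space f) Y"
    and h: "homeomorphic_map (subtopology T U) (subtopology (Euclidean_space f) Y) h"
  shows "has_local_dimension T x f"
proof -
  have UT: "U \<subseteq> topspace T" and OT: "Y \<subseteq> topspace (Euclidean_space f)"
    using U(1) Y by (simp_all add: openin_subset)
  have surj: "h ` U = Y"
    using homeomorphic_imp_surjective_map[OF h] UT OT by (simp add: Int_absorb1)
  then have "h x \<in> Y" using U by blast
  then obtain r where r: "r > 0"
    and box: "\<And>y. y \<in> topspace (Euclidean_space f) \<Longrightarrow> (\<And>i. i < f \<Longrightarrow> \<bar>y i - h x i\<bar> < r) \<Longrightarrow> y \<in> Y"
    using Euclidean_space_box_subset[OF Y] by metis
  let ?D = "{y. \<forall>i<f. \<bar>y i - h x i\<bar> < r}"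
  define U' where "U' = {u \<in> U. h u \<in> ?D}"
  have D: "openin (Euclidean_space f) (topspace (Euclidean_space f) \<inter> ?D)"
  proof -
    have eq: "topspace (Euclidean_space f) \<inter> ?D = topspace (Euclidean_space f) \<inter>
        (\<Inter>i\<in>{..<f}. {y \<in> topspace (Euclidean_space f). y i \<in> {h x i - r<..<h x i + r}})"
    proof -
      have "t \<in> {s - r<..<s + r} \<longleftrightarrow> \<bar>t - s\<bar> < r" for t s by auto
      then show ?thesis by auto
    qed
    have "openin (Euclidean_space f) {y \<in> topspace (Euclidean_space f). y i \<in> {h x i - r<..<h x i + r}}" for i
      by (rule openin_continuous_map_preimage[OF continuous_map_Euclidean_space_coordinate]) simp
    then show ?thesis
      unfolding eq by (cases "f = 0") (auto intro!: openin_Int openin_INT2)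
  qed
  have "openin (subtopology T U) {u \<in> topspace (subtopology T U). h u \<in> topspace (Euclidean_space f) \<inter> ?D}"
  proof (rule openin_continuous_map_preimage)
    show "continuous_map (subtopology T U) (Euclidean_space f) h"
      using homeomorphic_imp_continuous_map[OF h] by (simp add: continuous_map_in_subtopology)
  qed (rule D)
  moreover have "{u \<in> topspace (subtopology T U). h u \<in> topspace (Euclidean_space f) \<inter> ?D} = U'"
    using UT surj OT by (auto simp: U'_def)
  ultimately have U': "openin T U'"
    using U(1) openin_trans_full by metis
  have img: "h ` U' = topspace (Euclidean_space f) \<inter> ?D"
  proof (intro equalityI subsetI)
    fix y assume "y \<in> topspace (Euclidean_space f) \<inter> ?D"
    moreover from this have "y \<in> Y" using box by blast
    ultimately show "y \<in> h ` U'" using surj by (auto simp: U'_def)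
  qed (use surj OT in \<open>auto simp: U'_def\<close>)
  have "homeomorphic_map (subtopology (subtopology T U) U')
      (subtopology (subtopology (Euclidean_space f) Y) ?D) h"
  proof (rule homeomorphic_map_subtopologies[OF h])
    have "topspace (subtopology T U) \<inter> U' = U'" using UT by (auto simp: U'_def)
    moreover have "topspace (subtopology (Euclidean_space f) Y) \<inter> ?D = topspace (Euclidean_space f) \<inter> ?D"
      using box OT by auto
    ultimately show "h ` (topspace (subtopology T U) \<inter> U') = topspace (subtopology (Euclidean_space f) Y) \<inter> ?D"
      using img by simp
  qed
  moreover have "subtopology (subtopology T U) U' = subtopology T U'"
    unfolding subtopology_subtopology by (rule arg_cong[where f = "subtopology T"]) (auto simp: U'_def)
  moreover have "subtopology (subtopology (Euclidean_space f) Y) ?D = subtopology (Euclidean_space f) ?D"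
  proof -
    have "topspace (Euclidean_space f) \<inter> (Y \<inter> ?D) = topspace (Euclidean_space f) \<inter> ?D"
      using box by auto
    then show ?thesis
      unfolding subtopology_subtopology
      using subtopology_restrict[of "Euclidean_space f" "Y \<inter> ?D"] subtopology_restrict[of "Euclidean_space f" ?D]
      by (simp only:)
  qed
  ultimately have "homeomorphic_map (subtopology T U') (subtopology (Euclidean_space f) ?D) h"
    by (simp only:)
  then have "subtopology T U' homeomorphic_space subtopology (Euclidean_space f) ?D"
    by (rule homeomorphic_map_imp_homeomorphic_space)
  also have "\<dots> homeomorphic_space Euclidean_space f"
    by (rule Euclidean_space_box_homeomorphic[OF r])
  finally have "subtopology T U' homeomorphic_space Euclidean_space f" .
  moreover have "x \<in> U'" using U(2) r by (simp add: U'_def)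
  ultimately show ?thesis
    using U' unfolding has_local_dimension_def by blast
qed

lemma has_local_dimension_homeomorphic:
  assumes dim: "has_local_dimension T' (h x) f"
    and U: "openin T U" "x \<in> U" and U': "openin T' U'"
    and h: "homeomorphic_map (subtopology T U) (subtopology T' U') h"
  shows "has_local_dimension T x f"
proof -
  obtain Y k where Y: "openin T' Y" "h x \<in> Y" and k: "homeomorphic_map (subtopology T' Y) (Euclidean_space f) k"
    using dim by (auto simp: has_local_dimension_def homeomorphic_space)
  have UT: "U \<subseteq> topspace T" and U'T: "U' \<subseteq> topspace T'" and OT: "Y \<subseteq> topspace T'"
    using U(1) U' Y(1) by (simp_all add: openin_subset)
  have hU: "h ` U = U'"
    using homeomorphic_imp_surjective_map[OF h] UT U'T by (simp add: Int_absorb1)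
  define D where "D = {u \<in> U. h u \<in> Y}"
  have "openin (subtopology T U) {u \<in> topspace (subtopology T U). h u \<in> Y}"
  proof (rule openin_continuous_map_preimage)
    show "continuous_map (subtopology T U) T' h"
      using homeomorphic_imp_continuous_map[OF h] by (simp add: continuous_map_in_subtopology)
  qed (rule Y)
  moreover have "{u \<in> topspace (subtopology T U). h u \<in> Y} = D"
    using UT by (auto simp: D_def)
  ultimately have D: "openin T D"
    using U(1) openin_trans_full by metis
  have hD: "h ` D = U' \<inter> Y" using hU by (auto simp: D_def)
  have "homeomorphic_map (subtopology (subtopology T U) D) (subtopology (subtopology T' U') Y) h"
    by (rule homeomorphic_map_subtopologies[OF h])
      (use hD UT U'T in \<open>simp add: D_def Int_absorb1 Int_absorb2 Collect_conj_eq[symmetric]\<close>)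
  moreover have "subtopology (subtopology T U) D = subtopology T D"
    unfolding subtopology_subtopology by (rule arg_cong[where f = "subtopology T"]) (auto simp: D_def)
  ultimately have hD': "homeomorphic_map (subtopology T D) (subtopology T' (U' \<inter> Y)) h"
    by (simp add: subtopology_subtopology)
  have "openin (subtopology T' Y) (U' \<inter> Y)"
    using U' openin_subtopology by blast
  then have kO: "openin (Euclidean_space f) (k ` (U' \<inter> Y))"
    using homeomorphic_imp_open_map[OF k] by (simp add: open_map_def)
  have "homeomorphic_map (subtopology (subtopology T' Y) (U' \<inter> Y)) (subtopology (Euclidean_space f) (k ` (U' \<inter> Y))) k"
    by (rule homeomorphic_map_subtopologies[OF k])
      (use OT openin_subset[OF kO] in \<open>auto simp: Int_absorb1\<close>)
  moreover have "subtopology (subtopology T' Y) (U' \<inter> Y) = subtopology T' (U' \<inter> Y)"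
    by (simp add: subtopology_subtopology Int_absorb1)
  ultimately have "homeomorphic_map (subtopology T D) (subtopology (Euclidean_space f) (k ` (U' \<inter> Y))) (k \<circ> h)"
    using homeomorphic_map_compose[OF hD'] by simp
  with D kO show ?thesis
    by (intro has_local_dimensionI[where U = D]) (use Y U in \<open>auto simp: D_def\<close>)
qed


section \<open>The local dimension of the deformation space of the linkage\<close>

text \<open>
  Invariance of domain transported along a homeomorphism.  Applied to all open subsets of \<open>C\<close> it shows
  that \<open>\<Psi>\<close> is an open map, so that its inverse is continuous.
\<close>

lemma invariance_of_domain_homeomorphic:
  assumes T: "T homeomorphic_space Euclidean_space N" and C: "openin T C"
    and cont: "continuous_map (subtopology T C) (Euclidean_space N) \<Psi>" and inj: "inj_on \<Psi> C"
  shows "openin (Euclidean_space N) (\<Psi> ` C)"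
    and "homeomorphic_map (subtopology T C) (subtopology (Euclidean_space N) (\<Psi> ` C)) \<Psi>"
proof -
  obtain P Q where PQ: "homeomorphic_maps T (Euclidean_space N) P Q"
    using T by (auto simp: homeomorphic_space_def)
  have P: "homeomorphic_map T (Euclidean_space N) P" and Q: "continuous_map (Euclidean_space N) T Q"
    and QP: "\<And>x. x \<in> topspace T \<Longrightarrow> Q (P x) = x"
    using PQ homeomorphic_maps_map by (auto simp: homeomorphic_maps_def)
  have CT: "C \<subseteq> topspace T" using C by (rule openin_subset)
  have op: "openin (Euclidean_space N) (\<Psi> ` D)" if D: "openin T D" "D \<subseteq> C" for D
  proof -
    have PD: "openin (Euclidean_space N) (P ` D)"
      using homeomorphic_imp_open_map[OF P] D(1) by (simp add: open_map_def)
    have QPx: "Q (P x) = x" if "x \<in> D" for x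
      using QP that D(2) CT by blast
    have "(\<lambda>x. Q (P x)) ` D = D"
      using QPx by simp
    then have QPD: "Q ` P ` D = D" "inj_on Q (P ` D)"
      using QPx by (simp_all add: image_image inj_on_def)
    have "continuous_map (subtopology (Euclidean_space N) (P ` D)) (subtopology T C) Q"
      unfolding continuous_map_in_subtopology
      using continuous_map_from_subtopology[OF Q] QPx D(2) by auto
    then have "continuous_map (subtopology (Euclidean_space N) (P ` D)) (Euclidean_space N) (\<Psi> \<circ> Q)"
      using cont by (rule continuous_map_compose)
    moreover have "inj_on (\<Psi> \<circ> Q) (P ` D)"
      using QPD inj D(2) by (auto intro!: comp_inj_on intro: inj_on_subset)
    ultimately have "openin (Euclidean_space N) ((\<Psi> \<circ> Q) ` P ` D)"
      using invariance_of_domain_Euclidean_space[OF PD] by blast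
    then show ?thesis by (simp only: image_comp[symmetric] QPD(1))
  qed
  show opC: "openin (Euclidean_space N) (\<Psi> ` C)"
    using op[OF C] by simp
  show "homeomorphic_map (subtopology T C) (subtopology (Euclidean_space N) (\<Psi> ` C)) \<Psi>"
  proof (rule bijective_open_imp_homeomorphic_map)
    show "continuous_map (subtopology T C) (subtopology (Euclidean_space N) (\<Psi> ` C)) \<Psi>"
      using cont by (auto simp: continuous_map_in_subtopology)
    show "open_map (subtopology T C) (subtopology (Euclidean_space N) (\<Psi> ` C)) \<Psi>"
      unfolding open_map_def
    proof (intro allI impI)
      fix D assume "openin (subtopology T C) D"
      then have "openin T D" "D \<subseteq> C"
        using C openin_trans_full openin_subset by (blast, fastforce)
      then show "openin (subtopology (Euclidean_space N) (\<Psi> ` C)) (\<Psi> ` D)"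
        using op openin_subset_topspace_eq by (simp add: openin_open_subtopology[OF opC] image_mono)
    qed
    show "\<Psi> ` topspace (subtopology T C) = topspace (subtopology (Euclidean_space N) (\<Psi> ` C))"
      using CT openin_subset[OF opC] by (simp add: Int_absorb1)
    show "inj_on \<Psi> (topspace (subtopology T C))"
      using inj by (auto intro: inj_on_subset)
  qed
qed

abbreviation placement_space :: "'v set \<Rightarrow> ('v \<Rightarrow> real ^ 'd) topology" where
  "placement_space V \<equiv> product_topology (\<lambda>_. euclidean) V"

lemma continuous_map_placement: "v \<in> V \<Longrightarrow> continuous_map (placement_space V) euclidean (\<lambda>x. x v)"
  by (rule continuous_map_product_projection)

lemma tendsto_placement:
  fixes x :: "'v \<Rightarrow> real ^ 'd"
  assumes "v \<in> V" "x \<in> extensional V"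
  shows "((\<lambda>y. y v) \<longlongrightarrow> x v) (atin (placement_space V) x)"
proof -
  have "continuous_map (placement_space V) euclidean (\<lambda>y :: 'v \<Rightarrow> real ^ 'd. y v)"
    using assms(1) by (rule continuous_map_placement)
  then have "limitin euclidean (\<lambda>y. y v) (x v) (atin (placement_space V) x)"
    using assms(2) unfolding continuous_map_atin by (simp add: PiE_def)
  then show ?thesis by simp
qed

lemma placement_space_homeomorphic_Euclidean_space:
  assumes V: "finite V"
  shows "(placement_space V :: ('v \<Rightarrow> real ^ 'd) topology) homeomorphic_space Euclidean_space (card V * CARD('d))"
proof -
  let ?N = "card V * CARD('d)" and ?T = "placement_space V :: ('v \<Rightarrow> real ^ 'd) topology"
  have "finite (V \<times> (UNIV :: 'd set))" using V by simp
  from ex_bij_betw_nat_finite[OF this]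
  obtain \<gamma> where "bij_betw \<gamma> {0..<card (V \<times> (UNIV :: 'd set))} (V \<times> (UNIV :: 'd set))"
    by blast
  then have \<gamma>: "bij_betw \<gamma> {..<?N} (V \<times> UNIV)"
    by (simp add: card_cartesian_product lessThan_atLeast0)
  define \<delta> where "\<delta> = inv_into {..<?N} \<gamma>"
  have \<delta>: "\<delta> j < ?N" "\<gamma> (\<delta> j) = j" if "j \<in> V \<times> UNIV" for j
    using that \<gamma> bij_betw_imp_surj_on[OF \<gamma>] inv_into_into[of j \<gamma> "{..<?N}"] f_inv_into_f[of j \<gamma> "{..<?N}"]
    by (auto simp: \<delta>_def)
  have \<delta>\<gamma>: "\<delta> (\<gamma> k) = k" "fst (\<gamma> k) \<in> V" if "k < ?N" for k
    using that bij_betw_inv_into_left[OF \<gamma>] bij_betwE[OF \<gamma>] by (auto simp: \<delta>_def mem_Times_iff)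
  define P where "P x = (\<lambda>k. if k < ?N then x (fst (\<gamma> k)) $ snd (\<gamma> k) else 0)" for x :: "'v \<Rightarrow> real ^ 'd"
  define Q where "Q z = (\<lambda>v\<in>V. (\<chi> i. z (\<delta> (v, i))) :: real ^ 'd)" for z :: "nat \<Rightarrow> real"
  have "homeomorphic_maps ?T (Euclidean_space ?N) P Q"
    unfolding homeomorphic_maps_def
  proof (intro conjI ballI)
    show "continuous_map ?T (Euclidean_space ?N) P"
      unfolding P_def continuous_map_componentwise_Euclidean_space
    proof (intro allI impI)
      fix k assume "k < ?N"
      then show "continuous_map ?T euclideanreal (\<lambda>x. x (fst (\<gamma> k)) $ snd (\<gamma> k))"
        unfolding continuous_map_atin
        by (auto intro!: tendsto_vec_nth tendsto_placement \<delta>\<gamma> simp: PiE_def)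
    qed
    show "continuous_map (Euclidean_space ?N) ?T Q"
      unfolding continuous_map_componentwise
    proof (intro conjI ballI)
      fix v assume v: "v \<in> V"
      have "continuous_map (Euclidean_space ?N) euclidean (\<lambda>z. (\<chi> i. z (\<delta> (v, i))) :: real ^ 'd)"
        using continuous_map_Euclidean_space_coordinate[of ?N] unfolding continuous_map_atin
        by (auto intro!: vec_tendstoI)
      then show "continuous_map (Euclidean_space ?N) euclidean (\<lambda>z. Q z v)"
        using v by (simp add: Q_def)
    qed (auto simp: Q_def)
    show "Q (P x) = x" if "x \<in> topspace ?T" for x
    proof
      fix v
      show "Q (P x) v = x v"
        using that \<delta> by (cases "v \<in> V") (auto simp: P_def Q_def vec_eq_iff PiE_def extensional_def)
    qed
    show "P (Q z) = z" if "z \<in> topspace (Euclidean_space ?N)" for z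
      using that \<delta>\<gamma> by (auto simp: P_def Q_def fun_eq_iff topspace_Euclidean_space)
  qed
  then show ?thesis by (rule homeomorphic_maps_imp_homeomorphic_space)
qed

lemma simple_graph_iff_vertex_pairs: "simple_graph V E \<longleftrightarrow> E \<subseteq> vertex_pairs V"
  by (auto simp: simple_graph_def vertex_pairs_def)

lemma same_edge_lengths_iff:
  assumes "E \<subseteq> vertex_pairs V"
  shows "same_edge_lengths E p x \<longleftrightarrow> (\<forall>e\<in>E. rigidity_row x e x = rigidity_row p e p)"
proof -
  have *: "dist (x u) (x v) = dist (p u) (p v) \<longleftrightarrow> rigidity_row x {u, v} x = rigidity_row p {u, v} p" for u v
    by (simp add: dist_norm norm_eq rigidity_row_edge)
  show ?thesis
    unfolding same_edge_lengths_def *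
    using assms by (auto elim!: vertex_pairsE)
qed

lemma continuous_squared_length:
  assumes "e \<in> vertex_pairs V"
  shows "continuous_map (placement_space V) euclideanreal (\<lambda>x. rigidity_row x e x)"
  using assms
proof (rule vertex_pairsE)
  fix u v assume "e = {u, v}" "u \<in> V" "v \<in> V"
  then show ?thesis
    unfolding continuous_map_atin
    by (auto simp: rigidity_row_edge PiE_def intro!: tendsto_inner tendsto_diff tendsto_placement)
qed

lemma squared_length_isometry:
  assumes "euclidean_isometry g" "e \<in> vertex_pairs V"
  shows "rigidity_row (\<lambda>v\<in>V. g (x v)) e (\<lambda>v\<in>V. g (x v)) = rigidity_row x e x"
  using assms(2)
proof (rule vertex_pairsE)
  fix u v assume uv: "e = {u, v}" "u \<in> V" "v \<in> V"
  have "dist (g (x u)) (g (x v)) = dist (x u) (x v)"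
    using assms(1) by (simp add: euclidean_isometry_def)
  then show ?thesis
    using uv by (simp add: rigidity_row_edge dist_norm norm_eq)
qed

lemma continuous_map_isometry:
  assumes "euclidean_isometry g"
  shows "continuous_map (placement_space V) (placement_space V) (\<lambda>x. \<lambda>v\<in>V. g (x v))"
  unfolding continuous_map_componentwise
proof (intro conjI ballI)
  fix v assume v: "v \<in> V"
  have "continuous_on UNIV g"
    using assms by (auto simp: continuous_on_iff euclidean_isometry_def)
  then have "continuous_map (placement_space V) euclidean (g \<circ> (\<lambda>x. x v))"
    by (intro continuous_map_compose[OF continuous_map_placement[OF v]]) simp
  then show "continuous_map (placement_space V) euclidean (\<lambda>x. (\<lambda>v\<in>V. g (x v)) v)"
    using v by (simp add: o_def)
qed auto

lemma linkage_realization_isometry: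
  assumes "E \<subseteq> vertex_pairs V" "euclidean_isometry g" "x \<in> linkage_realizations V E p"
  shows "(x, \<lambda>v\<in>V. g (x v)) \<in> linkage_congruence V E p"
proof -
  have "(\<lambda>v\<in>V. g (x v)) \<in> linkage_realizations V E p"
    using assms(1,3)
    by (auto simp: squared_length_isometry[OF assms(2)] linkage_realizations_def same_edge_lengths_iff[OF assms(1)] subset_iff)
  then show ?thesis
    using assms by (auto simp: linkage_congruence_def)
qed

lemma congruent_squared_length:
  assumes "(x, y) \<in> linkage_congruence V E p" "e \<in> vertex_pairs V"
  shows "rigidity_row y e y = rigidity_row x e x"
  using assms squared_length_isometry by (auto simp: linkage_congruence_def)

text \<open>
  The chart \<open>h\<close> of the deformation space is induced by \<open>\<theta>\<close>, the squared lengths of the pairs in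
  \<open>B - E\<close>.  Its inverse \<open>k\<close> completes \<open>t\<close> by the values at \<open>p\<close> of the other coordinates (\<open>glue\<close>), takes
  the placement near \<open>p\<close> that has these coordinates, and passes to its congruence class.  The domain
  consists of the classes that meet the neighbourhood \<open>C\<close> of \<open>p\<close> on which the coordinates separate
  placements; alignment does not leave \<open>C\<close>, as it does not increase the distance to \<open>p\<close>.
\<close>

lemma linkage_local_dimension:
  fixes p :: "'v \<Rightarrow> real ^ 'd"
  assumes V: "finite V" and ab: "\<And>k. a k \<in> V \<and> b k \<in> V" and basis: "is_basis (marked_vector p a b)"
    and E: "E \<subseteq> vertex_pairs V" "infinitesimally_independent E p"
  obtains f where "f + card E + ((CARD('d) + 1) choose 2) = card V * CARD('d)"
    and "has_local_dimension (linkage_deformation_space V E p) (linkage_class V E p p) f"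
proof -
  obtain K :: "('d \<times> 'd) set" where K: "half_pairs K" "card K = (CARD('d) + 1) choose 2"
    by (rule half_pairs_exists)
  obtain B \<beta> \<eta> where B: "E \<subseteq> B" "B \<subseteq> vertex_pairs V" "card B + card K = card V * CARD('d)"
    and coords: "\<And>y v i. v \<in> V \<Longrightarrow> y v $ i = (\<Sum>e\<in>B. rigidity_row p e y * \<beta> e (v, i))
           + (\<Sum>\<kappa>\<in>K. (\<Sum>u\<in>V. trivial_motion p \<kappa> u \<bullet> y u) * \<eta> \<kappa> (v, i))"
    using infinitesimal_coordinates[OF V ab basis E K(1)] by blast
  obtain \<epsilon> where \<epsilon>: "\<epsilon> > 0"
    and inj: "\<And>x x'. (\<Sum>v\<in>V. (dist (x v) (p v))\<^sup>2) < \<epsilon>\<^sup>2 \<Longrightarrow> (\<Sum>v\<in>V. (dist (x' v) (p v))\<^sup>2) < \<epsilon>\<^sup>2 \<Longrightarrow>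
      (\<And>e. e \<in> B \<Longrightarrow> rigidity_row x e x = rigidity_row x' e x') \<Longrightarrow>
      (\<And>\<kappa>. \<kappa> \<in> K \<Longrightarrow> (\<Sum>v\<in>V. trivial_motion p \<kappa> v \<bullet> x v) = (\<Sum>v\<in>V. trivial_motion p \<kappa> v \<bullet> x' v)) \<Longrightarrow>
      \<forall>v\<in>V. x v = x' v"
    using local_length_coordinates_injective[OF V B(2) coords] by blast
  have finB: "finite B" using B(2) finite_vertex_pairs[OF V] by (rule finite_subset)
  \<comment> \<open>The coordinates are listed so that the first \<open>f\<close> belong to \<open>B - E\<close>.\<close>
  obtain es where es: "set es = B - E" "distinct es"
    using finite_distinct_list[of "B - E"] finB by auto
  obtain rest where rest: "set rest = Inl ` E \<union> Inr ` K" "distinct rest"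
    using finite_distinct_list[of "Inl ` E \<union> Inr ` K :: ('v set + 'd \<times> 'd) set"] finB B(1)
    by (auto intro: finite_subset)
  define \<alpha>s where "\<alpha>s = map Inl es @ rest"
  define f where "f = length es"
  define N where "N = card V * CARD('d)"
  have set_\<alpha>s: "set \<alpha>s = Inl ` B \<union> Inr ` K"
    using B(1) es(1) rest(1) by (auto simp: \<alpha>s_def)
  have f: "f = card (B - E)" using es by (simp add: f_def distinct_card[symmetric])
  have "length rest = card E + card K"
  proof -
    have "length rest = card (Inl ` E \<union> Inr ` K :: ('v set + 'd \<times> 'd) set)"
      using distinct_card[OF rest(2)] rest(1) by simp
    also have "\<dots> = card (Inl ` E :: ('v set + 'd \<times> 'd) set) + card (Inr ` K :: ('v set + 'd \<times> 'd) set)"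
      using finite_subset[OF B(1) finB] by (intro card_Un_disjoint) auto
    finally show ?thesis by (simp add: card_image)
  qed
  moreover have card_f: "f + card E = card B"
    using f finB B(1) card_mono[OF finB B(1)] by (simp add: card_Diff_subset finite_subset)
  ultimately have len: "length \<alpha>s = N"
    using B(3) by (simp add: \<alpha>s_def f_def N_def)
  have fN: "f \<le> N" using len by (simp add: \<alpha>s_def f_def)
  have nth_free: "\<exists>e\<in>B - E. \<alpha>s ! k = Inl e" if "k < f" for k
    using that es(1) nth_mem[of k es] by (auto simp: \<alpha>s_def f_def nth_append)
  have nth_fixed: "\<alpha>s ! k \<in> Inl ` E \<union> Inr ` K" if "f \<le> k" "k < N" for k
    using that len rest(1) nth_mem[of "k - f" rest] by (auto simp: \<alpha>s_def f_def nth_append)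
  define cf where "cf i x = (case i of Inl e \<Rightarrow> rigidity_row x e x
      | Inr \<kappa> \<Rightarrow> (\<Sum>v\<in>V. trivial_motion p \<kappa> v \<bullet> x v))" for i x
  define \<Psi> where "\<Psi> x = (\<lambda>k. if k < N then cf (\<alpha>s ! k) x else 0)" for x
  define \<theta> where "\<theta> x = (\<lambda>k. if k < f then cf (\<alpha>s ! k) x else 0)" for x
  define glue where "glue t = (\<lambda>k. if k < N then if k < f then t k else cf (\<alpha>s ! k) p else 0)" for t
  let ?T = "placement_space V :: ('v \<Rightarrow> real ^ 'd) topology"
  let ?L = "linkage_realizations V E p" and ?R = "linkage_congruence V E p"
  let ?TL = "linkage_realization_space V E p" and ?Q = "linkage_deformation_space V E p"
  have cont_cf: "continuous_map ?T euclideanreal (cf i)" if i: "i \<in> set \<alpha>s" for i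
  proof (cases i)
    case (Inl e)
    then have "e \<in> vertex_pairs V" using i B(2) by (auto simp: set_\<alpha>s)
    then show ?thesis using continuous_squared_length Inl by (simp add: cf_def[abs_def])
  next
    case (Inr \<kappa>)
    have "continuous_map ?T euclideanreal (\<lambda>x. \<Sum>v\<in>V. trivial_motion p \<kappa> v \<bullet> x v)"
      unfolding continuous_map_atin
      by (auto simp: PiE_def intro!: tendsto_sum tendsto_inner tendsto_placement)
    then show ?thesis using Inr by (simp add: cf_def[abs_def])
  qed
  have cont_\<Psi>: "continuous_map ?T (Euclidean_space N) \<Psi>"
    unfolding \<Psi>_def continuous_map_componentwise_Euclidean_space
    using cont_cf len by (auto simp: eta_contract_eq)
  have cont_\<theta>: "continuous_map ?T (Euclidean_space f) \<theta>"
    unfolding \<theta>_def continuous_map_componentwise_Euclidean_space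
    using cont_cf len fN by (auto simp: eta_contract_eq)
  have cont_glue: "continuous_map (Euclidean_space f) (Euclidean_space N) glue"
    unfolding glue_def continuous_map_componentwise_Euclidean_space
    using continuous_map_Euclidean_space_coordinate by auto
  define C where "C = {x \<in> topspace ?T. (\<Sum>v\<in>V. (dist (x v) (p v))\<^sup>2) < \<epsilon>\<^sup>2}"
  have C: "openin ?T C"
  proof -
    have "continuous_map ?T euclideanreal (\<lambda>x. \<Sum>v\<in>V. (dist (x v) (p v))\<^sup>2)"
      unfolding continuous_map_atin
      by (auto simp: PiE_def intro!: tendsto_sum tendsto_power tendsto_dist tendsto_placement tendsto_const)
    then have "openin ?T {x \<in> topspace ?T. (\<Sum>v\<in>V. (dist (x v) (p v))\<^sup>2) \<in> {..<\<epsilon>\<^sup>2}}"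
      by (rule openin_continuous_map_preimage) simp
    then show ?thesis by (simp add: C_def)
  qed
  have \<Psi>_cf: "cf i x = cf i x'" if "\<Psi> x = \<Psi> x'" "i \<in> set \<alpha>s" for x x' i
    using that len by (auto simp: \<Psi>_def fun_eq_iff in_set_conv_nth split: if_splits)
  have inj_\<Psi>: "inj_on \<Psi> C"
  proof (rule inj_onI)
    fix x x' assume x: "x \<in> C" "x' \<in> C" and eq: "\<Psi> x = \<Psi> x'"
    have "\<forall>v\<in>V. x v = x' v"
    proof (rule inj)
      show "rigidity_row x e x = rigidity_row x' e x'" if "e \<in> B" for e
        using \<Psi>_cf[OF eq, of "Inl e"] that by (simp add: set_\<alpha>s cf_def)
      show "(\<Sum>v\<in>V. trivial_motion p \<kappa> v \<bullet> x v) = (\<Sum>v\<in>V. trivial_motion p \<kappa> v \<bullet> x' v)" if "\<kappa> \<in> K" for \<kappa>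
        using \<Psi>_cf[OF eq, of "Inr \<kappa>"] that by (simp add: set_\<alpha>s cf_def)
    qed (use x in \<open>auto simp: C_def\<close>)
    then show "x = x'"
      using x by (intro extensionalityI[of _ V]) (auto simp: C_def PiE_def)
  qed
  note dom = invariance_of_domain_homeomorphic[OF placement_space_homeomorphic_Euclidean_space[OF V] C,
      folded N_def, OF continuous_map_from_subtopology[OF cont_\<Psi>] inj_\<Psi>]
  obtain \<Psi>' where \<Psi>': "homeomorphic_maps (subtopology ?T C) (subtopology (Euclidean_space N) (\<Psi> ` C)) \<Psi> \<Psi>'"
    using dom(2) by (auto simp: homeomorphic_map_maps)
  define Y where "Y = {t \<in> topspace (Euclidean_space f). glue t \<in> \<Psi> ` C}"
  have Y: "openin (Euclidean_space f) Y"
    unfolding Y_def by (rule openin_continuous_map_preimage[OF cont_glue dom(1)])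
  have equiv: "equiv (topspace ?TL) ?R"
    by (simp add: equiv_linkage_congruence)
  have L_T: "?L \<subseteq> topspace ?T" by (auto simp: linkage_realizations_def PiE_def)
  have \<theta>_congruent: "\<theta> x = \<theta> y" if "(x, y) \<in> ?R" for x y
  proof
    fix k
    show "\<theta> x k = \<theta> y k"
    proof (cases "k < f")
      case True
      then obtain e where "e \<in> B" "\<alpha>s ! k = Inl e" using nth_free by blast
      then show ?thesis
        using congruent_squared_length[OF that, of e] B(2) by (auto simp: \<theta>_def cf_def)
    qed (simp add: \<theta>_def)
  qed
  define S where "S = {x \<in> ?L. \<exists>g. euclidean_isometry g \<and> (\<lambda>v\<in>V. g (x v)) \<in> C}"
  have S_open: "openin ?TL S"
  proof -
    have "S = ?L \<inter> (\<Union>g\<in>{g. euclidean_isometry g}. {x \<in> topspace ?T. (\<lambda>v\<in>V. g (x v)) \<in> C})"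
      using L_T by (auto simp: S_def)
    moreover have "openin ?T (\<Union>g\<in>{g. euclidean_isometry g}. {x \<in> topspace ?T. (\<lambda>v\<in>V. g (x v)) \<in> C})"
      using openin_continuous_map_preimage[OF continuous_map_isometry C] by (intro openin_Union) blast
    ultimately show ?thesis
      unfolding linkage_realization_space_def openin_subtopology by blast
  qed
  have S_iff: "x \<in> S \<longleftrightarrow> (\<exists>y\<in>C. (x, y) \<in> ?R)" for x
  proof
    assume "x \<in> S"
    then show "\<exists>y\<in>C. (x, y) \<in> ?R"
      using linkage_realization_isometry[OF E(1)] by (auto simp: S_def)
  qed (auto simp: S_def linkage_congruence_def)
  have S_sat: "y \<in> S" if "(x, y) \<in> ?R" "x \<in> S" for x y
    using that equiv unfolding S_iff equiv_def sym_def trans_def by meson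
  let ?U = "(\<lambda>x. ?R `` {x}) ` S"
  have Q_eq: "?Q = quotient_topology ?TL ?R"
    by (simp add: linkage_deformation_space_def)
  have U: "openin ?Q ?U" and qm: "quotient_map (subtopology ?TL S) (subtopology ?Q ?U) (\<lambda>x. ?R `` {x})"
    unfolding Q_eq
    by (rule open_saturated_classes[OF equiv S_open], erule (1) S_sat)+
  \<comment> \<open>every class in \<open>?U\<close> has an aligned representative in \<open>C\<close>, found by its coordinates\<close>
  have aligned: "\<exists>y\<in>C. (x, y) \<in> ?R \<and> \<Psi> y = glue (\<theta> x)" if x: "x \<in> S" for x
  proof -
    obtain x' where x': "x' \<in> C" "(x, x') \<in> ?R" using x S_iff by blast
    then have x'L: "x' \<in> ?L" by (auto simp: linkage_congruence_def)
    have ne: "V \<noteq> {}" using ab by blast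
    obtain g where g: "euclidean_isometry g"
      and al: "\<And>\<kappa>. (\<Sum>v\<in>V. trivial_motion p \<kappa> v \<bullet> g (x' v)) = (\<Sum>v\<in>V. trivial_motion p \<kappa> v \<bullet> p v)"
      and near: "(\<Sum>v\<in>V. (dist (g (x' v)) (p v))\<^sup>2) \<le> (\<Sum>v\<in>V. (dist (x' v) (p v))\<^sup>2)"
      by (rule aligned_congruent_placement[OF V ne, of p x']) (rule that)
    define y where "y = (\<lambda>v\<in>V. g (x' v))"
    have x'y: "(x', y) \<in> ?R"
      unfolding y_def by (rule linkage_realization_isometry[OF E(1) g x'L])
    then have xy: "(x, y) \<in> ?R" using x'(2) equiv unfolding equiv_def trans_def by blast
    have yL: "y \<in> ?L" using xy by (auto simp: linkage_congruence_def)
    have "y \<in> C" using near x'(1) L_T yL by (auto simp: C_def y_def)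
    moreover have "\<Psi> y = glue (\<theta> x)"
    proof
      fix k
      consider "k < f" | "f \<le> k" "k < N" | "\<not> k < N" by linarith
      then show "\<Psi> y k = glue (\<theta> x) k"
      proof cases
        case 1
        then show ?thesis
          using fN \<theta>_congruent[OF xy] by (simp add: \<Psi>_def glue_def) (simp add: \<theta>_def)
      next
        case 2
        have "cf i y = cf i p" if "i \<in> Inl ` E \<union> Inr ` K" for i
          using that
        proof
          assume "i \<in> Inl ` E"
          then show ?thesis
            using yL by (auto simp: cf_def linkage_realizations_def same_edge_lengths_iff[OF E(1)])
        next
          assume "i \<in> Inr ` K"
          then show ?thesis using al by (auto simp: cf_def y_def)
        qed
        then show ?thesis using nth_fixed[OF 2] 2 by (simp add: \<Psi>_def glue_def)
      qed (use fN in \<open>simp add: \<Psi>_def glue_def\<close>)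
    qed
    ultimately show ?thesis using xy by blast
  qed
  have \<theta>_top: "\<theta> x \<in> topspace (Euclidean_space f)" for x
    by (simp add: \<theta>_def topspace_Euclidean_space)
  have \<theta>_Y: "\<theta> x \<in> Y" if "x \<in> S" for x
    using aligned[OF that] \<theta>_top by (auto simp: Y_def) (metis imageI)
  define k where "k t = ?R `` {\<Psi>' (glue t)}" for t
  have inv: "\<Psi>' (glue t) \<in> C" "\<Psi> (\<Psi>' (glue t)) = glue t" if "t \<in> Y" for t
    using that \<Psi>' openin_subset[OF dom(1)] unfolding Y_def homeomorphic_maps_def
    by (auto simp: continuous_map_def Pi_iff)
  have inv_L: "\<Psi>' (glue t) \<in> ?L" if t: "t \<in> Y" for t
  proof -
    let ?y = "\<Psi>' (glue t)"
    have "rigidity_row ?y e ?y = rigidity_row p e p" if "e \<in> E" for e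
    proof -
      have "Inl e \<in> set \<alpha>s" using that B(1) by (auto simp: set_\<alpha>s)
      then obtain k where k: "k < N" "\<alpha>s ! k = Inl e" using len by (metis in_set_conv_nth)
      have "\<not> k < f" using nth_free[of k] k(2) that by auto
      then have "cf (Inl e) ?y = cf (Inl e) p"
        using fun_cong[OF inv(2)[OF t], of k] k by (simp add: \<Psi>_def glue_def)
      then show ?thesis by (simp add: cf_def)
    qed
    moreover have "?y \<in> extensional V" using inv(1)[OF t] by (auto simp: C_def PiE_def)
    ultimately show ?thesis
      by (simp add: linkage_realizations_def same_edge_lengths_iff[OF E(1)])
  qed
  have inv_\<theta>: "\<theta> (\<Psi>' (glue t)) = t" if t: "t \<in> Y" for t
  proof
    fix k
    show "\<theta> (\<Psi>' (glue t)) k = t k"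
    proof (cases "k < f")
      case True
      then show ?thesis
        using fun_cong[OF inv(2)[OF t], of k] fN by (simp add: \<theta>_def \<Psi>_def glue_def)
    next
      case False
      then show ?thesis using t by (simp add: \<theta>_def Y_def topspace_Euclidean_space)
    qed
  qed
  have inv_S: "\<Psi>' (glue t) \<in> S" if t: "t \<in> Y" for t
    using inv(1)[OF t] inv_L[OF t] equiv_class_self[OF equiv, of "\<Psi>' (glue t)"] by (auto simp: S_iff)
  define h where "h c = \<theta> (SOME x. x \<in> c)" for c
  have h: "h (?R `` {x}) = \<theta> x" if "x \<in> ?L" for x
  proof -
    have "(SOME y. y \<in> ?R `` {x}) \<in> ?R `` {x}"
      using equiv_class_self[OF equiv, of x] that by (intro someI[of "\<lambda>y. y \<in> ?R `` {x}" x]) simp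
    then show ?thesis using \<theta>_congruent by (simp add: h_def)
  qed
  have S_L: "S \<subseteq> ?L" by (auto simp: S_def)
  have "homeomorphic_maps (subtopology ?Q ?U) (subtopology (Euclidean_space f) Y) h k"
    unfolding homeomorphic_maps_def
  proof (intro conjI ballI)
    have "continuous_map (subtopology ?TL S) (subtopology (Euclidean_space f) Y) \<theta>"
      using \<theta>_Y cont_\<theta>
      by (auto simp: continuous_map_in_subtopology linkage_realization_space_def continuous_map_from_subtopology)
    then have "continuous_map (subtopology ?TL S) (subtopology (Euclidean_space f) Y) (h \<circ> (\<lambda>x. ?R `` {x}))"
      by (rule continuous_map_eq) (use h in simp)
    then show "continuous_map (subtopology ?Q ?U) (subtopology (Euclidean_space f) Y) h"
      using continuous_compose_quotient_map_eq[OF qm] by blast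
    have "continuous_map (subtopology (Euclidean_space f) Y) (subtopology (Euclidean_space N) (\<Psi> ` C)) glue"
      using cont_glue by (auto simp: continuous_map_in_subtopology continuous_map_from_subtopology Y_def)
    then have "continuous_map (subtopology (Euclidean_space f) Y) (subtopology ?T C) (\<Psi>' \<circ> glue)"
      using \<Psi>' by (auto simp: homeomorphic_maps_def intro: continuous_map_compose)
    then have "continuous_map (subtopology (Euclidean_space f) Y) ?T (\<Psi>' \<circ> glue)"
      by (simp add: continuous_map_in_subtopology)
    then have "continuous_map (subtopology (Euclidean_space f) Y) (subtopology ?TL S) (\<Psi>' \<circ> glue)"
      using inv_L inv_S by (auto simp: continuous_map_in_subtopology linkage_realization_space_def)
    then have "continuous_map (subtopology (Euclidean_space f) Y) (subtopology ?Q ?U) ((\<lambda>x. ?R `` {x}) \<circ> (\<Psi>' \<circ> glue))"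
      by (rule continuous_map_compose) (rule quotient_imp_continuous_map[OF qm])
    then show "continuous_map (subtopology (Euclidean_space f) Y) (subtopology ?Q ?U) k"
      by (simp add: o_def k_def[abs_def])
    show "k (h c) = c" if c: "c \<in> topspace (subtopology ?Q ?U)" for c
    proof -
      obtain x where x: "x \<in> S" "c = ?R `` {x}" using c by auto
      then obtain y where y: "y \<in> C" "(x, y) \<in> ?R" "\<Psi> y = glue (\<theta> x)" using aligned by blast
      have "\<Psi>' (\<Psi> y) = y"
        using \<Psi>' y(1) by (simp add: homeomorphic_maps_def C_def)
      then have "k (h c) = ?R `` {y}"
        using x h S_L y(3) by (auto simp: k_def)
      also have "\<dots> = c"
        using equiv_class_eq[OF equiv y(2)] x(2) by simp
      finally show ?thesis .
    qed
    show "h (k t) = t" if "t \<in> topspace (subtopology (Euclidean_space f) Y)" for t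
      using that h inv_L inv_\<theta> by (simp add: k_def)
  qed
  then have hm: "homeomorphic_map (subtopology ?Q ?U) (subtopology (Euclidean_space f) Y) h"
    by (rule homeomorphic_maps_imp_map)
  have "restrict p V \<in> S"
  proof -
    have pC: "restrict p V \<in> C" using \<epsilon> by (simp add: C_def)
    have "restrict p V \<in> ?L"
      using simple_graph_iff_vertex_pairs[of V E] E(1)
      by (auto simp: linkage_realizations_def same_edge_lengths_def simple_graph_def)
    then show ?thesis
      using pC equiv_class_self[OF equiv, of "restrict p V"] by (auto simp: S_iff)
  qed
  then have "linkage_class V E p p \<in> ?U"
    by (simp add: linkage_class_def)
  from has_local_dimensionI[OF U this Y hm]
  have "has_local_dimension ?Q (linkage_class V E p p) f" .
  moreover have "f + card E + ((CARD('d) + 1) choose 2) = card V * CARD('d)"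
    using B(3) K(2) card_f by simp
  ultimately show ?thesis using that by blast
qed


section \<open>Structure and uniqueness of associated frameworks\<close>

locale marked_linkage =
  fixes V :: "'v set" and E :: "'v set set" and p :: "'v \<Rightarrow> real ^ 'd" and a b :: "'d \<Rightarrow> 'v"
  assumes finite_V: "finite V" and E_pairs: "E \<subseteq> vertex_pairs V"
    and nondegenerate: "\<And>u v. {u, v} \<in> E \<Longrightarrow> p u \<noteq> p v"
    and marked: "\<And>k. a k \<in> V \<and> b k \<in> V"
    and basis: "is_basis (marked_vector p a b)"
begin

lemma edge_subset: "e \<in> E \<Longrightarrow> e \<subseteq> V"
  using E_pairs by (auto simp: vertex_pairs_def)

abbreviation period :: "('d \<Rightarrow> int) \<Rightarrow> real ^ 'd" where
  "period \<equiv> lattice_point (marked_vector p a b)"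

end

text \<open>
  Any framework associated with the linkage.  What is proved in this locale describes all of it in
  terms of the linkage and the integer vectors that index the periodicity group.
\<close>

locale associated = marked_linkage V E p a b
  for V :: "'v set" and E and p :: "'v \<Rightarrow> real ^ 'd" and a b +
  fixes W :: "'w set" and F :: "'w set set" and \<Gamma> :: "('w \<Rightarrow> 'w) set"
    and q :: "'w \<Rightarrow> real ^ 'd" and \<pi> :: "('w \<Rightarrow> 'w) \<Rightarrow> real ^ 'd" and \<iota> :: "'v \<Rightarrow> 'w"
  assumes assoc: "associated_framework V E p a b W F \<Gamma> q \<pi> \<iota>"
begin

lemma graph: "periodic_graph CARD('d) W F \<Gamma>" and placement: "periodic_placement W F \<Gamma> q \<pi>"
  and \<pi>_image: "\<pi> ` \<Gamma> = range period"
  and edge_rep: "\<And>orb. orb \<in> edge_orbits W F \<Gamma> \<Longrightarrow> \<exists>!e. e \<in> E \<and> \<iota> ` e \<in> orb"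
  and vertex_rep: "\<And>orb. orb \<in> vertex_orbits W \<Gamma> \<Longrightarrow> \<exists>v\<in>V. \<iota> v \<in> orb"
  and \<iota>_W: "\<And>v. v \<in> V \<Longrightarrow> \<iota> v \<in> W" and \<iota>_F: "\<And>e. e \<in> E \<Longrightarrow> \<iota> ` e \<in> F"
  and q_\<iota>: "\<And>v. v \<in> V \<Longrightarrow> q (\<iota> v) = p v"
  and gluing: "\<And>u v. u \<in> V \<Longrightarrow> v \<in> V \<Longrightarrow> same_orbit \<Gamma> (\<iota> u) (\<iota> v) \<longleftrightarrow> marked_equiv a b u v"
  using assoc
  by (auto simp: associated_framework_def linkage_in_periodic_framework_def periodic_framework_def
      contains_linkage_def marked_gluing_def lattice_of_eq_range)

lemma subgroup_\<Gamma>: "subgroup \<Gamma> (BijGroup W)" and \<Gamma>_auts: "\<Gamma> \<subseteq> graph_auts W F" and F_simple: "simple_graph W F"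
  using graph by (auto simp: periodic_graph_def)

lemma \<Gamma>_Bij: "\<gamma> \<in> \<Gamma> \<Longrightarrow> \<gamma> \<in> Bij W"
  using \<Gamma>_auts by (auto simp: graph_auts_def)

lemma \<Gamma>_closed: "\<gamma> \<in> \<Gamma> \<Longrightarrow> w \<in> W \<Longrightarrow> \<gamma> w \<in> W"
  using \<Gamma>_Bij Bij_imp_funcset by blast

lemma \<Gamma>_extensional: "\<gamma> \<in> \<Gamma> \<Longrightarrow> \<gamma> \<in> extensional W"
  using \<Gamma>_Bij by (auto simp: Bij_def)

lemma mult_eq: "\<gamma> \<in> \<Gamma> \<Longrightarrow> \<delta> \<in> \<Gamma> \<Longrightarrow> \<gamma> \<otimes>\<^bsub>BijGroup W\<^esub> \<delta> = compose W \<gamma> \<delta>"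
  by (simp add: BijGroup_def \<Gamma>_Bij)

lemma compose_\<Gamma>: "\<gamma> \<in> \<Gamma> \<Longrightarrow> \<delta> \<in> \<Gamma> \<Longrightarrow> compose W \<gamma> \<delta> \<in> \<Gamma>"
  using subgroup.m_closed[OF subgroup_\<Gamma>] mult_eq by metis

lemma \<pi>_compose: "\<gamma> \<in> \<Gamma> \<Longrightarrow> \<delta> \<in> \<Gamma> \<Longrightarrow> \<pi> (compose W \<gamma> \<delta>) = \<pi> \<gamma> + \<pi> \<delta>"
  using placement mult_eq by (auto simp: periodic_placement_def)

lemma inj_\<pi>: "inj_on \<pi> \<Gamma>" and equivariant: "\<And>\<gamma> w. \<gamma> \<in> \<Gamma> \<Longrightarrow> w \<in> W \<Longrightarrow> q (\<gamma> w) = q w + \<pi> \<gamma>"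
  using placement by (auto simp: periodic_placement_def)

lemma id_\<Gamma>: "(\<lambda>w\<in>W. w) \<in> \<Gamma>"
  using subgroup.one_closed[OF subgroup_\<Gamma>] by (simp add: BijGroup_def)

text \<open>
  Indexing the periodicity group by integer vectors makes different frameworks comparable, although
  their groups consist of permutations of different sets.
\<close>

definition tr :: "('d \<Rightarrow> int) \<Rightarrow> 'w \<Rightarrow> 'w" where
  "tr n = inv_into \<Gamma> \<pi> (period n)"

lemma tr_\<Gamma> [simp]: "tr n \<in> \<Gamma>" and \<pi>_tr [simp]: "\<pi> (tr n) = period n"
proof -
  have "period n \<in> \<pi> ` \<Gamma>" by (simp add: \<pi>_image)
  then show "tr n \<in> \<Gamma>" "\<pi> (tr n) = period n"
    by (simp_all add: tr_def inv_into_into f_inv_into_f)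
qed

lemma tr_eqI: "\<gamma> \<in> \<Gamma> \<Longrightarrow> \<pi> \<gamma> = period n \<Longrightarrow> \<gamma> = tr n"
  using inj_\<pi> by (metis inj_onD \<pi>_tr tr_\<Gamma>)

lemma \<Gamma>_eq_range: "\<Gamma> = range tr"
proof (intro equalityI subsetI)
  fix \<gamma> assume \<gamma>: "\<gamma> \<in> \<Gamma>"
  then obtain n where "\<pi> \<gamma> = period n" using \<pi>_image by blast
  then show "\<gamma> \<in> range tr" using tr_eqI[OF \<gamma>] by blast
qed auto

lemma \<Gamma>_cases:
  assumes "\<gamma> \<in> \<Gamma>"
  obtains n where "\<gamma> = tr n"
  using assms \<Gamma>_eq_range by (metis imageE)

lemma \<Gamma>_image: "{f \<gamma> |\<gamma>. \<gamma> \<in> \<Gamma>} = range (\<lambda>n. f (tr n))"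
  by (auto elim: \<Gamma>_cases)

lemma tr_W [simp]: "w \<in> W \<Longrightarrow> tr n w \<in> W"
  by (simp add: \<Gamma>_closed)

lemma tr_tr: "w \<in> W \<Longrightarrow> tr n (tr m w) = tr (\<lambda>k. n k + m k) w"
proof -
  assume w: "w \<in> W"
  have "compose W (tr n) (tr m) = tr (\<lambda>k. n k + m k)"
    by (rule tr_eqI) (simp_all add: compose_\<Gamma> \<pi>_compose lattice_point_add)
  from fun_cong[OF this, of w] show ?thesis using w by (simp add: compose_eq)
qed

lemma tr_zero: "w \<in> W \<Longrightarrow> tr (\<lambda>_. 0) w = w"
proof -
  assume w: "w \<in> W"
  have "compose W (\<lambda>w\<in>W. w) (\<lambda>w\<in>W. w) = (\<lambda>w\<in>W. w)"
    by (auto simp: compose_def)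
  then have "\<pi> (\<lambda>w\<in>W. w) = 0" using \<pi>_compose[OF id_\<Gamma> id_\<Gamma>] by simp
  then have "(\<lambda>w\<in>W. w) = tr (\<lambda>_. 0)" by (intro tr_eqI id_\<Gamma>) simp
  from fun_cong[OF this, of w] show ?thesis using w by simp
qed

lemma tr_inverse: "w \<in> W \<Longrightarrow> tr (\<lambda>k. - n k) (tr n w) = w" "w \<in> W \<Longrightarrow> tr n (tr (\<lambda>k. - n k) w) = w"
  by (simp_all add: tr_tr tr_zero)

lemma q_tr: "v \<in> V \<Longrightarrow> q (tr n (\<iota> v)) = p v + period n"
  by (simp add: equivariant \<iota>_W q_\<iota>)

lemma vertex_orbits_eq: "vertex_orbits W \<Gamma> = (\<lambda>w. range (\<lambda>n. tr n w)) ` W"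
  by (auto simp: vertex_orbits_def orbits_def orbit_def \<Gamma>_image[of "\<lambda>\<gamma>. \<gamma> _"])

lemma edge_orbits_eq: "edge_orbits W F \<Gamma> = (\<lambda>e. range (\<lambda>n. tr n ` e)) ` F"
  by (auto simp: edge_orbits_def orbits_def orbit_def \<Gamma>_image[of "\<lambda>\<gamma>. \<gamma> ` _"])

lemma vertex_cover:
  assumes "w \<in> W"
  obtains v n where "v \<in> V" "w = tr n (\<iota> v)"
proof -
  have "range (\<lambda>n. tr n w) \<in> vertex_orbits W \<Gamma>"
    unfolding vertex_orbits_eq using assms by (rule imageI)
  from vertex_rep[OF this] obtain v n where "v \<in> V" "\<iota> v = tr n w"
    by blast
  then show ?thesis using that[of v "\<lambda>k. - n k"] tr_inverse(1)[OF assms] by simp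
qed

lemma edge_cover:
  assumes "e' \<in> F"
  obtains e n where "e \<in> E" "e' = tr n ` \<iota> ` e"
proof -
  have "range (\<lambda>n. tr n ` e') \<in> edge_orbits W F \<Gamma>"
    unfolding edge_orbits_eq using assms by (rule imageI)
  from ex1_implies_ex[OF edge_rep[OF this]] obtain e n where e: "e \<in> E" "\<iota> ` e = tr n ` e'"
    by blast
  have "e' \<subseteq> W" using assms F_simple by (auto simp: simple_graph_def)
  then have "(\<lambda>w. tr (\<lambda>k. - n k) (tr n w)) ` e' = (\<lambda>w. w) ` e'"
    by (intro image_cong refl tr_inverse(1)) blast
  then have "e' = tr (\<lambda>k. - n k) ` \<iota> ` e" using e(2) by (simp add: image_image)
  then show ?thesis using that e(1) by blast
qed

lemma edge_translate:
  assumes "e \<in> E"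
  shows "tr n ` \<iota> ` e \<in> F"
proof -
  obtain u v where uv: "e = {u, v}" "u \<in> V" "v \<in> V"
    using assms E_pairs by (blast elim: vertex_pairsE)
  have "{\<iota> u, \<iota> v} \<in> F" using \<iota>_F[OF assms] uv by simp
  then have "{tr n (\<iota> u), tr n (\<iota> v)} \<in> F"
    using \<Gamma>_auts tr_\<Gamma>[of n] \<iota>_W uv unfolding graph_auts_def by blast
  then show ?thesis by (simp add: uv)
qed

text \<open>
  The gluing condition decides whether \<open>\<iota> u\<close> and \<open>\<iota> v\<close> lie in one orbit.  If they do, then the
  positions determine the group element, since \<open>\<pi>\<close> is injective and the marked vectors are independent.
\<close>

lemma tr_\<iota>_iff:
  assumes uv: "u \<in> V" "v \<in> V"
  shows "tr n (\<iota> u) = \<iota> v \<longleftrightarrow> marked_displacement a b u v n"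
proof
  assume eq: "tr n (\<iota> u) = \<iota> v"
  then have "same_orbit \<Gamma> (\<iota> u) (\<iota> v)" unfolding same_orbit_def by (intro bexI[of _ "tr n"]) simp_all
  then obtain m where m: "marked_displacement a b u v m"
    using gluing uv marked_equiv_iff_displacement by metis
  have "p v - p u = period n"
    using q_tr[OF uv(1), of n] q_\<iota>[OF uv(2)] eq by simp
  then show "marked_displacement a b u v n"
    using marked_displacement_unique[OF basis m] m by simp
next
  assume n: "marked_displacement a b u v n"
  then have "same_orbit \<Gamma> (\<iota> u) (\<iota> v)"
    using gluing uv marked_equiv_iff_displacement by metis
  then obtain m where m: "tr m (\<iota> u) = \<iota> v"
    by (auto simp: same_orbit_def elim: \<Gamma>_cases)
  have "p v - p u = period m"
    using q_tr[OF uv(1), of m] q_\<iota>[OF uv(2)] m by simp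
  then show "tr n (\<iota> u) = \<iota> v"
    using marked_displacement_unique[OF basis n] m by simp
qed

text \<open>
  All coincidences among the translates of the linkage are thereby determined by the marked pairs.
\<close>

lemma tr_eq_iff:
  assumes uv: "u \<in> V" "v \<in> V"
  shows "tr n (\<iota> u) = tr m (\<iota> v) \<longleftrightarrow> marked_displacement a b u v (\<lambda>k. n k - m k)"
proof -
  have "tr n (\<iota> u) = tr m (\<iota> v) \<longleftrightarrow> tr (\<lambda>k. - m k) (tr n (\<iota> u)) = \<iota> v"
    using tr_inverse[of "\<iota> v" m] tr_inverse(2)[of "tr n (\<iota> u)" m] uv \<iota>_W by (metis tr_W)
  then show ?thesis
    using uv \<iota>_W by (simp add: tr_tr tr_\<iota>_iff)
qed

lemma card_edge_orbits: "card (edge_orbits W F \<Gamma>) = card E"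
proof -
  let ?o = "\<lambda>e. range (\<lambda>n. tr n ` \<iota> ` e)"
  have self: "\<iota> ` e \<in> ?o e" if "e \<in> E" for e
  proof -
    have "(\<lambda>v. tr (\<lambda>_. 0) (\<iota> v)) ` e = \<iota> ` e"
      using edge_subset[OF that] \<iota>_W by (intro image_cong refl tr_zero) blast
    then have eq: "tr (\<lambda>_. 0) ` \<iota> ` e = \<iota> ` e" by (simp add: image_image)
    from rangeI[of "\<lambda>n. tr n ` \<iota> ` e" "\<lambda>_. 0"] show ?thesis by (simp only: eq)
  qed
  have "?o ` E = edge_orbits W F \<Gamma>"
  proof (intro equalityI subsetI)
    fix orb assume "orb \<in> edge_orbits W F \<Gamma>"
    then obtain e' where e': "e' \<in> F" "orb = range (\<lambda>n. tr n ` e')"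
      by (auto simp: edge_orbits_eq)
    obtain e m where e: "e \<in> E" "e' = tr m ` \<iota> ` e" using e'(1) by (rule edge_cover)
    have tt: "tr n ` tr m ` \<iota> ` e = tr (\<lambda>k. n k + m k) ` \<iota> ` e" for n m
      using edge_subset[OF e(1)] \<iota>_W unfolding image_image by (intro image_cong refl tr_tr) blast
    have "orb = ?o e"
    proof (intro equalityI subsetI)
      fix x assume "x \<in> ?o e"
      then obtain n where "x = tr n ` \<iota> ` e" by blast
      then have "x = tr (\<lambda>k. n k - m k) ` e'" by (simp add: e(2) tt)
      then show "x \<in> orb" using e'(2) by blast
    qed (use e' e(2) tt in auto)
    then show "orb \<in> ?o ` E" using e(1) by blast
  qed (auto simp: edge_orbits_eq \<iota>_F)
  moreover have "inj_on ?o E"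
  proof (rule inj_onI)
    fix e\<^sub>1 e\<^sub>2 assume e: "e\<^sub>1 \<in> E" "e\<^sub>2 \<in> E" "?o e\<^sub>1 = ?o e\<^sub>2"
    have orb: "?o e\<^sub>1 \<in> edge_orbits W F \<Gamma>" using e(1) \<iota>_F by (auto simp: edge_orbits_eq)
    have 2: "e\<^sub>2 \<in> E \<and> \<iota> ` e\<^sub>2 \<in> ?o e\<^sub>1"
      unfolding e(3) by (intro conjI self e(2))
    have 1: "e\<^sub>1 \<in> E \<and> \<iota> ` e\<^sub>1 \<in> ?o e\<^sub>1"
      by (intro conjI self e(1))
    define P where "P e \<longleftrightarrow> e \<in> E \<and> \<iota> ` e \<in> ?o e\<^sub>1" for e
    have "\<exists>!e. P e" "P e\<^sub>1" "P e\<^sub>2"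
      unfolding P_def by (rule edge_rep[OF orb], rule 1, rule 2)
    then show "e\<^sub>1 = e\<^sub>2" by blast
  qed
  ultimately show ?thesis using card_image[of ?o E] by simp
qed

lemma card_vertex_orbits: "card (vertex_orbits W \<Gamma>) + CARD('d) = card V"
proof -
  let ?R = "{(u, v). u \<in> V \<and> v \<in> V \<and> marked_equiv a b u v}"
  let ?o = "\<lambda>v. range (\<lambda>n. tr n (\<iota> v))"
  have orbit_iff: "?o u = ?o v \<longleftrightarrow> marked_equiv a b u v" if uv: "u \<in> V" "v \<in> V" for u v
  proof
    assume eq: "?o u = ?o v"
    have "tr (\<lambda>_. 0) (\<iota> v) \<in> ?o v" by blast
    then obtain n where "tr (\<lambda>_. 0) (\<iota> v) = tr n (\<iota> u)" unfolding eq[symmetric] by blast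
    then have "tr n (\<iota> u) = \<iota> v" using tr_zero[OF \<iota>_W[OF uv(2)]] by simp
    then show "marked_equiv a b u v"
      using tr_\<iota>_iff[OF uv] by (auto simp: marked_equiv_iff_displacement)
  next
    have sub: "?o v \<subseteq> ?o u" if uv: "marked_equiv a b u v" "u \<in> V" "v \<in> V" for u v
    proof -
      obtain m where m: "\<iota> v = tr m (\<iota> u)"
        using uv tr_\<iota>_iff[OF uv(2,3)] by (metis marked_equiv_iff_displacement)
      show ?thesis
        using m tr_tr[OF \<iota>_W[OF uv(2)]] by auto
    qed
    assume "marked_equiv a b u v"
    with uv show "?o u = ?o v"
      by (intro equalityI sub marked_equiv_sym[of a b u v])
  qed
  have "vertex_orbits W \<Gamma> = ?o ` V"
  proof (intro equalityI subsetI)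
    fix orb assume "orb \<in> vertex_orbits W \<Gamma>"
    then obtain w where w: "w \<in> W" "orb = range (\<lambda>n. tr n w)" by (auto simp: vertex_orbits_eq)
    obtain v m where v: "v \<in> V" "w = tr m (\<iota> v)" using w(1) by (rule vertex_cover)
    have "orb = ?o v"
    proof (intro equalityI subsetI)
      fix x assume "x \<in> ?o v"
      then obtain n where "x = tr n (\<iota> v)" by blast
      then have "x = tr (\<lambda>k. n k - m k) w" using v \<iota>_W by (simp add: tr_tr)
      then show "x \<in> orb" using w(2) by blast
    qed (use w v \<iota>_W tr_tr in auto)
    then show "orb \<in> ?o ` V" using v(1) by blast
  qed (auto simp: vertex_orbits_eq \<iota>_W)
  moreover have bij: "bij_betw (\<lambda>C. \<Union>v\<in>C. ?o v) (V // ?R) (?o ` V)"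
  proof -
    have cls: "(\<Union>v\<in>?R `` {u}. ?o v) = ?o u" if u: "u \<in> V" for u
    proof -
      have "?o v = ?o u" if "v \<in> ?R `` {u}" for v
        using that orbit_iff[of v u] marked_equiv_sym[of a b u v] by auto
      moreover have "u \<in> ?R `` {u}" using u by simp
      ultimately show ?thesis by blast
    qed
    show ?thesis
      unfolding bij_betw_def
    proof
      show "inj_on (\<lambda>C. \<Union>v\<in>C. ?o v) (V // ?R)"
      proof (rule inj_onI)
        fix C D assume C: "C \<in> V // ?R" and D: "D \<in> V // ?R" and e: "(\<Union>v\<in>C. ?o v) = (\<Union>v\<in>D. ?o v)"
        obtain u where u: "u \<in> V" "C = ?R `` {u}" using C by (auto simp: quotient_def)
        obtain v where v: "v \<in> V" "D = ?R `` {v}" using D by (auto simp: quotient_def)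
        have "?o u = ?o v" using e unfolding u(2) v(2) cls[OF u(1)] cls[OF v(1)] .
        then have uv: "marked_equiv a b u v" using orbit_iff[OF u(1) v(1)] by simp
        have "marked_equiv a b u x \<longleftrightarrow> marked_equiv a b v x" for x
          using marked_equiv_trans[OF uv] marked_equiv_trans[OF marked_equiv_sym[OF uv]] by blast
        then show "C = D"
          using u v by auto
      qed
      show "(\<lambda>C. \<Union>v\<in>C. ?o v) ` (V // ?R) = ?o ` V"
      proof -
        have "V // ?R = (\<lambda>u. ?R `` {u}) ` V" by (auto simp: quotient_def)
        then have "(\<lambda>C. \<Union>v\<in>C. ?o v) ` (V // ?R) = (\<lambda>u. \<Union>v\<in>?R `` {u}. ?o v) ` V"
          by (simp only: image_image)
        also have "\<dots> = ?o ` V"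
          using cls by (intro image_cong refl)
        finally show ?thesis .
      qed
    qed
  qed
  ultimately have "card (vertex_orbits W \<Gamma>) = card (V // ?R)"
    using bij_betw_same_card[OF bij] by simp
  then show ?thesis
    using card_marked_classes[OF finite_V marked basis] by simp
qed

end

text \<open>
  The isomorphism takes \<open>tr n (\<iota>\<^sub>1 v)\<close> to \<open>tr n (\<iota>\<^sub>2 v)\<close>.  It is well defined and injective because the
  criterion of \<open>tr_eq_iff\<close> is the same in both frameworks.
\<close>

lemma associated_framework_unique:
  assumes A1: "associated V E p a b W\<^sub>1 F\<^sub>1 \<Gamma>\<^sub>1 q\<^sub>1 \<pi>\<^sub>1 \<iota>\<^sub>1" and A2: "associated V E p a b W\<^sub>2 F\<^sub>2 \<Gamma>\<^sub>2 q\<^sub>2 \<pi>\<^sub>2 \<iota>\<^sub>2"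
  shows "\<exists>\<phi>. framework_iso \<phi> W\<^sub>1 F\<^sub>1 \<Gamma>\<^sub>1 q\<^sub>1 \<pi>\<^sub>1 W\<^sub>2 F\<^sub>2 \<Gamma>\<^sub>2 q\<^sub>2 \<pi>\<^sub>2 \<and> (\<forall>v\<in>V. \<phi> (\<iota>\<^sub>1 v) = \<iota>\<^sub>2 v)"
proof -
  interpret A1: associated V E p a b W\<^sub>1 F\<^sub>1 \<Gamma>\<^sub>1 q\<^sub>1 \<pi>\<^sub>1 \<iota>\<^sub>1 by (rule A1)
  interpret A2: associated V E p a b W\<^sub>2 F\<^sub>2 \<Gamma>\<^sub>2 q\<^sub>2 \<pi>\<^sub>2 \<iota>\<^sub>2 by (rule A2)
  have "\<forall>w\<in>W\<^sub>1. \<exists>vn. fst vn \<in> V \<and> w = A1.tr (snd vn) (\<iota>\<^sub>1 (fst vn))"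
    using A1.vertex_cover by (metis fst_conv snd_conv)
  then obtain c where c: "\<And>w. w \<in> W\<^sub>1 \<Longrightarrow> fst (c w) \<in> V \<and> w = A1.tr (snd (c w)) (\<iota>\<^sub>1 (fst (c w)))"
    by metis
  define \<phi> where "\<phi> w = A2.tr (snd (c w)) (\<iota>\<^sub>2 (fst (c w)))" for w
  have \<phi>: "\<phi> (A1.tr n (\<iota>\<^sub>1 v)) = A2.tr n (\<iota>\<^sub>2 v)" if v: "v \<in> V" for n v
  proof -
    let ?c = "c (A1.tr n (\<iota>\<^sub>1 v))"
    have "A1.tr n (\<iota>\<^sub>1 v) \<in> W\<^sub>1" using v A1.\<iota>_W by simp
    from c[OF this] have "fst ?c \<in> V" "A1.tr (snd ?c) (\<iota>\<^sub>1 (fst ?c)) = A1.tr n (\<iota>\<^sub>1 v)" by auto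
    then show ?thesis
      unfolding \<phi>_def using v by (simp add: A1.tr_eq_iff A2.tr_eq_iff)
  qed
  have inj: "inj_on \<phi> W\<^sub>1"
  proof (rule inj_onI)
    fix w w' assume w: "w \<in> W\<^sub>1" "w' \<in> W\<^sub>1" "\<phi> w = \<phi> w'"
    obtain u n where u: "u \<in> V" "w = A1.tr n (\<iota>\<^sub>1 u)" using w(1) by (rule A1.vertex_cover)
    obtain v m where v: "v \<in> V" "w' = A1.tr m (\<iota>\<^sub>1 v)" using w(2) by (rule A1.vertex_cover)
    show "w = w'"
      using w(3) u v \<phi> by (simp add: A1.tr_eq_iff A2.tr_eq_iff)
  qed
  have surj: "\<phi> ` W\<^sub>1 = W\<^sub>2"
  proof (intro equalityI subsetI)
    fix w assume "w \<in> W\<^sub>2"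
    then obtain v n where "v \<in> V" "w = A2.tr n (\<iota>\<^sub>2 v)" by (rule A2.vertex_cover)
    then have "w = \<phi> (A1.tr n (\<iota>\<^sub>1 v))" "A1.tr n (\<iota>\<^sub>1 v) \<in> W\<^sub>1" using \<phi> A1.\<iota>_W by simp_all
    then show "w \<in> \<phi> ` W\<^sub>1" by blast
  qed (use c A2.\<iota>_W in \<open>auto simp: \<phi>_def\<close>)
  have bij: "bij_betw \<phi> W\<^sub>1 W\<^sub>2" using inj surj by (simp add: bij_betw_def)
  have edge: "\<phi> ` A1.tr n ` \<iota>\<^sub>1 ` e = A2.tr n ` \<iota>\<^sub>2 ` e" if "e \<in> E" for n e
    unfolding image_image using A1.edge_subset[OF that] \<phi> by (intro image_cong refl) blast
  have F: "F\<^sub>2 = (\<lambda>e. \<phi> ` e) ` F\<^sub>1"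
  proof (intro equalityI subsetI)
    fix e' assume "e' \<in> F\<^sub>2"
    then obtain e n where e: "e \<in> E" "e' = A2.tr n ` \<iota>\<^sub>2 ` e" by (rule A2.edge_cover)
    then have "e' = \<phi> ` A1.tr n ` \<iota>\<^sub>1 ` e" by (simp add: edge)
    then show "e' \<in> (\<lambda>e. \<phi> ` e) ` F\<^sub>1" using A1.edge_translate[OF e(1)] by blast
  next
    fix e' assume "e' \<in> (\<lambda>e. \<phi> ` e) ` F\<^sub>1"
    then obtain e'' where e'': "e'' \<in> F\<^sub>1" "e' = \<phi> ` e''" by blast
    obtain e n where e: "e \<in> E" "e'' = A1.tr n ` \<iota>\<^sub>1 ` e" using e''(1) by (rule A1.edge_cover)
    then have "e' = A2.tr n ` \<iota>\<^sub>2 ` e" using e''(2) by (simp add: edge)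
    then show "e' \<in> F\<^sub>2" using A2.edge_translate[OF e(1)] by simp
  qed
  define conj where "conj = (\<lambda>\<gamma>. \<lambda>w\<in>W\<^sub>2. \<phi> (\<gamma> (inv_into W\<^sub>1 \<phi> w)))"
  have conj: "conj (A1.tr m) = A2.tr m" for m
  proof (rule extensionalityI[of _ W\<^sub>2])
    show "conj (A1.tr m) \<in> extensional W\<^sub>2" by (simp add: conj_def)
    show "A2.tr m \<in> extensional W\<^sub>2" by (simp add: A2.\<Gamma>_extensional)
    fix w assume w: "w \<in> W\<^sub>2"
    then obtain v n where v: "v \<in> V" "w = A2.tr n (\<iota>\<^sub>2 v)" by (rule A2.vertex_cover)
    have "inv_into W\<^sub>1 \<phi> w = A1.tr n (\<iota>\<^sub>1 v)"
      using v A1.\<iota>_W \<phi> by (intro inv_into_f_eq[OF inj]) simp_all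
    then show "conj (A1.tr m) w = A2.tr m w"
      using w v A1.\<iota>_W A2.\<iota>_W by (simp add: conj_def A1.tr_tr A2.tr_tr \<phi>)
  qed
  have G: "\<Gamma>\<^sub>2 = conj ` \<Gamma>\<^sub>1"
  proof -
    have "\<Gamma>\<^sub>2 = range A2.tr" by (rule A2.\<Gamma>_eq_range)
    also have "\<dots> = conj ` range A1.tr" by (simp add: image_image conj)
    also have "\<dots> = conj ` \<Gamma>\<^sub>1" by (simp flip: A1.\<Gamma>_eq_range)
    finally show ?thesis .
  qed
  have P: "\<forall>\<gamma>\<in>\<Gamma>\<^sub>1. \<pi>\<^sub>2 (conj \<gamma>) = \<pi>\<^sub>1 \<gamma>"
    by (auto simp: conj elim: A1.\<Gamma>_cases)
  have Q: "\<forall>w\<in>W\<^sub>1. q\<^sub>2 (\<phi> w) = q\<^sub>1 w"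
  proof
    fix w assume "w \<in> W\<^sub>1"
    then obtain v n where "v \<in> V" "w = A1.tr n (\<iota>\<^sub>1 v)" by (rule A1.vertex_cover)
    then show "q\<^sub>2 (\<phi> w) = q\<^sub>1 w" by (simp add: \<phi> A1.q_tr A2.q_tr)
  qed
  have "framework_iso \<phi> W\<^sub>1 F\<^sub>1 \<Gamma>\<^sub>1 q\<^sub>1 \<pi>\<^sub>1 W\<^sub>2 F\<^sub>2 \<Gamma>\<^sub>2 q\<^sub>2 \<pi>\<^sub>2"
    unfolding framework_iso_def Let_def conj_def[symmetric] using bij F G P Q by blast
  moreover have "\<forall>v\<in>V. \<phi> (\<iota>\<^sub>1 v) = \<iota>\<^sub>2 v"
    using \<phi>[of _ "\<lambda>_. 0"] A1.tr_zero A2.tr_zero A1.\<iota>_W A2.\<iota>_W by simp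
  ultimately show ?thesis by blast
qed


section \<open>Restricting periodic realizations to the linkage\<close>

text \<open>
  A spanning family indexed by the coordinates has at most as many vectors as the dimension.
\<close>

lemma is_basis_if_spanning:
  fixes \<mu> :: "'d \<Rightarrow> real ^ 'd"
  assumes "span (range \<mu>) = UNIV"
  shows "is_basis \<mu>"
proof -
  have card_le: "card (range \<mu>) \<le> CARD('d)"
    by (rule card_image_le) simp
  have indep: "independent (range \<mu>)"
    by (rule card_le_dim_spanning[of _ UNIV]) (use assms card_le in \<open>simp_all add: dim_UNIV\<close>)
  have "card (range \<mu>) = dim (UNIV :: (real ^ 'd) set)"
    using dim_span_eq_card_independent[OF indep] assms by simp
  then have "inj \<mu>"
    by (intro eq_card_imp_inj_on) simp_all
  with indep assms show ?thesis by (simp add: is_basis_def)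
qed

lemma is_basis_iff_det: "is_basis \<mu> \<longleftrightarrow> det (\<chi> k. \<mu> k) \<noteq> 0"
proof -
  have "rows (\<chi> k. \<mu> k) = range \<mu>"
    by (auto simp: rows_def row_def vec_eq_iff)
  then have "det (\<chi> k. \<mu> k) \<noteq> 0 \<longleftrightarrow> span (range \<mu>) = UNIV"
    using matrix_left_invertible_span_rows[of "\<chi> k. \<mu> k"]
    by (simp add: invertible_det_nz[symmetric] invertible_left_inverse)
  then show ?thesis
    using is_basis_if_spanning by (auto simp: is_basis_def)
qed

lemma is_basis_orthogonal_transformation:
  assumes "is_basis \<mu>" "orthogonal_transformation h"
  shows "is_basis (\<lambda>k. h (\<mu> k))"
proof (rule is_basis_if_spanning)
  have "span (range (\<lambda>k. h (\<mu> k))) = span (h ` range \<mu>)"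
    by (simp add: image_image)
  also have "\<dots> = h ` span (range \<mu>)"
    by (rule linear_span_image[OF orthogonal_transformation_linear[OF assms(2)]])
  also have "\<dots> = UNIV"
    using assms orthogonal_transformation_surj by (auto simp: is_basis_def)
  finally show "span (range (\<lambda>k. h (\<mu> k))) = UNIV" .
qed

lemma additive_eq_unit_combination:
  fixes f :: "('d::finite \<Rightarrow> int) \<Rightarrow> 'z::real_vector"
  assumes add: "\<And>n m. f (\<lambda>k. n k + m k) = f n + f m"
  shows "f n = (\<Sum>k\<in>UNIV. of_int (n k) *\<^sub>R f (\<lambda>i. if i = k then 1 else 0))"
proof -
  have zero: "f (\<lambda>_. 0) = 0" using add[of "\<lambda>_. 0" "\<lambda>_. 0"] by simp
  have unit: "f (\<lambda>i. if i = k then c else 0) = of_int c *\<^sub>R f (\<lambda>i. if i = k then 1 else 0)" for k c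
  proof (induction c rule: int_induct[where k = 0])
    case base
    show ?case using zero by (simp cong: if_cong)
  next
    case (step1 c)
    have "(\<lambda>i. (if i = k then c else 0) + (if i = k then 1 else 0)) = (\<lambda>i. if i = k then c + 1 else 0)"
      by auto
    then show ?case
      using add[of "\<lambda>i. if i = k then c else 0" "\<lambda>i. if i = k then 1 else 0"] step1
      by (simp add: scaleR_left_distrib)
  next
    case (step2 c)
    have "(\<lambda>i. (if i = k then c - 1 else 0) + (if i = k then 1 else 0)) = (\<lambda>i. if i = k then c else 0)"
      by auto
    then show ?case
      using add[of "\<lambda>i. if i = k then c - 1 else 0" "\<lambda>i. if i = k then 1 else 0"] step2
      by (simp add: scaleR_left_diff_distrib)
  qed
  have "f (\<lambda>i. if i \<in> S then n i else 0) = (\<Sum>k\<in>S. of_int (n k) *\<^sub>R f (\<lambda>i. if i = k then 1 else 0))" for S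
  proof (induction S rule: infinite_finite_induct)
    case (insert k S)
    have "(\<lambda>i. (if i = k then n k else 0) + (if i \<in> S then n i else 0)) = (\<lambda>i. if i \<in> insert k S then n i else 0)"
      using insert by auto
    then have "f (\<lambda>i. if i \<in> insert k S then n i else 0) = of_int (n k) *\<^sub>R f (\<lambda>i. if i = k then 1 else 0)
        + (\<Sum>k\<in>S. of_int (n k) *\<^sub>R f (\<lambda>i. if i = k then 1 else 0))"
      using add[of "\<lambda>i. if i = k then n k else 0" "\<lambda>i. if i \<in> S then n i else 0"]
        unit[of k "n k"] insert.IH by (simp only:)
    then show ?case
      by (subst sum.insert[OF insert.hyps])
  qed (simp_all add: zero)
  from this[of UNIV] show ?thesis by simp
qed

lemma lattice_point_linear:
  assumes "linear h"
  shows "h (lattice_point \<mu> n) = lattice_point (\<lambda>k. h (\<mu> k)) n"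
  by (simp add: lattice_point_def linear_sum[OF assms] linear_scale[OF assms])

context associated
begin

abbreviation periods :: "('v \<Rightarrow> real ^ 'd) \<Rightarrow> ('d \<Rightarrow> int) \<Rightarrow> real ^ 'd" where
  "periods s \<equiv> lattice_point (marked_vector s a b)"

text \<open>
  The realizations of the linkage that extend to periodic realizations of the framework.
\<close>

definition spanning_realizations :: "('v \<Rightarrow> real ^ 'd) set" where
  "spanning_realizations = {s \<in> linkage_realizations V E p. is_basis (marked_vector s a b)}"

definition restriction :: "('w \<Rightarrow> real ^ 'd) \<times> (('w \<Rightarrow> 'w) \<Rightarrow> real ^ 'd) \<Rightarrow> 'v \<Rightarrow> real ^ 'd" where
  "restriction x = restrict (fst x \<circ> \<iota>) V"

lemma compose_tr: "tr n \<otimes>\<^bsub>BijGroup W\<^esub> tr m = tr (\<lambda>k. n k + m k)"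
  unfolding mult_eq[OF tr_\<Gamma> tr_\<Gamma>]
  by (rule tr_eqI) (simp_all add: compose_\<Gamma> \<pi>_compose lattice_point_add)

lemma tr_inj: "tr n = tr m \<Longrightarrow> n = m"
  using lattice_point_inj[OF basis] \<pi>_tr by metis

lemma edge_endpoints:
  assumes "{x, y} \<in> F"
  obtains u v n where "{u, v} \<in> E" "x = tr n (\<iota> u)" "y = tr n (\<iota> v)" "u \<in> V" "v \<in> V"
proof -
  obtain e n where e: "e \<in> E" "{x, y} = tr n ` \<iota> ` e" using assms by (rule edge_cover)
  obtain u v where uv: "e = {u, v}" "u \<in> V" "v \<in> V"
    using e(1) E_pairs by (blast elim: vertex_pairsE)
  then have "x = tr n (\<iota> u) \<and> y = tr n (\<iota> v) \<or> x = tr n (\<iota> v) \<and> y = tr n (\<iota> u)"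
    using e(2) by (auto simp: doubleton_eq_iff)
  then show ?thesis
    using that[of u v n] that[of v u n] e(1) uv by (auto simp: insert_commute)
qed

text \<open>
  The generator with unit vector \<open>k\<close> takes \<open>\<iota> (a k)\<close> to \<open>\<iota> (b k)\<close>, so its translation vector in any
  periodic placement is the marked vector, and the period homomorphism is known on generators.  Its image
  has to contain a basis, and therefore the marked vectors span the space.
\<close>

lemma periodic_placement_determined:
  assumes "periodic_placement W F \<Gamma> r \<rho>"
  shows "\<rho> (tr n) = periods (r \<circ> \<iota>) n"
    and "v \<in> V \<Longrightarrow> r (tr n (\<iota> v)) = r (\<iota> v) + periods (r \<circ> \<iota>) n"
    and "is_basis (marked_vector (r \<circ> \<iota>) a b)"
proof -
  have hom: "\<rho> (tr (\<lambda>k. n k + m k)) = \<rho> (tr n) + \<rho> (tr m)" for n m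
    using assms compose_tr[of n m] tr_\<Gamma> unfolding periodic_placement_def by metis
  have eqv: "r (tr n w) = r w + \<rho> (tr n)" if "w \<in> W" for n w
    using assms that by (simp add: periodic_placement_def)
  have unit: "\<rho> (tr (\<lambda>i. if i = k then 1 else 0)) = marked_vector (r \<circ> \<iota>) a b k" for k
  proof -
    have "tr (\<lambda>i. if i = k then 1 else 0) (\<iota> (a k)) = \<iota> (b k)"
      using marked[of k] marked_displacement_pair[of a b k] by (simp add: tr_\<iota>_iff)
    then show ?thesis
      using eqv[of "\<iota> (a k)" "\<lambda>i. if i = k then 1 else 0"] marked[of k] \<iota>_W by (simp add: marked_vector_def)
  qed
  show \<rho>: "\<rho> (tr n) = periods (r \<circ> \<iota>) n" for n
    using additive_eq_unit_combination[of "\<lambda>n. \<rho> (tr n)" n] hom unit by (simp add: lattice_point_def)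
  show "r (tr n (\<iota> v)) = r (\<iota> v) + periods (r \<circ> \<iota>) n" if "v \<in> V"
    using eqv \<iota>_W[OF that] \<rho> by simp
  obtain b' where b': "is_basis b'" "\<rho> ` \<Gamma> = lattice_of b'"
    using assms by (auto simp: periodic_placement_def)
  have "b' k \<in> span (range (marked_vector (r \<circ> \<iota>) a b))" for k
  proof -
    have "b' k \<in> \<rho> ` \<Gamma>" using b'(2) lattice_of_base by metis
    then obtain n where "b' k = periods (r \<circ> \<iota>) n" using \<rho> by (auto elim: \<Gamma>_cases)
    then show ?thesis
      by (simp add: lattice_point_def) (intro span_sum span_scale, rule span_base, rule rangeI)
  qed
  then have "span (range b') \<subseteq> span (range (marked_vector (r \<circ> \<iota>) a b))"
    by (intro span_minimal subspace_span) auto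
  then show "is_basis (marked_vector (r \<circ> \<iota>) a b)"
    using b'(1) by (intro is_basis_if_spanning) (auto simp: is_basis_def)
qed

text \<open>
  A choice of coordinates for the vertices of the framework: \<open>w\<close> is the translate by \<open>orbit_index w\<close> of
  the vertex \<open>orbit_vertex w\<close> of the linkage.  The choice does not affect \<open>extend\<close>, see \<open>fst_extend\<close>.
\<close>

definition orbit_vertex :: "'w \<Rightarrow> 'v" where
  "orbit_vertex w = fst (SOME vn. fst vn \<in> V \<and> w = tr (snd vn) (\<iota> (fst vn)))"

definition orbit_index :: "'w \<Rightarrow> 'd \<Rightarrow> int" where
  "orbit_index w = snd (SOME vn. fst vn \<in> V \<and> w = tr (snd vn) (\<iota> (fst vn)))"

lemma orbit_vertex_index:
  assumes "w \<in> W"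
  shows "orbit_vertex w \<in> V" "tr (orbit_index w) (\<iota> (orbit_vertex w)) = w"
proof -
  obtain v n where "v \<in> V" "w = tr n (\<iota> v)" using assms by (rule vertex_cover)
  then have "\<exists>vn. fst vn \<in> V \<and> w = tr (snd vn) (\<iota> (fst vn))" by (intro exI[of _ "(v, n)"]) simp
  from someI_ex[OF this] show "orbit_vertex w \<in> V" "tr (orbit_index w) (\<iota> (orbit_vertex w)) = w"
    by (simp_all add: orbit_vertex_def orbit_index_def)
qed

definition extend :: "('v \<Rightarrow> real ^ 'd) \<Rightarrow> ('w \<Rightarrow> real ^ 'd) \<times> (('w \<Rightarrow> 'w) \<Rightarrow> real ^ 'd)" where
  "extend s = (\<lambda>w\<in>W. s (orbit_vertex w) + periods s (orbit_index w), \<lambda>\<gamma>\<in>\<Gamma>. periods s (inv_into UNIV tr \<gamma>))"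

lemma snd_extend: "snd (extend s) (tr n) = periods s n"
  by (simp add: extend_def inv_into_f_f inj_def tr_inj)

text \<open>
  Two descriptions of the same vertex differ by a displacement, and a displacement has the required
  effect on every placement, not only on \<open>p\<close>.
\<close>

lemma fst_extend:
  assumes "v \<in> V"
  shows "fst (extend s) (tr n (\<iota> v)) = s v + periods s n"
proof -
  let ?w = "tr n (\<iota> v)"
  have w: "?w \<in> W" using assms \<iota>_W by simp
  have "marked_displacement a b (orbit_vertex ?w) v (\<lambda>k. orbit_index ?w k - n k)"
    using orbit_vertex_index[OF w] tr_eq_iff[OF orbit_vertex_index(1)[OF w] assms] by simp
  from marked_displacementD[OF this, of s]
  have "s v - s (orbit_vertex ?w) = periods s (orbit_index ?w) - periods s n" by (simp add: lattice_point_diff)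
  then show ?thesis using w by (simp add: extend_def algebra_simps)
qed

text \<open>
  Every edge of the framework is a translate of an edge of the linkage, and the extension has the same
  length on both.
\<close>

lemma extend_realization:
  assumes s: "s \<in> spanning_realizations"
  shows "extend s \<in> framework_realizations W F \<Gamma> q"
proof -
  define r \<rho> where "r = fst (extend s)" and "\<rho> = snd (extend s)"
  have \<rho>: "\<rho> (tr n) = periods s n" for n by (simp add: \<rho>_def snd_extend)
  have r: "r (tr n (\<iota> v)) = s v + periods s n" if "v \<in> V" for v n
    using that by (simp add: r_def fst_extend)
  have bs: "is_basis (marked_vector s a b)" and len: "same_edge_lengths E p s"
    using s by (auto simp: spanning_realizations_def linkage_realizations_def)
  have dist: "dist (r x) (r y) = dist (q x) (q y) \<and> q x \<noteq> q y" if xy: "{x, y} \<in> F" for x y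
  proof -
    obtain u v n where uv: "{u, v} \<in> E" "x = tr n (\<iota> u)" "y = tr n (\<iota> v)" "u \<in> V" "v \<in> V"
      using xy by (rule edge_endpoints)
    then show ?thesis
      using len nondegenerate[OF uv(1)] by (simp add: r q_tr same_edge_lengths_def)
  qed
  have "periodic_placement W F \<Gamma> r \<rho>"
    unfolding periodic_placement_def
  proof (intro conjI ballI allI impI)
    fix \<gamma> \<delta> assume "\<gamma> \<in> \<Gamma>" "\<delta> \<in> \<Gamma>"
    then show "\<rho> (\<gamma> \<otimes>\<^bsub>BijGroup W\<^esub> \<delta>) = \<rho> \<gamma> + \<rho> \<delta>"
      by (elim \<Gamma>_cases) (simp add: compose_tr \<rho> lattice_point_add)
  next
    show "inj_on \<rho> \<Gamma>"
    proof (rule inj_onI)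
      fix \<gamma> \<delta> assume "\<gamma> \<in> \<Gamma>" "\<delta> \<in> \<Gamma>" and eq: "\<rho> \<gamma> = \<rho> \<delta>"
      then obtain n m where nm: "\<gamma> = tr n" "\<delta> = tr m" by (elim \<Gamma>_cases)
      then have "n = m" using eq by (intro lattice_point_inj[OF bs]) (simp add: \<rho>)
      with nm show "\<gamma> = \<delta>" by simp
    qed
  next
    have "\<rho> ` \<Gamma> = range (\<lambda>n. \<rho> (tr n))" using \<Gamma>_image[of \<rho>] by (simp only: Setcompr_eq_image)
    then show "\<exists>b. is_basis b \<and> \<rho> ` \<Gamma> = lattice_of b"
      using bs by (auto simp: \<rho> lattice_of_eq_range)
  next
    fix \<gamma> w assume "\<gamma> \<in> \<Gamma>" and w: "w \<in> W"
    then obtain m where \<gamma>: "\<gamma> = tr m" by (elim \<Gamma>_cases)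
    obtain v n where v: "v \<in> V" "w = tr n (\<iota> v)" using w by (rule vertex_cover)
    show "r (\<gamma> w) = r w + \<rho> \<gamma>"
      using v \<iota>_W by (simp add: \<gamma> tr_tr r \<rho> lattice_point_add)
  next
    fix x y assume "{x, y} \<in> F"
    then show "r x \<noteq> r y" using dist by (metis dist_eq_0_iff)
  qed
  moreover have "same_edge_lengths F q r" using dist by (simp add: same_edge_lengths_def)
  moreover have "r \<in> extensional W" "\<rho> \<in> extensional \<Gamma>" by (simp_all add: r_def \<rho>_def extend_def)
  ultimately have "(r, \<rho>) \<in> framework_realizations W F \<Gamma> q"
    by (simp add: framework_realizations_def)
  then show ?thesis by (simp add: r_def \<rho>_def)
qed

lemma marked_vector_restrict: "marked_vector (restrict s V) a b = marked_vector s a b"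
  using marked by (auto simp: marked_vector_def)

lemma restriction_spanning:
  assumes "x \<in> framework_realizations W F \<Gamma> q"
  shows "restriction x \<in> spanning_realizations"
proof -
  obtain r \<rho> where x: "x = (r, \<rho>)" by (cases x)
  have pl: "periodic_placement W F \<Gamma> r \<rho>" and len: "same_edge_lengths F q r"
    using assms by (auto simp: x framework_realizations_def)
  have "is_basis (marked_vector (restriction x) a b)"
    using periodic_placement_determined(3)[OF pl] by (simp add: restriction_def x marked_vector_restrict)
  moreover have "same_edge_lengths E p (restriction x)"
    unfolding same_edge_lengths_def
  proof (intro allI impI)
    fix u v assume uv: "{u, v} \<in> E"
    then have "u \<in> V" "v \<in> V" "{\<iota> u, \<iota> v} \<in> F" using edge_subset[OF uv] \<iota>_F[OF uv] by auto
    then show "dist (restriction x u) (restriction x v) = dist (p u) (p v)"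
      using len by (simp add: restriction_def x same_edge_lengths_def q_\<iota>)
  qed
  ultimately show ?thesis by (simp add: spanning_realizations_def linkage_realizations_def restriction_def)
qed

lemma restriction_extend:
  assumes "s \<in> spanning_realizations"
  shows "restriction (extend s) = s"
proof (rule extensionalityI[of _ V])
  show "restriction (extend s) \<in> extensional V" by (simp add: restriction_def)
  show "s \<in> extensional V" using assms by (simp add: spanning_realizations_def linkage_realizations_def)
  fix v assume v: "v \<in> V"
  then show "restriction (extend s) v = s v"
    using fst_extend[OF v, of s "\<lambda>_. 0"] tr_zero \<iota>_W by (simp add: restriction_def)
qed

lemma extend_restriction:
  assumes "x \<in> framework_realizations W F \<Gamma> q"
  shows "extend (restriction x) = x"
proof -
  obtain r \<rho> where x: "x = (r, \<rho>)" by (cases x)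
  have pl: "periodic_placement W F \<Gamma> r \<rho>" and ext: "r \<in> extensional W" "\<rho> \<in> extensional \<Gamma>"
    using assms by (auto simp: x framework_realizations_def)
  have per: "periods (restriction x) n = periods (r \<circ> \<iota>) n" for n
    by (simp add: restriction_def x marked_vector_restrict)
  have "fst (extend (restriction x)) = r"
  proof (rule extensionalityI[of _ W])
    fix w assume "w \<in> W"
    then obtain v n where v: "v \<in> V" "w = tr n (\<iota> v)" by (rule vertex_cover)
    have "restriction x v = r (\<iota> v)" using v by (simp add: restriction_def x)
    then show "fst (extend (restriction x)) w = r w"
      using v periodic_placement_determined(2)[OF pl v(1)] by (simp add: fst_extend per)
  qed (simp_all add: ext extend_def)
  moreover have "snd (extend (restriction x)) = \<rho>"
  proof (rule extensionalityI[of _ \<Gamma>])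
    fix \<gamma> assume "\<gamma> \<in> \<Gamma>"
    then obtain n where "\<gamma> = tr n" by (rule \<Gamma>_cases)
    then show "snd (extend (restriction x)) \<gamma> = \<rho> \<gamma>"
      using periodic_placement_determined(1)[OF pl] by (simp add: snd_extend per)
  qed (simp_all add: ext extend_def)
  ultimately show ?thesis by (simp add: x prod_eq_iff)
qed

lemma restriction_homeomorphic:
  "homeomorphic_map (framework_realization_space W F \<Gamma> q) (subtopology (linkage_realization_space V E p) spanning_realizations) restriction"
proof (rule homeomorphic_maps_imp_map)
  let ?P = "prod_topology (placement_space W :: ('w \<Rightarrow> real ^ 'd) topology) (product_topology (\<lambda>_. euclidean) \<Gamma>)"
  have spanning_sub: "spanning_realizations \<subseteq> linkage_realizations V E p" by (auto simp: spanning_realizations_def)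
  have sub: "subtopology (linkage_realization_space V E p) spanning_realizations = subtopology (placement_space V) spanning_realizations"
    by (simp add: linkage_realization_space_def subtopology_subtopology Int_absorb1[OF spanning_sub])
  show "homeomorphic_maps (framework_realization_space W F \<Gamma> q) (subtopology (linkage_realization_space V E p) spanning_realizations) restriction extend"
    unfolding homeomorphic_maps_def
  proof (intro conjI ballI)
    have "continuous_map ?P (placement_space V) restriction"
      unfolding continuous_map_componentwise
    proof (intro conjI ballI)
      fix v assume v: "v \<in> V"
      have "continuous_map ?P euclidean ((\<lambda>r. r (\<iota> v)) \<circ> fst)"
        by (rule continuous_map_compose[OF continuous_map_fst continuous_map_placement[OF \<iota>_W[OF v]]])
      then show "continuous_map ?P euclidean (\<lambda>x. restriction x v)"
        using v by (simp add: restriction_def o_def)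
    qed (auto simp: restriction_def)
    then show "continuous_map (framework_realization_space W F \<Gamma> q) (subtopology (linkage_realization_space V E p) spanning_realizations) restriction"
      unfolding sub continuous_map_in_subtopology
      using restriction_spanning by (auto simp: framework_realization_space_def intro: continuous_map_from_subtopology)
    have per: "continuous_map (placement_space V) euclidean (\<lambda>s :: 'v \<Rightarrow> real ^ 'd. periods s n)" for n
      unfolding continuous_map_atin lattice_point_def marked_vector_def
      using marked by (auto simp: PiE_def intro!: tendsto_sum tendsto_scaleR tendsto_diff tendsto_const tendsto_placement)
    have "continuous_map (placement_space V) (placement_space W) (\<lambda>s. fst (extend s))"
      unfolding continuous_map_componentwise
    proof (intro conjI ballI)
      fix w assume w: "w \<in> W"
      have "continuous_map (placement_space V) euclidean (\<lambda>s :: 'v \<Rightarrow> real ^ 'd. s (orbit_vertex w) + periods s (orbit_index w))"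
        using continuous_map_placement[OF orbit_vertex_index(1)[OF w]] per by (rule continuous_map_add)
      then show "continuous_map (placement_space V) euclidean (\<lambda>s. fst (extend s) w)"
        using w by (simp add: extend_def)
    qed (auto simp: extend_def)
    moreover have "continuous_map (placement_space V) (product_topology (\<lambda>_. euclidean) \<Gamma>) (\<lambda>s. snd (extend s))"
      unfolding continuous_map_componentwise
    proof (intro conjI ballI)
      fix \<gamma> assume "\<gamma> \<in> \<Gamma>"
      then show "continuous_map (placement_space V) euclidean (\<lambda>s. snd (extend s) \<gamma>)"
        using per by (simp add: extend_def)
    qed (auto simp: extend_def)
    ultimately have "continuous_map (placement_space V) ?P (\<lambda>s. (fst (extend s), snd (extend s)))"
      by (simp add: continuous_map_pairwise o_def)
    then show "continuous_map (subtopology (linkage_realization_space V E p) spanning_realizations) (framework_realization_space W F \<Gamma> q) extend"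
      unfolding sub framework_realization_space_def continuous_map_in_subtopology
      using extend_realization by (auto intro: continuous_map_from_subtopology)
    show "extend (restriction x) = x" if "x \<in> topspace (framework_realization_space W F \<Gamma> q)" for x
      using that by (simp add: extend_restriction)
    show "restriction (extend s) = s" if "s \<in> topspace (subtopology (linkage_realization_space V E p) spanning_realizations)" for s
      using that by (simp add: restriction_extend)
  qed
qed

text \<open>
  An isometry that relates the restrictions also relates the translation vectors, through its linear
  part, and hence the extensions.
\<close>

lemma restriction_congruence:
  assumes x: "x \<in> framework_realizations W F \<Gamma> q" and y: "y \<in> framework_realizations W F \<Gamma> q"
  shows "(x, y) \<in> framework_congruence W F \<Gamma> q \<longleftrightarrow> (restriction x, restriction y) \<in> linkage_congruence V E p"
proof
  assume "(x, y) \<in> framework_congruence W F \<Gamma> q"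
  then obtain g where g: "euclidean_isometry g" "fst y = (\<lambda>w\<in>W. g (fst x w))"
    by (auto simp: framework_congruence_def)
  have "restriction y = (\<lambda>v\<in>V. g (restriction x v))"
    using \<iota>_W by (auto simp: restriction_def g(2))
  then show "(restriction x, restriction y) \<in> linkage_congruence V E p"
    using g(1) restriction_spanning[OF x] restriction_spanning[OF y] by (auto simp: linkage_congruence_def spanning_realizations_def)
next
  assume "(restriction x, restriction y) \<in> linkage_congruence V E p"
  then obtain g where g: "euclidean_isometry g" "restriction y = (\<lambda>v\<in>V. g (restriction x v))"
    by (auto simp: linkage_congruence_def)
  obtain h where h: "orthogonal_transformation h" and gh: "\<And>z. g z = h z + g 0"
    using euclidean_isometry_affine[OF g(1)] by blast
  have lin: "linear h" using h by (rule orthogonal_transformation_linear)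
  have "marked_vector (restriction y) a b k = h (marked_vector (restriction x) a b k)" for k
    using marked[of k] gh[of "restriction x (b k)"] gh[of "restriction x (a k)"]
    by (simp add: marked_vector_def g(2) linear_diff[OF lin])
  then have mv: "marked_vector (restriction y) a b = (\<lambda>k. h (marked_vector (restriction x) a b k))" by auto
  have per: "periods (restriction y) n = h (periods (restriction x) n)" for n
    by (simp add: mv lattice_point_linear[OF lin])
  have "fst y = (\<lambda>w\<in>W. g (fst x w))"
  proof (rule extensionalityI[of _ W])
    fix w assume w: "w \<in> W"
    then obtain v n where v: "v \<in> V" "w = tr n (\<iota> v)" by (rule vertex_cover)
    have "restriction y v = g (restriction x v)" using v(1) by (simp add: g(2))
    then have "fst y w = g (restriction x v) + h (periods (restriction x) n)"
      using v(2) fst_extend[OF v(1), of "restriction y" n] by (simp add: extend_restriction[OF y] per)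
    also have "\<dots> = g (restriction x v + periods (restriction x) n)"
      using gh[of "restriction x v"] gh[of "restriction x v + periods (restriction x) n"] by (simp add: linear_add[OF lin])
    also have "\<dots> = g (fst x w)"
      using v fst_extend[OF v(1), of "restriction x" n] by (simp add: extend_restriction[OF x])
    finally show "fst y w = (\<lambda>w\<in>W. g (fst x w)) w" using w by simp
  qed (use y in \<open>auto simp: framework_realizations_def\<close>)
  moreover have "snd y = (\<lambda>\<gamma>\<in>\<Gamma>. g (snd x \<gamma>) - g 0)"
  proof (rule extensionalityI[of _ \<Gamma>])
    fix \<gamma> assume \<gamma>: "\<gamma> \<in> \<Gamma>"
    then obtain n where n: "\<gamma> = tr n" by (rule \<Gamma>_cases)
    have "snd y \<gamma> = h (periods (restriction x) n)"
      using snd_extend[of "restriction y" n] by (simp add: extend_restriction[OF y] per n)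
    also have "periods (restriction x) n = snd x \<gamma>"
      using snd_extend[of "restriction x" n] by (simp add: extend_restriction[OF x] n)
    finally show "snd y \<gamma> = (\<lambda>\<gamma>\<in>\<Gamma>. g (snd x \<gamma>) - g 0) \<gamma>"
      using \<gamma> gh[of "snd x \<gamma>"] by simp
  qed (use y in \<open>auto simp: framework_realizations_def\<close>)
  ultimately show "(x, y) \<in> framework_congruence W F \<Gamma> q"
    using x y g(1) by (cases x, cases y) (auto simp: framework_congruence_def)
qed

text \<open>
  Being a basis is expressed by a determinant, which is continuous.
\<close>

lemma spanning_realizations_open: "openin (linkage_realization_space V E p) spanning_realizations"
proof -
  have "continuous_map (placement_space V) euclideanreal (\<lambda>s :: 'v \<Rightarrow> real ^ 'd. det (\<chi> k. marked_vector s a b k))"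
    unfolding continuous_map_atin det_def marked_vector_def
    using marked by (auto simp: PiE_def intro!: tendsto_sum tendsto_mult tendsto_prod tendsto_const
        tendsto_vec_nth tendsto_diff tendsto_placement)
  then have "openin (placement_space V) {s \<in> topspace (placement_space V). det (\<chi> k. marked_vector s a b k) \<in> - {0}}"
    by (rule openin_continuous_map_preimage) (simp add: open_Compl)
  moreover have "spanning_realizations = linkage_realizations V E p \<inter>
      {s \<in> topspace (placement_space V). det (\<chi> k. marked_vector s a b k) \<in> - {0}}"
    by (auto simp: spanning_realizations_def is_basis_iff_det linkage_realizations_def PiE_def)
  ultimately show ?thesis
    unfolding linkage_realization_space_def openin_subtopology by blast
qed

lemma spanning_realizations_saturated:
  assumes "(x, y) \<in> linkage_congruence V E p" "x \<in> spanning_realizations"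
  shows "y \<in> spanning_realizations"
proof -
  obtain g where g: "euclidean_isometry g" "y = (\<lambda>v\<in>V. g (x v))" "y \<in> linkage_realizations V E p"
    using assms(1) by (auto simp: linkage_congruence_def)
  obtain h where h: "orthogonal_transformation h" and gh: "\<And>z. g z = h z + g 0"
    using euclidean_isometry_affine[OF g(1)] by blast
  have "marked_vector y a b k = h (marked_vector x a b k)" for k
    using marked[of k] gh[of "x (b k)"] gh[of "x (a k)"]
    by (simp add: marked_vector_def g(2) linear_diff[OF orthogonal_transformation_linear[OF h]])
  then have "marked_vector y a b = (\<lambda>k. h (marked_vector x a b k))" by auto
  then show ?thesis
    using is_basis_orthogonal_transformation[OF _ h] assms(2) g(3) by (simp add: spanning_realizations_def)
qed

lemma base_realization: "(restrict q W, restrict \<pi> \<Gamma>) \<in> framework_realizations W F \<Gamma> q"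
proof -
  have FW: "x \<in> W \<and> y \<in> W" if "{x, y} \<in> F" for x y
    using F_simple that by (auto simp: simple_graph_def)
  have "\<gamma> \<otimes>\<^bsub>BijGroup W\<^esub> \<delta> \<in> \<Gamma>" if "\<gamma> \<in> \<Gamma>" "\<delta> \<in> \<Gamma>" for \<gamma> \<delta>
    using that by (simp add: mult_eq compose_\<Gamma>)
  moreover have "restrict \<pi> \<Gamma> ` \<Gamma> = \<pi> ` \<Gamma>" by auto
  ultimately have "periodic_placement W F \<Gamma> (restrict q W) (restrict \<pi> \<Gamma>)"
    using placement FW \<Gamma>_closed by (auto simp: periodic_placement_def inj_on_def)
  then show ?thesis
    using FW by (auto simp: framework_realizations_def same_edge_lengths_def)
qed

lemma deformation_spaces:
  fixes h
  defines "h \<equiv> \<lambda>C. restriction ` C"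
    and "U' \<equiv> (\<lambda>s. linkage_congruence V E p `` {s}) ` spanning_realizations"
  shows "openin (linkage_deformation_space V E p) U'"
    and "homeomorphic_map (framework_deformation_space W F \<Gamma> q) (subtopology (linkage_deformation_space V E p) U') h"
    and "(r, \<rho>) \<in> framework_realizations W F \<Gamma> q \<Longrightarrow>
      h (framework_class W F \<Gamma> q r \<rho>) = linkage_class V E p (r \<circ> \<iota>)"
    and "framework_class W F \<Gamma> q q \<pi> \<in> topspace (framework_deformation_space W F \<Gamma> q)"
    and "h (framework_class W F \<Gamma> q q \<pi>) = linkage_class V E p p"
    and "linkage_class V E p p \<in> U'"
proof -
  let ?TF = "framework_realization_space W F \<Gamma> q" and ?TL = "linkage_realization_space V E p"
  have eqF: "equiv (topspace ?TF) (framework_congruence W F \<Gamma> q)"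
    and eqL: "equiv (topspace ?TL) (linkage_congruence V E p)"
    by (simp_all add: equiv_framework_congruence equiv_linkage_congruence)
  have iff: "(x, y) \<in> framework_congruence W F \<Gamma> q \<longleftrightarrow> (restriction x, restriction y) \<in> linkage_congruence V E p"
    if "x \<in> topspace ?TF" "y \<in> topspace ?TF" for x y
    using that by (simp add: restriction_congruence)
  note emb = quotient_open_embedding[OF eqF eqL spanning_realizations_open spanning_realizations_saturated restriction_homeomorphic iff]
  show "openin (linkage_deformation_space V E p) U'"
    unfolding U'_def linkage_deformation_space_def
    by (rule open_saturated_classes(1)[OF eqL spanning_realizations_open spanning_realizations_saturated])
  show "homeomorphic_map (framework_deformation_space W F \<Gamma> q) (subtopology (linkage_deformation_space V E p) U') h"
    unfolding U'_def h_def linkage_deformation_space_def framework_deformation_space_def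
    by (rule emb(2))
  have cls: "h (framework_congruence W F \<Gamma> q `` {x}) = linkage_congruence V E p `` {restriction x}"
    if "x \<in> framework_realizations W F \<Gamma> q" for x
    unfolding h_def using emb(1) that by simp
  show "h (framework_class W F \<Gamma> q r \<rho>) = linkage_class V E p (r \<circ> \<iota>)"
    if "(r, \<rho>) \<in> framework_realizations W F \<Gamma> q"
  proof -
    have "restrict r W = r" "restrict \<rho> \<Gamma> = \<rho>"
      using that by (auto simp: framework_realizations_def extensional_restrict)
    then show ?thesis
      using cls[OF that] by (simp add: framework_class_def linkage_class_def restriction_def)
  qed
  have restriction_base: "restriction (restrict q W, restrict \<pi> \<Gamma>) = restrict p V"
    using \<iota>_W q_\<iota> by (auto simp: restriction_def)
  show "h (framework_class W F \<Gamma> q q \<pi>) = linkage_class V E p p"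
    using cls[OF base_realization] by (simp add: framework_class_def linkage_class_def restriction_base)
  show "framework_class W F \<Gamma> q q \<pi> \<in> topspace (framework_deformation_space W F \<Gamma> q)"
    unfolding framework_deformation_space_def topspace_quotient_topology[OF eqF] framework_class_def
    using base_realization by (intro quotientI) simp
  show "linkage_class V E p p \<in> U'"
    using restriction_spanning[OF base_realization] by (auto simp: U'_def linkage_class_def restriction_base)
qed

lemma deformation_spaces_identified: "local_deformation_spaces_identified V E p W F \<Gamma> q \<pi> \<iota>"
  unfolding local_deformation_spaces_identified_def
  using deformation_spaces
  by (intro exI[of _ "topspace (framework_deformation_space W F \<Gamma> q)"]
      exI[of _ "(\<lambda>s. linkage_congruence V E p `` {s}) ` spanning_realizations"] exI[of _ "\<lambda>C. restriction ` C"])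
    (auto simp: subtopology_topspace)

lemma framework_local_dimension:
  assumes "has_local_dimension (linkage_deformation_space V E p) (linkage_class V E p p) f"
  shows "has_local_dimension (framework_deformation_space W F \<Gamma> q) (framework_class W F \<Gamma> q q \<pi>) f"
proof (rule has_local_dimension_homeomorphic)
  show "has_local_dimension (linkage_deformation_space V E p) ((\<lambda>C. restriction ` C) (framework_class W F \<Gamma> q q \<pi>)) f"
    using assms deformation_spaces(5) by simp
  show "homeomorphic_map (subtopology (framework_deformation_space W F \<Gamma> q) (topspace (framework_deformation_space W F \<Gamma> q)))
     (subtopology (linkage_deformation_space V E p) ((\<lambda>s. linkage_congruence V E p `` {s}) ` spanning_realizations)) (\<lambda>C. restriction ` C)"
    using deformation_spaces(2) by (simp add: subtopology_topspace)
qed (use deformation_spaces(1,4) in auto)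

end


section \<open>Construction of the associated framework\<close>

context marked_linkage
begin

text \<open>
  The model of the framework uses one representative for each class of vertices that have to be glued.
  The vertex \<open>(class_rep v, l)\<close> is the translate by \<open>l\<close> of the representative, placed at
  \<open>p (class_rep v) + l\<close>, and \<open>v\<close> itself becomes the translate by \<open>p v - p (class_rep v)\<close>, which is a
  lattice vector.
\<close>

definition class_rep :: "'v \<Rightarrow> 'v" where
  "class_rep v = (SOME u. marked_equiv a b v u)"

lemma class_rep_equiv: "marked_equiv a b v (class_rep v)"
  unfolding class_rep_def by (rule someI[of _ v]) simp

lemma class_rep_eq_iff: "class_rep u = class_rep v \<longleftrightarrow> marked_equiv a b u v"
proof
  assume "class_rep u = class_rep v"
  then show "marked_equiv a b u v"
    using class_rep_equiv[of u] marked_equiv_sym[OF class_rep_equiv[of v]] marked_equiv_trans by metis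
next
  assume uv: "marked_equiv a b u v"
  have "marked_equiv a b u = marked_equiv a b v"
    using marked_equiv_trans[OF uv] marked_equiv_trans[OF marked_equiv_sym[OF uv]] by blast
  then show "class_rep u = class_rep v" by (simp add: class_rep_def)
qed

lemma class_rep_displacement: "\<exists>n. p v - p (class_rep v) = period n"
proof -
  obtain n where n: "marked_displacement a b (class_rep v) v n"
    using marked_equiv_sym[OF class_rep_equiv[of v]] by (auto simp: marked_equiv_iff_displacement)
  show ?thesis by (rule exI, rule marked_displacementD[OF n])
qed

definition verts :: "('v \<times> (real ^ 'd)) set" where
  "verts = {(class_rep v, period n) |v n. v \<in> V}"

definition emb :: "'v \<Rightarrow> 'v \<times> (real ^ 'd)" where
  "emb v = (class_rep v, p v - p (class_rep v))"

definition shift :: "('d \<Rightarrow> int) \<Rightarrow> 'v \<times> (real ^ 'd) \<Rightarrow> 'v \<times> (real ^ 'd)" where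
  "shift n = (\<lambda>w\<in>verts. (fst w, snd w + period n))"

definition edges :: "('v \<times> (real ^ 'd)) set set" where
  "edges = {shift n ` emb ` e |n e. e \<in> E}"

definition pos :: "'v \<times> (real ^ 'd) \<Rightarrow> real ^ 'd" where
  "pos w = p (fst w) + snd w"

definition translation_vector :: "('v \<times> (real ^ 'd) \<Rightarrow> 'v \<times> (real ^ 'd)) \<Rightarrow> real ^ 'd" where
  "translation_vector \<gamma> = period (inv_into UNIV shift \<gamma>)"

lemma emb_verts [simp]: "v \<in> V \<Longrightarrow> emb v \<in> verts"
  using class_rep_displacement[of v] by (auto simp: emb_def verts_def)

lemma shift_verts [simp]: "w \<in> verts \<Longrightarrow> shift n w \<in> verts"
proof -
  assume w: "w \<in> verts"
  then obtain v m where "v \<in> V" "w = (class_rep v, period m)" by (auto simp: verts_def)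
  then have "shift n w = (class_rep v, period (\<lambda>k. m k + n k))" "v \<in> V"
    using w by (simp_all add: shift_def lattice_point_add)
  then show ?thesis unfolding verts_def by blast
qed

lemma shift_shift: "w \<in> verts \<Longrightarrow> shift n (shift m w) = shift (\<lambda>k. n k + m k) w"
  using shift_verts[of w m] by (auto simp: shift_def lattice_point_add)

lemma shift_zero [simp]: "w \<in> verts \<Longrightarrow> shift (\<lambda>_. 0) w = w"
  by (simp add: shift_def)

lemma shift_inverse: "w \<in> verts \<Longrightarrow> shift (\<lambda>k. - n k) (shift n w) = w" "w \<in> verts \<Longrightarrow> shift n (shift (\<lambda>k. - n k) w) = w"
  by (simp_all add: shift_shift)

lemma shift_free: "w \<in> verts \<Longrightarrow> shift n w = shift m w \<Longrightarrow> n = m"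
  by (rule lattice_point_inj[OF basis]) (simp add: shift_def)

lemma base_vertex: "emb (a k) \<in> verts"
  using marked by simp

lemma shift_inj: "shift n = shift m \<Longrightarrow> n = m"
  using shift_free[OF base_vertex] by metis

lemma translation_vector_shift [simp]: "translation_vector (shift n) = period n"
  by (simp add: translation_vector_def inv_into_f_f inj_def shift_inj)

lemma pos_shift: "w \<in> verts \<Longrightarrow> pos (shift n w) = pos w + period n"
  by (simp add: pos_def shift_def)

lemma pos_emb: "pos (emb v) = p v"
  by (simp add: pos_def emb_def)

text \<open>
  The counterpart of \<open>tr_\<iota>_iff\<close> for the model.
\<close>

lemma shift_emb_iff:
  assumes uv: "u \<in> V" "v \<in> V"
  shows "shift n (emb u) = emb v \<longleftrightarrow> marked_displacement a b u v n"
proof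
  assume eq: "shift n (emb u) = emb v"
  then have "p v - p u = period n"
    using pos_shift[of "emb u" n] uv by (simp add: pos_emb)
  moreover have "(fst (emb u), snd (emb u) + period n) = emb v"
    using eq emb_verts[OF uv(1)] by (simp add: shift_def)
  then have "class_rep u = class_rep v" by (simp add: emb_def)
  then obtain m where "marked_displacement a b u v m"
    by (auto simp: class_rep_eq_iff marked_equiv_iff_displacement)
  ultimately show "marked_displacement a b u v n"
    using marked_displacement_unique[OF basis] by blast
next
  assume n: "marked_displacement a b u v n"
  then have "class_rep u = class_rep v" by (auto simp: class_rep_eq_iff marked_equiv_iff_displacement)
  moreover have "p v - p u = period n" using n by (rule marked_displacementD)
  ultimately show "shift n (emb u) = emb v"
    using uv by (simp add: shift_def) (simp add: emb_def algebra_simps)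
qed

lemma verts_cover:
  assumes "w \<in> verts"
  obtains v n where "v \<in> V" "w = shift n (emb v)"
proof -
  obtain v m where v: "v \<in> V" "w = (class_rep v, period m)" using assms by (auto simp: verts_def)
  obtain k where k: "p v - p (class_rep v) = period k" using class_rep_displacement by blast
  have "w = shift (\<lambda>i. m i - k i) (emb v)"
    using v emb_verts[OF v(1)] by (simp add: shift_def) (simp add: emb_def k lattice_point_diff)
  then show ?thesis using that v(1) by blast
qed

lemma compose_shift: "compose verts (shift n) (shift m) = shift (\<lambda>k. n k + m k)"
  by (rule extensionalityI[of _ verts]) (simp_all add: compose_eq shift_shift, simp add: shift_def)

lemma shift_Bij: "shift n \<in> Bij verts"
proof -
  have "bij_betw (shift n) verts verts"
    by (rule bij_betw_byWitness[where f' = "shift (\<lambda>k. - n k)"]) (auto simp: shift_inverse)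
  then show ?thesis by (simp add: Bij_def shift_def)
qed

lemma mult_shift: "shift n \<otimes>\<^bsub>BijGroup verts\<^esub> shift m = shift (\<lambda>k. n k + m k)"
  by (simp add: BijGroup_def shift_Bij compose_shift)

lemma one_shift: "\<one>\<^bsub>BijGroup verts\<^esub> = shift (\<lambda>_. 0)"
  by (simp add: BijGroup_def shift_def)

lemma shift_subgroup: "subgroup (range shift) (BijGroup verts)"
proof (rule group.subgroupI[OF group_BijGroup])
  show "range shift \<subseteq> carrier (BijGroup verts)"
    using shift_Bij by (auto simp: BijGroup_def)
  show "x \<otimes>\<^bsub>BijGroup verts\<^esub> y \<in> range shift" if "x \<in> range shift" "y \<in> range shift" for x y
    using that mult_shift by auto
  show "m_inv (BijGroup verts) x \<in> range shift" if x: "x \<in> range shift" for x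
  proof -
    obtain n where n: "x = shift n" using x by blast
    have "m_inv (BijGroup verts) x = shift (\<lambda>k. - n k)"
      by (rule group.inv_equality[OF group_BijGroup])
        (use shift_Bij in \<open>simp_all add: n mult_shift one_shift, simp_all add: BijGroup_def\<close>)
    then show ?thesis by blast
  qed
qed blast

lemma shift_group_free: "perm_group verts (range shift) \<cong> free_Abelian_group {..<CARD('d)}"
proof -
  obtain \<beta> :: "nat \<Rightarrow> 'd" where \<beta>: "bij_betw \<beta> {0..<CARD('d)} UNIV"
    using ex_bij_betw_nat_finite[of "UNIV :: 'd set"] by auto
  define \<delta> where "\<delta> = inv_into {0..<CARD('d)} \<beta>"
  have \<delta>: "\<delta> k < CARD('d)" "\<beta> (\<delta> k) = k" for k
    using \<beta> bij_betw_imp_surj_on[OF \<beta>] inv_into_into[of k \<beta> "{0..<CARD('d)}"]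
      f_inv_into_f[of k \<beta> "{0..<CARD('d)}"] by (auto simp: \<delta>_def)
  have \<delta>\<beta>: "\<delta> (\<beta> i) = i" if "i < CARD('d)" for i
    using that bij_betw_inv_into_left[OF \<beta>] by (simp add: \<delta>_def)
  define h where "h c = shift (\<lambda>k. poly_mapping.lookup c (\<delta> k))" for c :: "nat \<Rightarrow>\<^sub>0 int"
  have "h \<in> iso (free_Abelian_group {..<CARD('d)}) (perm_group verts (range shift))"
    unfolding iso_def
  proof (intro CollectI conjI)
    show "h \<in> hom (free_Abelian_group {..<CARD('d)}) (perm_group verts (range shift))"
      by (rule homI) (simp_all add: h_def mult_shift lookup_add)
    show "bij_betw h (carrier (free_Abelian_group {..<CARD('d)})) (carrier (perm_group verts (range shift)))"
      unfolding bij_betw_def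
    proof
      show "inj_on h (carrier (free_Abelian_group {..<CARD('d)}))"
      proof (rule inj_onI)
        fix c c' assume c: "c \<in> carrier (free_Abelian_group {..<CARD('d)})" "c' \<in> carrier (free_Abelian_group {..<CARD('d)})"
          and eq: "h c = h c'"
        have eq': "poly_mapping.lookup c (\<delta> k) = poly_mapping.lookup c' (\<delta> k)" for k
          using shift_inj eq by (auto simp: h_def dest!: shift_inj fun_cong[where x = k])
        show "c = c'"
        proof (rule poly_mapping_eqI)
          fix i
          show "poly_mapping.lookup c i = poly_mapping.lookup c' i"
          proof (cases "i < CARD('d)")
            case True
            then show ?thesis using eq'[of "\<beta> i"] by (simp add: \<delta>\<beta>)
          next
            case False
            then have "i \<notin> Poly_Mapping.keys c" "i \<notin> Poly_Mapping.keys c'" using c by auto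
            then show ?thesis by (simp add: in_keys_iff)
          qed
        qed
      qed
      show "h ` carrier (free_Abelian_group {..<CARD('d)}) = carrier (perm_group verts (range shift))"
      proof (intro equalityI subsetI)
        fix x assume "x \<in> carrier (perm_group verts (range shift))"
        then obtain n where n: "x = shift n" by auto
        define c where "c = Abs_poly_mapping (\<lambda>i. if i < CARD('d) then n (\<beta> i) else 0)"
        have look: "poly_mapping.lookup c = (\<lambda>i. if i < CARD('d) then n (\<beta> i) else 0)"
          unfolding c_def by (rule lookup_Abs_poly_mapping) (rule finite_subset[of _ "{..<CARD('d)}"], auto)
        have "c \<in> carrier (free_Abelian_group {..<CARD('d)})"
          by (auto simp: in_keys_iff look split: if_splits)
        moreover have "x = h c" by (simp add: h_def n look \<delta>)
        ultimately show "x \<in> h ` carrier (free_Abelian_group {..<CARD('d)})" by blast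
      qed (auto simp: h_def)
    qed
  qed
  then have "free_Abelian_group {..<CARD('d)} \<cong> perm_group verts (range shift)"
    by (auto simp: is_iso_def)
  then show ?thesis
    by (rule group.iso_sym[OF group_free_Abelian_group])
qed

lemma shift_image_shift: "e \<subseteq> verts \<Longrightarrow> shift n ` shift m ` e = shift (\<lambda>k. n k + m k) ` e"
  unfolding image_image by (intro image_cong refl shift_shift) blast

lemma emb_image_verts: "e \<in> E \<Longrightarrow> emb ` e \<subseteq> verts"
  using edge_subset emb_verts by blast

lemma edgesE:
  assumes "e' \<in> edges"
  obtains u v n where "{u, v} \<in> E" "u \<in> V" "v \<in> V" "u \<noteq> v" "e' = {shift n (emb u), shift n (emb v)}"
proof -
  obtain n e where e: "e \<in> E" "e' = shift n ` emb ` e" using assms by (auto simp: edges_def)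
  then obtain u v where "e = {u, v}" "u \<in> V" "v \<in> V" "u \<noteq> v" using E_pairs by (blast elim: vertex_pairsE)
  then show ?thesis using that[of u v n] e by simp
qed

lemma shift_edges: "e' \<in> edges \<Longrightarrow> shift k ` e' \<in> edges"
  using shift_image_shift[OF emb_image_verts] by (auto simp: edges_def) blast

lemma edges_simple: "simple_graph verts edges"
  unfolding simple_graph_def
proof
  fix e' assume "e' \<in> edges"
  then obtain u v n where uv: "{u, v} \<in> E" "u \<in> V" "v \<in> V" "e' = {shift n (emb u), shift n (emb v)}"
    by (rule edgesE)
  have "pos (shift n (emb u)) \<noteq> pos (shift n (emb v))"
    using nondegenerate[OF uv(1)] uv by (simp add: pos_shift pos_emb)
  then have "shift n (emb u) \<noteq> shift n (emb v)" by auto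
  then show "e' \<subseteq> verts \<and> card e' = 2" using uv by simp
qed

lemma edges_automorphism: "shift n \<in> graph_auts verts edges"
  unfolding graph_auts_def
proof (intro CollectI conjI ballI shift_Bij)
  fix x y assume xy: "x \<in> verts" "y \<in> verts"
  show "{shift n x, shift n y} \<in> edges \<longleftrightarrow> {x, y} \<in> edges"
  proof
    assume "{shift n x, shift n y} \<in> edges"
    from shift_edges[OF this, of "\<lambda>k. - n k"] show "{x, y} \<in> edges"
      using xy by (simp add: shift_inverse)
  next
    assume "{x, y} \<in> edges"
    from shift_edges[OF this, of n] show "{shift n x, shift n y} \<in> edges" by simp
  qed
qed

lemma edges_locally_finite:
  assumes w: "w \<in> verts"
  shows "finite {e' \<in> edges. w \<in> e'}"
proof (rule finite_subset)
  let ?f = "\<lambda>(e, u). shift (THE n. shift n (emb u) = w) ` emb ` e"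
  show "{e' \<in> edges. w \<in> e'} \<subseteq> ?f ` (SIGMA e:E. e)"
  proof
    fix e' assume "e' \<in> {e' \<in> edges. w \<in> e'}"
    then obtain n e u where e: "e \<in> E" "e' = shift n ` emb ` e" "u \<in> e" "shift n (emb u) = w"
      by (auto simp: edges_def)
    have "emb u \<in> verts" using e(1,3) edge_subset[OF e(1)] by auto
    then have "(THE n. shift n (emb u) = w) = n"
      using e(4) shift_free by (intro the_equality) auto
    then show "e' \<in> ?f ` (SIGMA e:E. e)" using e by force
  qed
  have "finite E" using E_pairs finite_vertex_pairs[OF finite_V] by (rule finite_subset)
  moreover have "finite e" if "e \<in> E" for e using edge_subset[OF that] finite_V by (rule finite_subset)
  ultimately show "finite (?f ` (SIGMA e:E. e))" by blast
qed

text \<open>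
  A translation that exchanges the two ends of an edge would have order two.
\<close>

lemma shift_no_fixed_edge:
  assumes e': "e' \<in> edges" and eq: "shift n ` e' = e'"
  shows "n = (\<lambda>_. 0)"
proof -
  obtain x y where xy: "e' = {x, y}" "x \<in> verts" "y \<in> verts"
    using e' by (elim edgesE) (metis emb_verts shift_verts)
  have "shift n x = x \<or> shift n x = y \<and> shift n y = x"
    using eq by (auto simp: xy doubleton_eq_iff)
  then have "shift n x = shift (\<lambda>_. 0) x \<or> shift (\<lambda>k. n k + n k) x = shift (\<lambda>_. 0) x"
    using shift_shift[OF xy(2), of n n] xy by auto
  then have "n = (\<lambda>_. 0) \<or> (\<lambda>k. n k + n k) = (\<lambda>_. 0)"
    using shift_free[OF xy(2)] by blast
  then show ?thesis by (auto simp: fun_eq_iff)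
qed

lemma vertex_orbits_shift: "vertex_orbits verts (range shift) = (\<lambda>w. range (\<lambda>n. shift n w)) ` verts"
  by (auto simp: vertex_orbits_def orbits_def orbit_def)

lemma edge_orbits_shift: "edge_orbits verts edges (range shift) = (\<lambda>e. range (\<lambda>n. shift n ` e)) ` edges"
  by (auto simp: edge_orbits_def orbits_def orbit_def)

lemma vertex_orbit_emb:
  assumes "orb \<in> vertex_orbits verts (range shift)"
  obtains v where "v \<in> V" "orb = range (\<lambda>n. shift n (emb v))"
proof -
  obtain w where w: "w \<in> verts" "orb = range (\<lambda>n. shift n w)"
    using assms by (auto simp: vertex_orbits_shift)
  obtain v m where v: "v \<in> V" "w = shift m (emb v)" using w(1) by (rule verts_cover)
  have "range (\<lambda>n. shift n w) = range (\<lambda>n. shift n (emb v))"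
  proof (intro equalityI subsetI)
    fix x assume "x \<in> range (\<lambda>n. shift n (emb v))"
    then obtain n where "x = shift n (emb v)" by blast
    then have "x = shift (\<lambda>k. n k - m k) w" using v by (simp add: shift_shift)
    then show "x \<in> range (\<lambda>n. shift n w)" by blast
  qed (use v shift_shift in auto)
  then show ?thesis using that v w by blast
qed

lemma edge_orbit_emb:
  assumes "orb \<in> edge_orbits verts edges (range shift)"
  obtains e where "e \<in> E" "orb = range (\<lambda>n. shift n ` emb ` e)"
proof -
  obtain e' where e': "e' \<in> edges" "orb = range (\<lambda>n. shift n ` e')"
    using assms by (auto simp: edge_orbits_shift)
  obtain m e where e: "e \<in> E" "e' = shift m ` emb ` e" using e'(1) by (auto simp: edges_def)
  note ss = shift_image_shift[OF emb_image_verts[OF e(1)]]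
  have "range (\<lambda>n. shift n ` e') = range (\<lambda>n. shift n ` emb ` e)"
  proof (intro equalityI subsetI)
    fix x assume "x \<in> range (\<lambda>n. shift n ` emb ` e)"
    then obtain n where "x = shift n ` emb ` e" by blast
    then have "x = shift (\<lambda>k. n k - m k) ` e'" by (simp add: e(2) ss)
    then show "x \<in> range (\<lambda>n. shift n ` e')" by blast
  qed (use e(2) ss in auto)
  then show ?thesis using that e(1) e'(2) by blast
qed

text \<open>
  A translation that carries one edge to another displaces both ends by the same \<open>k\<close>.  As the ends are
  distinct, \<open>marked_displacement_endpoints\<close> leaves only the trivial displacement.
\<close>

lemma edge_representative_unique:
  assumes e: "e \<in> E" "e' \<in> E" and eq: "emb ` e' = shift k ` emb ` e"
  shows "e' = e"
proof -
  obtain u v where uv: "e = {u, v}" "u \<in> V" "v \<in> V" "u \<noteq> v" using e(1) E_pairs by (blast elim: vertex_pairsE)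
  obtain x y where xy: "e' = {x, y}" "x \<in> V" "y \<in> V" using e(2) E_pairs by (blast elim: vertex_pairsE)
  have "shift k (emb u) = emb x \<and> shift k (emb v) = emb y \<or> shift k (emb u) = emb y \<and> shift k (emb v) = emb x"
    using eq by (auto simp: uv xy doubleton_eq_iff)
  then show ?thesis
  proof
    assume "shift k (emb u) = emb x \<and> shift k (emb v) = emb y"
    then have "marked_displacement a b u x k" "marked_displacement a b v y k"
      using uv xy by (simp_all add: shift_emb_iff)
    from marked_displacement_endpoints[OF this] show ?thesis using uv xy by auto
  next
    assume "shift k (emb u) = emb y \<and> shift k (emb v) = emb x"
    then have "marked_displacement a b u y k" "marked_displacement a b v x k"
      using uv xy by (simp_all add: shift_emb_iff)
    from marked_displacement_endpoints[OF this] show ?thesis using uv xy by auto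
  qed
qed

lemma graph_periodic: "periodic_graph CARD('d) verts edges (range shift)"
  unfolding periodic_graph_def
proof (intro conjI ballI impI)
  show "infinite verts"
  proof
    assume "finite verts"
    moreover have "range (\<lambda>c :: int. shift (\<lambda>_. c) (emb (a undefined))) \<subseteq> verts"
      using base_vertex by auto
    moreover have "inj (\<lambda>c :: int. shift (\<lambda>_. c) (emb (a undefined)))"
      using shift_free[OF base_vertex] by (auto intro!: injI dest!: fun_cong)
    ultimately show False
      using finite_subset finite_imageD infinite_UNIV_int by metis
  qed
  show "finite (vertex_orbits verts (range shift))"
    by (rule finite_subset[of _ "(\<lambda>v. range (\<lambda>n. shift n (emb v))) ` V"])
      (auto simp: finite_V elim: vertex_orbit_emb)
  have "finite E" using E_pairs finite_vertex_pairs[OF finite_V] by (rule finite_subset)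
  then have fin: "finite ((\<lambda>e. range (\<lambda>n. shift n ` emb ` e)) ` E)" by (rule finite_imageI)
  show "finite (edge_orbits verts edges (range shift))"
    by (rule finite_subset[OF _ fin]) (auto elim: edge_orbit_emb)
next
  fix \<gamma> w assume "\<gamma> \<in> range shift" "\<gamma> \<noteq> \<one>\<^bsub>BijGroup verts\<^esub>" and w: "w \<in> verts"
  then obtain n where n: "\<gamma> = shift n" "n \<noteq> (\<lambda>_. 0)" by (auto simp: one_shift)
  then show "\<gamma> w \<noteq> w" using shift_free[OF w, of n "\<lambda>_. 0"] w by auto
next
  fix \<gamma> e' assume "\<gamma> \<in> range shift" "\<gamma> \<noteq> \<one>\<^bsub>BijGroup verts\<^esub>" and e': "e' \<in> edges"
  then obtain n where n: "\<gamma> = shift n" "n \<noteq> (\<lambda>_. 0)" by (auto simp: one_shift)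
  then show "\<gamma> ` e' \<noteq> e'" using shift_no_fixed_edge[OF e'] by blast
qed (use edges_simple edges_locally_finite shift_subgroup edges_automorphism shift_group_free in auto)

lemma placement_periodic: "periodic_placement verts edges (range shift) pos translation_vector"
  unfolding periodic_placement_def
proof (intro conjI ballI allI impI)
  show "translation_vector (\<gamma> \<otimes>\<^bsub>BijGroup verts\<^esub> \<delta>) = translation_vector \<gamma> + translation_vector \<delta>"
    if "\<gamma> \<in> range shift" "\<delta> \<in> range shift" for \<gamma> \<delta>
    using that by (auto simp: mult_shift lattice_point_add)
  show "inj_on translation_vector (range shift)"
    by (rule inj_onI) (auto dest!: lattice_point_inj[OF basis])
  show "\<exists>b. is_basis b \<and> translation_vector ` range shift = lattice_of b"
    using basis by (intro exI[of _ "marked_vector p a b"]) (simp add: image_image lattice_of_eq_range)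
  show "pos (\<gamma> w) = pos w + translation_vector \<gamma>" if "\<gamma> \<in> range shift" "w \<in> verts" for \<gamma> w
    using that by (auto simp: pos_shift)
  fix x y assume xy: "{x, y} \<in> edges"
  obtain u v n where uv: "{u, v} \<in> E" "u \<in> V" "v \<in> V" "{x, y} = {shift n (emb u), shift n (emb v)}"
    using xy by (rule edgesE)
  have "pos (shift n (emb u)) \<noteq> pos (shift n (emb v))"
    using nondegenerate[OF uv(1)] uv by (simp add: pos_shift pos_emb)
  then show "pos x \<noteq> pos y" using uv(4) by (auto simp: doubleton_eq_iff)
qed

lemma associated_framework_exists:
  "associated_framework V E p a b verts edges (range shift) pos translation_vector emb"
  unfolding associated_framework_def linkage_in_periodic_framework_def periodic_framework_def
proof (intro conjI ballI)
  show "translation_vector ` range shift = lattice_of (marked_vector p a b)"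
    by (simp add: image_image lattice_of_eq_range)
  have id_image: "shift (\<lambda>_. 0) ` emb ` e = emb ` e" if "e \<in> E" for e
  proof -
    have "shift (\<lambda>_. 0) ` emb ` e = (\<lambda>w. w) ` emb ` e"
      using emb_image_verts[OF that] by (intro image_cong refl shift_zero) blast
    then show ?thesis by simp
  qed
  show "contains_linkage V E p verts edges pos emb"
    unfolding contains_linkage_def
  proof (intro conjI ballI)
    show "inj_on emb V"
    proof (rule inj_onI)
      fix u v assume uv: "u \<in> V" "v \<in> V" "emb u = emb v"
      then have "shift (\<lambda>_. 0) (emb u) = emb v" by simp
      then have "marked_displacement a b u v (\<lambda>_. 0)"
        using uv(1,2) by (intro iffD1[OF shift_emb_iff])
      then show "u = v" by (rule marked_displacement_zero)
    qed
    show "emb ` e \<in> edges" if "e \<in> E" for e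
      using id_image[OF that, symmetric] that by (auto simp: edges_def)
  qed (auto simp: pos_emb)
  show "\<exists>!e. e \<in> E \<and> emb ` e \<in> orb" if orb: "orb \<in> edge_orbits verts edges (range shift)" for orb
  proof -
    obtain e where e: "e \<in> E" "orb = range (\<lambda>n. shift n ` emb ` e)"
      using orb by (rule edge_orbit_emb)
    show ?thesis
    proof (rule ex1I[of _ e])
      show "e \<in> E \<and> emb ` e \<in> orb"
        using e id_image[OF e(1)] by (metis rangeI)
      show "e' = e" if "e' \<in> E \<and> emb ` e' \<in> orb" for e'
        using that e edge_representative_unique[OF e(1)] by auto
    qed
  qed
  show "\<exists>v\<in>V. emb v \<in> orb" if orb: "orb \<in> vertex_orbits verts (range shift)" for orb
  proof -
    obtain v where v: "v \<in> V" "orb = range (\<lambda>n. shift n (emb v))"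
      using orb by (rule vertex_orbit_emb)
    then have "shift (\<lambda>_. 0) (emb v) \<in> orb" by blast
    then show ?thesis using v(1) by auto
  qed
  show "marked_gluing V a b (range shift) emb"
    unfolding marked_gluing_def same_orbit_def
    by (auto simp: shift_emb_iff marked_equiv_iff_displacement)
qed (rule graph_periodic placement_periodic)+

end


lemma (in marked_linkage) associatedI:
  "associated_framework V E p a b W F \<Gamma> q \<pi> \<iota> \<Longrightarrow> associated V E p a b W F \<Gamma> q \<pi> \<iota>"
  by unfold_locales

section \<open>The periodic framework associated with a linkage\<close>

theorem theorem1:
  fixes V :: "'v set" and E :: "'v set set" and p :: "'v \<Rightarrow> real ^ 'd"
    and a b :: "'d \<Rightarrow> 'v" and d n m :: nat
  assumes "d = CARD('d)" and "d \<ge> 2"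
    and "linkage V E p" and "n = card V" and "m = card E"
    and "int m \<le> int n * int d - int ((d + 1) choose 2)"
    and "infinitesimally_independent E p"
    and "\<forall>k. a k \<in> V \<and> b k \<in> V \<and> a k \<noteq> b k"
    and "is_basis (marked_vector p a b)"
  shows
    "(\<exists>(W :: ('v \<times> (real ^ 'd)) set) F \<Gamma> q \<pi> \<iota>. associated_framework V E p a b W F \<Gamma> q \<pi> \<iota>) \<and>
     (\<forall>(W\<^sub>1 :: 'w1 set) F\<^sub>1 \<Gamma>\<^sub>1 q\<^sub>1 \<pi>\<^sub>1 \<iota>\<^sub>1 (W\<^sub>2 :: 'w2 set) F\<^sub>2 \<Gamma>\<^sub>2 q\<^sub>2 \<pi>\<^sub>2 \<iota>\<^sub>2.
        associated_framework V E p a b W\<^sub>1 F\<^sub>1 \<Gamma>\<^sub>1 q\<^sub>1 \<pi>\<^sub>1 \<iota>\<^sub>1 \<longrightarrow>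
        associated_framework V E p a b W\<^sub>2 F\<^sub>2 \<Gamma>\<^sub>2 q\<^sub>2 \<pi>\<^sub>2 \<iota>\<^sub>2 \<longrightarrow>
        (\<exists>\<phi>. framework_iso \<phi> W\<^sub>1 F\<^sub>1 \<Gamma>\<^sub>1 q\<^sub>1 \<pi>\<^sub>1 W\<^sub>2 F\<^sub>2 \<Gamma>\<^sub>2 q\<^sub>2 \<pi>\<^sub>2 \<and> (\<forall>v\<in>V. \<phi> (\<iota>\<^sub>1 v) = \<iota>\<^sub>2 v))) \<and>
     (\<forall>(W :: 'w set) F \<Gamma> q \<pi> \<iota>.
        associated_framework V E p a b W F \<Gamma> q \<pi> \<iota> \<longrightarrow>
        int (card (vertex_orbits W \<Gamma>)) = int n - int d \<and>
        card (edge_orbits W F \<Gamma>) = m \<and>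
        local_deformation_spaces_identified V E p W F \<Gamma> q \<pi> \<iota> \<and>
        (\<exists>f :: nat.
           int f = int n * int d - int m - int ((d + 1) choose 2) \<and>
           int f = int (card (vertex_orbits W \<Gamma>)) * int d - int (card (edge_orbits W F \<Gamma>)) + int (d choose 2) \<and>
           has_local_dimension (linkage_deformation_space V E p) (linkage_class V E p p) f \<and>
           has_local_dimension (framework_deformation_space W F \<Gamma> q) (framework_class W F \<Gamma> q q \<pi>) f))"
proof -
  have E: "E \<subseteq> vertex_pairs V"
    using assms(3) by (simp add: linkage_def simple_graph_iff_vertex_pairs)
  interpret marked_linkage V E p a b
    using assms(3,8,9) E by unfold_locales (auto simp: linkage_def)
  obtain f where f: "f + card E + ((CARD('d) + 1) choose 2) = card V * CARD('d)"
    and dim: "has_local_dimension (linkage_deformation_space V E p) (linkage_class V E p p) f"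
    using linkage_local_dimension[OF finite_V marked basis E assms(7)] by blast
  have f_eq: "int f = int n * int d - int m - int ((d + 1) choose 2)"
    using arg_cong[OF f, of int] assms(1,4,5) by simp
  have third: "int (card (vertex_orbits W \<Gamma>)) = int n - int d \<and>
        card (edge_orbits W F \<Gamma>) = m \<and>
        local_deformation_spaces_identified V E p W F \<Gamma> q \<pi> \<iota> \<and>
        (\<exists>f :: nat.
           int f = int n * int d - int m - int ((d + 1) choose 2) \<and>
           int f = int (card (vertex_orbits W \<Gamma>)) * int d - int (card (edge_orbits W F \<Gamma>)) + int (d choose 2) \<and>
           has_local_dimension (linkage_deformation_space V E p) (linkage_class V E p p) f \<and>
           has_local_dimension (framework_deformation_space W F \<Gamma> q) (framework_class W F \<Gamma> q q \<pi>) f)"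
    if assoc: "associated_framework V E p a b W F \<Gamma> q \<pi> \<iota>"
    for W :: "'w set" and F \<Gamma> q \<pi> \<iota>
  proof -
    interpret A: associated V E p a b W F \<Gamma> q \<pi> \<iota>
      by (rule associatedI[OF assoc])
    have vo: "int (card (vertex_orbits W \<Gamma>)) = int n - int d"
      using A.card_vertex_orbits assms(1,4) by simp
    have eo: "card (edge_orbits W F \<Gamma>) = m"
      using A.card_edge_orbits assms(5) by simp
    have "even (d * (d - 1))" by (cases d) auto
    then have two: "2 * (d choose 2) = d * (d - 1)"
      by (simp add: choose_two)
    have "2 * int (d choose 2) = int d * (int d - 1)"
      using arg_cong[OF two, of int] assms(2) by (simp add: of_nat_diff)
    moreover have "int ((d + 1) choose 2) = int d + int (d choose 2)"
      by (simp add: numeral_2_eq_2)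
    ultimately have "int f = int (card (vertex_orbits W \<Gamma>)) * int d - int (card (edge_orbits W F \<Gamma>)) + int (d choose 2)"
      unfolding vo eo f_eq by (simp add: algebra_simps)
    then show ?thesis
      using vo eo A.deformation_spaces_identified f_eq dim A.framework_local_dimension[OF dim] by blast
  qed
  show ?thesis
  proof (intro conjI[OF _ conjI] allI impI)
    show "\<exists>(W :: ('v \<times> (real ^ 'd)) set) F \<Gamma> q \<pi> \<iota>. associated_framework V E p a b W F \<Gamma> q \<pi> \<iota>"
      using associated_framework_exists by blast
  next
    fix W\<^sub>1 :: "'w1 set" and F\<^sub>1 \<Gamma>\<^sub>1 q\<^sub>1 \<pi>\<^sub>1 \<iota>\<^sub>1 and W\<^sub>2 :: "'w2 set" and F\<^sub>2 \<Gamma>\<^sub>2 q\<^sub>2 \<pi>\<^sub>2 \<iota>\<^sub>2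
    assume A: "associated_framework V E p a b W\<^sub>1 F\<^sub>1 \<Gamma>\<^sub>1 q\<^sub>1 \<pi>\<^sub>1 \<iota>\<^sub>1"
      "associated_framework V E p a b W\<^sub>2 F\<^sub>2 \<Gamma>\<^sub>2 q\<^sub>2 \<pi>\<^sub>2 \<iota>\<^sub>2"
    show "\<exists>\<phi>. framework_iso \<phi> W\<^sub>1 F\<^sub>1 \<Gamma>\<^sub>1 q\<^sub>1 \<pi>\<^sub>1 W\<^sub>2 F\<^sub>2 \<Gamma>\<^sub>2 q\<^sub>2 \<pi>\<^sub>2 \<and> (\<forall>v\<in>V. \<phi> (\<iota>\<^sub>1 v) = \<iota>\<^sub>2 v)"
      by (rule associated_framework_unique[OF associatedI[OF A(1)] associatedI[OF A(2)]])
  qed (drule third, blast)+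
qed


end
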